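(* There exist an increasing function $\Phi\colon(0,\infty)\to(0,1)$ with $\Phi(\tau)\to 1$ as $\tau\to\infty$, and a function $\lambda$ defined on $[1,\infty)$, such that $$\Phi(\tau)=\lambda\left(\coth\frac{\pi^2}{2\tau}\right)\ (\tau>0),\qquad \lambda(t)\ge \frac{\log t-\log(1+\log t)}{2+\log t}\ \ (t\ge 1),$$ and such that the following holds: if $\Omega,\Omega^*\subset\mathbb{C}$ are doubly connected domains, $\Omega$ is nondegenerate, and there is a harmonic homeomorphism $h$ from $\Omega$ onto $\Omega^*$, then $$\frac{\operatorname{Mod}_@\Omega^*}{\operatorname{Mod}\Omega}\ge \Phi(\operatorname{Mod}\Omega).$$
   Context: A domain $\Omega\subset\mathbb{C}$ is doubly connected if $\widehat{\mathbb{C}}\setminus\Omega$ has exactly two connected components ($\widehat{\mathbb{C}}$ is the Riemann sphere); it is nondegenerate if both components contain more than one point. A nondegenerate doubly connected domain $\Omega$ is conformally equivalent to an annulus $\{z: r<|z|<R\}$ with $0<r<R<\infty$, where $R/r$ depends only on $\Omega$; its conformal modulus is $\operatorname{Mod}\Omega=\log(R/r)$. If $\Omega$ is degenerate, set $\operatorname{Mod}\Omega=\infty$. An affine automorphism of $\mathbb{C}$ is a map $z\mapsto az+b\bar z+c$ with $a,b,c\in\mathbb{C}$ and $|a|^2-|b|^2\neq 0$. The affine modulus of a doubly connected domain $\Omega$ is $\operatorname{Mod}_@\Omega=\sup\{\operatorname{Mod}\phi(\Omega):\ \phi\colon\mathbb{C}\to\mathbb{C}\text{ an affine automorphism}\}\in(0,\infty]$.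 If $\operatorname{Mod}_@\Omega^*=\infty$ the quotient in the claim is $\infty$. A complex-valued map is harmonic if its real and imaginary parts are harmonic functions (no Cauchy–Riemann relation is required). *)

theory Defs
  imports "HOL-Complex_Analysis.Complex_Analysis"
begin

definition coth :: "real \<Rightarrow> real" where
  "coth x = cosh x / sinh x"

text \<open>The Riemann sphere is the one-point compactification of the plane: a finite point \<open>z\<close> is
  \<open>Some z\<close>, and \<open>None\<close> is the point at infinity.\<close>

definition riemann_sphere :: "complex option topology" where
  "riemann_sphere = Alexandroff_compactification euclidean"

definition complementary_components :: "complex set \<Rightarrow> complex option set set" where
  "complementary_components \<Omega> =
     connected_components_of (subtopology riemann_sphere (topspace riemann_sphere - Some ` \<Omega>))"

definition doubly_connected_domain :: "complex set \<Rightarrow> bool" where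
  "doubly_connected_domain \<Omega> \<longleftrightarrow>
     \<Omega> \<noteq> {} \<and> open \<Omega> \<and> connected \<Omega> \<and> card (complementary_components \<Omega>) = 2"

definition nondegenerate :: "complex set \<Rightarrow> bool" where
  "nondegenerate \<Omega> \<longleftrightarrow> (\<forall>C \<in> complementary_components \<Omega>. \<exists>p\<in>C. \<exists>q\<in>C. p \<noteq> q)"

definition annulus :: "real \<Rightarrow> real \<Rightarrow> complex set" where
  "annulus r R = {z. r < cmod z \<and> cmod z < R}"

definition conformally_equivalent :: "complex set \<Rightarrow> complex set \<Rightarrow> bool" where
  "conformally_equivalent \<Omega> \<Omega>' \<longleftrightarrow> (\<exists>f. f holomorphic_on \<Omega> \<and> bij_betw f \<Omega> \<Omega>')"

text \<open>Meaningful for doubly connected domains only. In the nondegenerate case the number described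
  exists and is unique, by classical theorems not proved here.\<close>

definition conformal_modulus :: "complex set \<Rightarrow> ereal" where
  "conformal_modulus \<Omega> =
     (if nondegenerate \<Omega>
      then ereal (THE m. \<exists>r R. 0 < r \<and> r < R \<and> conformally_equivalent \<Omega> (annulus r R) \<and> m = ln (R / r))
      else \<infinity>)"

definition affine_automorphism :: "(complex \<Rightarrow> complex) \<Rightarrow> bool" where
  "affine_automorphism \<phi> \<longleftrightarrow>
     (\<exists>a b c. (cmod a)\<^sup>2 - (cmod b)\<^sup>2 \<noteq> 0 \<and> \<phi> = (\<lambda>z. a * z + b * cnj z + c))"

definition affine_modulus :: "complex set \<Rightarrow> ereal" where
  "affine_modulus \<Omega> = (SUP \<phi> \<in> Collect affine_automorphism. conformal_modulus (\<phi> ` \<Omega>))"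

text \<open>\<open>u\<close> is twice continuously differentiable on \<open>S\<close> with vanishing Laplacian. The witnesses
  \<open>ux\<close>, \<open>uy\<close>, \<open>uxx\<close>, \<open>uxy\<close>, \<open>uyx\<close>, \<open>uyy\<close> are its partial derivatives, uniquely determined on the
  open set \<open>S\<close>.\<close>

definition harmonic_real_on :: "(complex \<Rightarrow> real) \<Rightarrow> complex set \<Rightarrow> bool" where
  "harmonic_real_on u S \<longleftrightarrow> open S \<and>
     (\<exists>ux uy uxx uxy uyx uyy :: complex \<Rightarrow> real.
        continuous_on S uxx \<and> continuous_on S uxy \<and> continuous_on S uyx \<and> continuous_on S uyy \<and>
        (\<forall>z\<in>S. (u has_derivative (\<lambda>w. ux z * Re w + uy z * Im w)) (at z) \<and>
               (ux has_derivative (\<lambda>w. uxx z * Re w + uxy z * Im w)) (at z) \<and>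
               (uy has_derivative (\<lambda>w. uyx z * Re w + uyy z * Im w)) (at z) \<and>
               uxx z + uyy z = 0))"

definition harmonic_on :: "(complex \<Rightarrow> complex) \<Rightarrow> complex set \<Rightarrow> bool" where
  "harmonic_on h S \<longleftrightarrow> harmonic_real_on (\<lambda>z. Re (h z)) S \<and> harmonic_real_on (\<lambda>z. Im (h z)) S"

end

theory Submission
  imports Defs "HOL-Real_Asymp.Real_Asymp"
begin

text \<open>
  Let \<open>\<tau>\<close> be the modulus of \<open>\<Omega>\<close>, so that \<open>\<Omega>\<close> is the conformal image of the annulus with logarithmic
  radii between \<open>- \<tau> / 2\<close> and \<open>\<tau> / 2\<close>.  After a conjugation, if needed, the harmonic homeomorphism \<open>h\<close>
  preserves the orientation.  Then its derivative is \<open>v \<mapsto> a v + cnj (\<nu> a v)\<close> with holomorphic \<open>a\<close> and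
  \<open>\<nu>\<close> and \<open>\<bar>\<nu>\<bar> < 1\<close>, see \<open>injective_harmonic_beltrami\<close>.  Composing \<open>h\<close> with an affine automorphism of the
  plane changes \<open>\<nu>\<close> by a Moebius transformation of the disc, and so the affine map can be chosen such
  that \<open>\<nu>\<close> vanishes at a point of the middle circle.

  The lift of \<open>\<nu>\<close> to the logarithmic strip has period \<open>2\<pi>\<i>\<close>.  The Schwarz lemma in the strip bounds it
  on the middle line by \<open>tanh (\<pi>\<^sup>2 / (2 \<tau>)) = exp (- L)\<close>, where \<open>exp L\<close> is the hyperbolic cotangent in
  the statement.  Hadamard's three lines argument then gives \<open>\<bar>\<nu>\<bar> \<le> exp (- L (1 - y))\<close> on the middle part of
  relative width \<open>y\<close>, see \<open>strip_decay\<close>.  With \<open>y = 1 - ln (1 + L) / L\<close> this bound is \<open>k = 1 / (1 + L)\<close>, so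
  on that part the map is \<open>K\<close>-quasiconformal with \<open>K = (1 + k) / (1 - k) = (2 + L) / L\<close>.

  Quasiconformality bounds the modulus of the image from below by \<open>y \<tau> / K\<close>, see
  \<open>annulus_quasiconformal_modulus\<close>.  This is the length-area method: images of the concentric circles
  wind around the image ring, so they are long in the logarithmic metric, and their lengths bound
  the area of the image, which is at most \<open>2\<pi>\<close> times its modulus.  Finally
  \<open>y / K = (L - ln (1 + L)) / (2 + L)\<close>, which is the function of \<open>\<tau>\<close> in the theorem.

  The modulus of a nondegenerate doubly connected domain is meaningful because such a domain is
  conformally an annulus, and because of its uniqueness.  Uniqueness is the case \<open>K = 1\<close> of the
  distortion inequality.  For existence, put the origin into the bounded complementary component.  The preimage of
  the domain under the exponential map is simply connected, and the Riemann map takes it to a disc.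
  There, translation by \<open>2\<pi>\<i>\<close> becomes an automorphism without fixed points.  In a suitable
  half-plane coordinate it is \<open>z \<mapsto> l z\<close> or \<open>z \<mapsto> z + \<beta>\<close>.  The quotient is an annulus in the
  first case and a punctured disc in the second, and nondegeneracy excludes the second
  (\<open>doubly_connected_uniformization\<close>).
\<close>


section \<open>The profile function\<close>

text \<open>The lower bound of the theorem as a function of \<open>L = ln t\<close>.\<close>

definition lower_profile :: "real \<Rightarrow> real" where
  "lower_profile L = (L - ln (1 + L)) / (2 + L)"

lemma lower_profile_strict_mono: "strict_mono_on {0<..} lower_profile"
proof (rule strict_mono_onI)
  fix x y :: real assume "x \<in> {0<..}" "y \<in> {0<..}" and xy: "x < y"
  then have x: "x > 0" by simp
  show "lower_profile x < lower_profile y"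
  proof (rule DERIV_pos_imp_increasing[OF xy])
    fix t assume "x \<le> t" "t \<le> y"
    with x have t: "t > 0" by simp
    have "(lower_profile has_real_derivative
        ((1 - 1 / (1 + t)) * (2 + t) - (t - ln (1 + t))) / (2 + t)\<^sup>2) (at t)"
      unfolding lower_profile_def using t
      by (auto intro!: derivative_eq_intros simp: power2_eq_square)
    moreover have "(1 - 1 / (1 + t)) * (2 + t) - (t - ln (1 + t)) = t / (1 + t) + ln (1 + t)"
      using t by (simp add: field_simps)
    moreover have "t / (1 + t) + ln (1 + t) > 0"
      using t by (intro add_pos_pos) auto
    ultimately show "\<exists>D. DERIV lower_profile t :> D \<and> 0 < D"
      using t by (intro exI[of _ "(t / (1 + t) + ln (1 + t)) / (2 + t)\<^sup>2"]) simp
  qed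
qed

lemma lower_profile_bounds:
  assumes "L > 0"
  shows "0 < lower_profile L" "lower_profile L < 1"
proof -
  have "ln (1 + L) < L" using assms ln_add_one_self_less_self by blast
  moreover have "ln (1 + L) > 0" using assms by simp
  moreover have "2 + ln (1 + L) > 0" using calculation by linarith
  ultimately show "0 < lower_profile L" "lower_profile L < 1"
    using assms by (auto simp: lower_profile_def divide_less_eq)
qed

text \<open>The reciprocal of \<open>tanh (\<pi>\<^sup>2 / (2 \<tau>))\<close>.  In the hyperbolic metric of curvature \<open>-1\<close> on the annulus of
  modulus \<open>\<tau>\<close>, the middle circle is a geodesic of length \<open>2\<pi>\<^sup>2 / \<tau>\<close>, so its points have distances at most
  \<open>\<pi>\<^sup>2 / \<tau>\<close>, and the Schwarz lemma gives \<open>tanh\<close> of half the distance as a bound.\<close>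

definition mid_circle_bound :: "real \<Rightarrow> real" where
  "mid_circle_bound \<tau> = coth (pi\<^sup>2 / (2 * \<tau>))"

lemma coth_gt_1: "x > 0 \<Longrightarrow> coth x > 1"
  by (simp add: coth_def) (smt (verit) cosh_real_pos cosh_minus_sinh exp_gt_zero)

lemma coth_antimono: 
  assumes "0 < x" "x < y" shows "coth y < coth x"
proof -
  have s: "sinh x > 0" "sinh y > 0" "sinh (y - x) > 0" using assms by auto
  have "cosh x * sinh y - cosh y * sinh x = sinh (y - x)"
    by (simp add: sinh_diff)
  then have "cosh y * sinh x < cosh x * sinh y" using s by linarith
  then show ?thesis using s by (simp add: coth_def field_simps)
qed

lemma mid_circle_bound_gt_1: "\<tau> > 0 \<Longrightarrow> mid_circle_bound \<tau> > 1"
  unfolding mid_circle_bound_def by (rule coth_gt_1) simp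

lemma mid_circle_bound_mono:
  assumes "0 < \<tau>" "\<tau> < \<tau>'" shows "mid_circle_bound \<tau> < mid_circle_bound \<tau>'"
  unfolding mid_circle_bound_def using assms
  by (intro coth_antimono) (auto simp: field_simps)

definition modulus_profile :: "real \<Rightarrow> real" where
  "modulus_profile \<tau> = lower_profile (ln (mid_circle_bound \<tau>))"

lemma modulus_profile_strict_mono: "strict_mono_on {0<..} modulus_profile"
proof (rule strict_mono_onI)
  fix x y :: real assume "x \<in> {0<..}" "y \<in> {0<..}" and xy: "x < y"
  then have "ln (mid_circle_bound x) < ln (mid_circle_bound y)" "0 < ln (mid_circle_bound x)"
    using mid_circle_bound_gt_1[of x] mid_circle_bound_mono[of x y] by auto
  then show "modulus_profile x < modulus_profile y"
    unfolding modulus_profile_def using strict_mono_onD[OF lower_profile_strict_mono] by auto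
qed

lemma modulus_profile_bounds:
  assumes "\<tau> > 0" shows "0 < modulus_profile \<tau>" "modulus_profile \<tau> < 1"
  unfolding modulus_profile_def using assms mid_circle_bound_gt_1[of \<tau>]
  by (auto intro!: lower_profile_bounds)

lemma modulus_profile_tendsto: "(modulus_profile \<longlongrightarrow> 1) at_top"
proof -
  have "filterlim mid_circle_bound at_top at_top"
  proof -
    have 2: "(2 * a + 2 * b) / (2 * a - 2 * b) = (a + b) / (a - b)" for a b :: real
      by (metis distrib_left mult_divide_mult_cancel_left right_diff_distrib zero_neq_numeral)
    have eq: "mid_circle_bound = (\<lambda>\<tau>. (exp (pi\<^sup>2 / (2 * \<tau>)) + exp (- (pi\<^sup>2 / (2 * \<tau>)))) /
        (exp (pi\<^sup>2 / (2 * \<tau>)) - exp (- (pi\<^sup>2 / (2 * \<tau>)))))"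
      unfolding mid_circle_bound_def coth_def sinh_field_def cosh_field_def
      by (rule ext, subst 2[symmetric]) (simp add: mult.commute)
    show ?thesis unfolding eq by real_asymp
  qed
  then have 1: "filterlim (\<lambda>\<tau>. ln (mid_circle_bound \<tau>)) at_top at_top"
    using filterlim_compose ln_at_top by blast
  have "(lower_profile \<longlongrightarrow> 1) at_top"
    unfolding lower_profile_def by real_asymp
  from filterlim_compose[OF this 1] show ?thesis
    unfolding modulus_profile_def .
qed

section \<open>Complements in the Riemann sphere\<close>

lemma openin_sphere_Some: "openin riemann_sphere (Some ` U) \<longleftrightarrow> open U"
  by (simp add: riemann_sphere_def)

lemma openin_sphere_infinity: 
  "openin riemann_sphere (insert None (Some ` U)) \<longleftrightarrow> compact (- U)"
proof
  assume "openin riemann_sphere (insert None (Some ` U))"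
  then obtain C where C: "compact C" "insert None (Some ` U) = insert None (Some ` (- C))"
    unfolding riemann_sphere_def openin_Alexandroff_compactification
    by (auto simp: Compl_eq_Diff_UNIV)
  then have "Some ` U = Some ` (- C)" by blast
  then have "U = - C" by (simp add: inj_image_eq_iff)
  then show "compact (- U)" using C by simp
next
  assume "compact (- U)"
  then show "openin riemann_sphere (insert None (Some ` U))"
    unfolding riemann_sphere_def openin_Alexandroff_compactification
    by (intro disjI2 exI[of _ "- U"]) (auto simp: compact_imp_closed)
qed

lemma topspace_sphere: "topspace riemann_sphere = UNIV"
  by (auto simp: riemann_sphere_def) (metis not_None_eq rangeI)

lemma Compl_image_Some: "- Some ` M = insert None (Some ` (- M))"
  by (rule set_eqI, rename_tac x, case_tac x) auto

abbreviation sphere_complement :: "complex set \<Rightarrow> complex option topology" where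
  "sphere_complement \<Omega> \<equiv> subtopology riemann_sphere (- Some ` \<Omega>)"

lemma complementary_components_alt:
  "complementary_components \<Omega> = connected_components_of (sphere_complement \<Omega>)"
  by (simp add: complementary_components_def topspace_sphere Compl_eq_Diff_UNIV)

text \<open>The first claim is openness of \<open>\<Omega> \<union> M\<close> in the sphere.  The second holds because a compact set of finite
  points stays closed when the point at infinity is added.\<close>

lemma clopen_sphere_complement:
  assumes "open \<Omega>" "compact M" "M \<inter> \<Omega> = {}" "open (\<Omega> \<union> M)"
  shows "openin (sphere_complement \<Omega>) (Some ` M)" "closedin (sphere_complement \<Omega>) (Some ` M)"
proof -
  have "openin riemann_sphere (Some ` (\<Omega> \<union> M))"
    using assms by (simp only: openin_sphere_Some)
  moreover have "Some ` M = Some ` (\<Omega> \<union> M) \<inter> - Some ` \<Omega>" using assms by auto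
  ultimately show "openin (sphere_complement \<Omega>) (Some ` M)"
    unfolding openin_subtopology by blast
  have "openin riemann_sphere (insert None (Some ` (- M)))"
    using assms by (simp add: openin_sphere_infinity)
  moreover have "insert None (Some ` (- M)) = - Some ` M"
    by (simp add: Compl_image_Some)
  ultimately have "closedin riemann_sphere (Some ` M)"
    by (simp add: closedin_def topspace_sphere Compl_eq_Diff_UNIV)
  moreover have "Some ` M = Some ` M \<inter> - Some ` \<Omega>" using assms by auto
  ultimately show "closedin (sphere_complement \<Omega>) (Some ` M)"
    unfolding closedin_subtopology by blast
qed

lemma component_subset_clopen:
  assumes "C \<in> connected_components_of X" "openin X M" "closedin X M" "C \<inter> M \<noteq> {}"
  shows "C \<subseteq> M"
proof -
  have C: "connectedin X C" using assms(1) connectedin_connected_components_of by blast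
  show ?thesis
    using connectedin_clopen_cases[OF C assms(3,2)] assms(4) by (auto simp: disjnt_def)
qed

text \<open>The part of double connectivity that matters in the plane: the complement of \<open>\<Omega>\<close> has exactly one
  nonempty compact relatively open subset \<open>K\<close>, the bounded complementary component.  Unlike
  the definition by components in the sphere, it is visibly invariant under homeomorphisms
  of the plane.\<close>

definition ring_with_hole :: "complex set \<Rightarrow> complex set \<Rightarrow> bool" where
  "ring_with_hole \<Omega> K \<longleftrightarrow> open \<Omega> \<and> connected \<Omega> \<and> \<Omega> \<noteq> {} \<and> compact K \<and> K \<noteq> {} \<and> K \<inter> \<Omega> = {} \<and>
     open (\<Omega> \<union> K) \<and> (\<forall>M. compact M \<and> M \<inter> \<Omega> = {} \<and> open (\<Omega> \<union> M) \<longrightarrow> M = {} \<or> M = K)"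

text \<open>Two components are clopen in the complement.  The one without the point at infinity is compact in
  the plane, and a clopen set that avoids infinity is empty or equal to it.\<close>

lemma doubly_connected_imp_ring_with_hole:
  assumes "doubly_connected_domain \<Omega>"
  obtains K where "ring_with_hole \<Omega> K"
proof -
  let ?X = "sphere_complement \<Omega>"
  have \<Omega>: "open \<Omega>" "connected \<Omega>" "\<Omega> \<noteq> {}" and c2: "card (connected_components_of ?X) = 2"
    using assms by (auto simp: doubly_connected_domain_def complementary_components_alt)
  have topX: "topspace ?X = - Some ` \<Omega>" by (simp add: topspace_sphere)
  have None: "None \<in> \<Union> (connected_components_of ?X)"
    unfolding Union_connected_components_of topX by auto
  then obtain C0 where C0: "C0 \<in> connected_components_of ?X" "None \<in> C0" by blast
  obtain C1 where C1: "connected_components_of ?X = {C0, C1}" "C0 \<noteq> C1"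
  proof -
    obtain x y where "connected_components_of ?X = {x, y}" "x \<noteq> y" using c2 by (auto simp: card_2_iff)
    then show thesis using C0(1) that[of x] that[of y] by (metis empty_iff insert_commute insert_iff)
  qed
  have disj: "C0 \<inter> C1 = {}"
    using pairwise_disjoint_connected_components_of[of ?X] C1 by (auto simp: pairwise_def disjnt_def)
  have Un: "C0 \<union> C1 = - Some ` \<Omega>"
    using Union_connected_components_of[of ?X] C1 topX by simp
  have sph_closed: "closedin riemann_sphere (- Some ` \<Omega>)"
    using \<Omega> openin_sphere_Some[of \<Omega>] by (simp add: closedin_def topspace_sphere Compl_eq_Diff_UNIV[symmetric])
  have cl: "closedin riemann_sphere C0" "closedin riemann_sphere C1"
    using closedin_trans_full[OF closedin_connected_components_of sph_closed] C1 by auto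
  define K where "K = {z. Some z \<in> C1}"
  have "x \<in> C1 \<longleftrightarrow> x \<in> Some ` K" for x
    using disj C0(2) by (cases x) (auto simp: K_def)
  then have C1K: "C1 = Some ` K" by blast
  have C0K: "- C0 = Some ` (\<Omega> \<union> K)"
    using Un disj C1K C0(2) by (auto simp: image_Un)
  have "openin riemann_sphere (- C0)" "openin riemann_sphere (- C1)"
    using cl by (auto simp: closedin_def topspace_sphere Compl_eq_Diff_UNIV)
  moreover have "- C1 = insert None (Some ` (- K))"
    by (simp add: C1K Compl_image_Some)
  ultimately have op: "open (\<Omega> \<union> K)" and co: "compact K"
    using openin_sphere_infinity[of "-K"] openin_sphere_Some[of "\<Omega> \<union> K"] C0K by simp_all
  have "C1 \<noteq> {}" using nonempty_connected_components_of[of C1 ?X] C1 by simp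
  then have "K \<noteq> {}" using C1K by auto
  moreover have "K \<inter> \<Omega> = {}" using Un C1K by auto
  moreover have "M = {} \<or> M = K" if M: "compact M" "M \<inter> \<Omega> = {}" "open (\<Omega> \<union> M)" for M
  proof -
    note clo = clopen_sphere_complement[OF \<Omega>(1) M]
    have "C0 \<inter> Some ` M = {}"
      using component_subset_clopen[OF C0(1) clo] C0(2) by auto
    moreover have "Some ` M \<subseteq> C0 \<union> C1" unfolding Un using M by auto
    ultimately have "Some ` M \<subseteq> C1" by blast
    then have sub: "Some ` M \<subseteq> Some ` K" using C1K by simp
    have C1c: "C1 \<in> connected_components_of ?X" using C1 by simp
    show ?thesis
    proof (cases "M = {}")
      case False
      then have "C1 \<inter> Some ` M \<noteq> {}" using sub C1K by auto
      then have "Some ` K \<subseteq> Some ` M" using component_subset_clopen[OF C1c clo] C1K by simp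
      then show ?thesis using sub by (simp add: inj_image_subset_iff)
    qed simp
  qed
  ultimately show thesis using that[of K] \<Omega> op co by (simp add: ring_with_hole_def)
qed

text \<open>Otherwise \<open>{k}\<close> would be clopen in the complement and hence a component.\<close>

lemma nondegenerate_no_isolated_point:
  assumes "nondegenerate \<Omega>" "open \<Omega>" "k \<notin> \<Omega>"
  shows "\<not> open (insert k \<Omega>)"
proof
  assume "open (insert k \<Omega>)"
  then have clo: "openin (sphere_complement \<Omega>) (Some ` {k})" "closedin (sphere_complement \<Omega>) (Some ` {k})"
    using clopen_sphere_complement[of \<Omega> "{k}"] assms by auto
  have "Some k \<in> \<Union> (connected_components_of (sphere_complement \<Omega>))"
    unfolding Union_connected_components_of using assms by (auto simp: topspace_sphere)
  then obtain C where C: "C \<in> connected_components_of (sphere_complement \<Omega>)" "Some k \<in> C" by blast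
  then have "C \<subseteq> {Some k}" using component_subset_clopen[OF C(1) clo] by auto
  then show False using assms C unfolding nondegenerate_def complementary_components_alt by blast
qed

text \<open>Otherwise the point at infinity would be isolated in the complement and form a component.\<close>

lemma nondegenerate_unbounded_complement:
  assumes "nondegenerate \<Omega>" "open \<Omega>"
  shows "\<not> bounded (- \<Omega>)"
proof
  assume "bounded (- \<Omega>)"
  then have clo: "openin (sphere_complement \<Omega>) (Some ` (-\<Omega>))" "closedin (sphere_complement \<Omega>) (Some ` (-\<Omega>))"
    using clopen_sphere_complement[of \<Omega> "-\<Omega>"] assms by (auto simp: compact_eq_bounded_closed)
  have "None \<in> \<Union> (connected_components_of (sphere_complement \<Omega>))"
    unfolding Union_connected_components_of by (auto simp: topspace_sphere)
  then obtain C where C: "C \<in> connected_components_of (sphere_complement \<Omega>)" "None \<in> C" by blast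
  have sub: "C \<subseteq> - Some ` \<Omega>" using connected_components_of_subset[OF C(1)] by (auto simp: topspace_sphere)
  have "C \<inter> Some ` (- \<Omega>) = {}" using component_subset_clopen[OF C(1) clo] C(2) by blast
  then have "C \<subseteq> {None}" using sub by (auto simp: Compl_image_Some)
  then show False using assms C unfolding nondegenerate_def complementary_components_alt by blast
qed

section \<open>Simply connected preimages under the exponential\<close>

lemma continuous_log_on_convex:
  fixes f :: "'a::real_normed_vector \<Rightarrow> complex"
  assumes "convex S" "continuous_on S f" "\<And>z. z \<in> S \<Longrightarrow> f z \<noteq> 0"
  shows "\<exists>g. continuous_on S g \<and> (\<forall>z\<in>S. f z = exp (g z))"
  using continuous_logarithm_on_contractible[of S f] convex_imp_contractible[OF assms(1)] assms(2,3)
  by metis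

text \<open>A bounded component of the complement would, by the Sura-Bura theorem, be contained in a compact
  relatively open subset of the complement.\<close>

lemma no_hole_imp_simply_connected:
  fixes D :: "complex set"
  assumes D: "open D" "connected D"
    and hole: "\<And>M. compact M \<Longrightarrow> M \<inter> D = {} \<Longrightarrow> open (D \<union> M) \<Longrightarrow> M = {}"
  shows "simply_connected D"
proof -
  have "\<not> bounded C" if C: "C \<in> components (- D)" for C
  proof
    assume "bounded C"
    have cD: "closed (- D)" using D(1) by (simp add: closed_Compl)
    then have "compact C"
      using closed_components[OF _ C] \<open>bounded C\<close> by (simp add: compact_eq_bounded_closed)
    then obtain M where M: "openin (top_of_set (- D)) M" "compact M" "C \<subseteq> M" "M \<subseteq> UNIV"
      by (rule Sura_Bura_clopen_subset[OF closed_imp_locally_compact[OF cD] C _ open_UNIV subset_UNIV])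
    then obtain T where T: "open T" "M = - D \<inter> T" by (auto simp: openin_open)
    then have "D \<union> M = D \<union> T" by auto
    then have "M = {}" using hole[OF M(2)] T D by auto
    then show False using M(3) in_components_nonempty[OF C] by simp
  qed
  then show ?thesis using D by (simp add: simply_connected_eq_unbounded_complement_components)
qed

text \<open>A compact relatively open part \<open>N\<close> of the complement of \<open>\<Omega> \<union> K\<close> would make \<open>K \<union> N\<close> such a part of the
  complement of \<open>\<Omega>\<close>, and \<open>K\<close> is the only one.\<close>

lemma ring_with_hole_filled:
  assumes "ring_with_hole \<Omega> K"
  shows "open (\<Omega> \<union> K)" "simply_connected (\<Omega> \<union> K)"
proof -
  have r: "open \<Omega>" "connected \<Omega>" "\<Omega> \<noteq> {}" "compact K" "K \<noteq> {}" "K \<inter> \<Omega> = {}" "open (\<Omega> \<union> K)"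
    and M: "\<And>M. compact M \<Longrightarrow> M \<inter> \<Omega> = {} \<Longrightarrow> open (\<Omega> \<union> M) \<Longrightarrow> M = {} \<or> M = K"
    using assms unfolding ring_with_hole_def by blast+
  show "open (\<Omega> \<union> K)" by fact
  have "connected (\<Omega> \<union> K)"
  proof (rule connectedI)
    fix A B assume AB: "open A" "open B" "A \<inter> (\<Omega> \<union> K) \<noteq> {}" "B \<inter> (\<Omega> \<union> K) \<noteq> {}"
      "A \<inter> B \<inter> (\<Omega> \<union> K) = {}" "\<Omega> \<union> K \<subseteq> A \<union> B"
    have *: False if AB: "open A" "open B" "B \<inter> (\<Omega> \<union> K) \<noteq> {}"
      "A \<inter> B \<inter> (\<Omega> \<union> K) = {}" "\<Omega> \<union> K \<subseteq> A \<union> B" and sub: "\<Omega> \<subseteq> A" for A B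
    proof -
      have "B \<inter> (\<Omega> \<union> K) = K - A" using AB sub by auto
      moreover have "compact (K - A)" using r AB by (simp add: compact_diff)
      moreover have "open (B \<inter> (\<Omega> \<union> K))" using AB r by auto
      ultimately have "B \<inter> (\<Omega> \<union> K) = {} \<or> B \<inter> (\<Omega> \<union> K) = UNIV"
        using compact_imp_closed connected_UNIV[where 'a=complex] clopen by metis
      moreover have "B \<inter> (\<Omega> \<union> K) \<noteq> UNIV"
        using \<open>compact (K - A)\<close> \<open>B \<inter> (\<Omega> \<union> K) = K - A\<close> not_compact_UNIV[where 'a=complex] by auto
      ultimately show False using AB by auto
    qed
    have "\<Omega> \<subseteq> A \<or> \<Omega> \<subseteq> B"
      using connectedD[OF r(2) AB(1,2)] AB by blast
    then show False using *[of A B] *[of B A] AB by (auto simp: Int_ac Un_ac)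
  qed
  then show "simply_connected (\<Omega> \<union> K)"
  proof (rule no_hole_imp_simply_connected[OF r(7)])
    fix N assume N: "compact N" "N \<inter> (\<Omega> \<union> K) = {}" "open (\<Omega> \<union> K \<union> N)"
    have "K \<union> N = {} \<or> K \<union> N = K"
      by (rule M) (use N r in \<open>auto simp: Un_assoc\<close>)
    then show "N = {}" using N r by auto
  qed
qed

text \<open>A lifted loop in \<open>\<Omega>\<close> that winds exactly once around the hole.  It is the preimage of a
  circle close to the boundary under a Riemann map of the simply connected domain \<open>\<Omega> \<union> K\<close>.\<close>

lemma ring_with_hole_loop:
  assumes R: "ring_with_hole \<Omega> K" and 0: "0 \<in> K" and unb: "\<not> bounded (- \<Omega>)"
  obtains c :: "real \<Rightarrow> complex" where "continuous_on {0..1} c"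
    "\<And>t. t \<in> {0..1} \<Longrightarrow> exp (c t) \<in> \<Omega>" "c 1 = c 0 + 2 * of_real pi * \<i>"
proof -
  have r: "open \<Omega>" "connected \<Omega>" "\<Omega> \<noteq> {}" "compact K" "K \<noteq> {}" "K \<inter> \<Omega> = {}" "open (\<Omega> \<union> K)"
    using R unfolding ring_with_hole_def by blast+
  have "\<Omega> \<union> K \<noteq> UNIV"
  proof
    assume "\<Omega> \<union> K = UNIV"
    then have "- \<Omega> \<subseteq> K" by auto
    then show False using unb r bounded_subset compact_imp_bounded by blast
  qed
  then obtain f g where fg: "f holomorphic_on (\<Omega> \<union> K)" "g holomorphic_on ball 0 1"
     "\<And>z. z \<in> \<Omega> \<union> K \<Longrightarrow> f z \<in> ball 0 1 \<and> g (f z) = z"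
     "\<And>z. z \<in> ball 0 1 \<Longrightarrow> g z \<in> \<Omega> \<union> K \<and> f (g z) = z"
    using Riemann_mapping_theorem[of "\<Omega> \<union> K"] ring_with_hole_filled[OF R] r by (metis Un_empty)
  have "f 0 \<in> ball 0 1" using fg 0 by auto
  then obtain f1 g1 where h: "f1 (f 0) = 0" "f1 holomorphic_on ball 0 1" "f1 ` ball 0 1 \<subseteq> ball 0 1"
        "g1 holomorphic_on ball 0 1" "g1 ` ball 0 1 \<subseteq> ball 0 1"
        "\<And>z. z \<in> ball 0 1 \<Longrightarrow> f1 (g1 z) = z" "\<And>z. z \<in> ball 0 1 \<Longrightarrow> g1 (f1 z) = z"
    using ball_biholomorphism_exists by metis
  define F where "F = (\<lambda>z. f1 (f z))"
  define G where "G = (\<lambda>z. g (g1 z))"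
  have F: "F holomorphic_on (\<Omega> \<union> K)"
    unfolding F_def using holomorphic_on_compose_gen[OF fg(1) h(2)] fg(3) by (simp add: o_def image_subset_iff)
  have G: "G holomorphic_on ball 0 1"
    unfolding G_def using holomorphic_on_compose_gen[OF h(4) fg(2)] h(5) by (simp add: o_def)
  have FG: "F z \<in> ball 0 1 \<and> G (F z) = z" if "z \<in> \<Omega> \<union> K" for z
    using fg(3)[OF that] h unfolding F_def G_def by (auto simp: image_subset_iff)
  have GF: "G z \<in> \<Omega> \<union> K \<and> F (G z) = z" if "z \<in> ball 0 1" for z
    using fg(4)[of "g1 z"] h that unfolding F_def G_def by (auto simp: image_subset_iff)
  have G0: "G 0 = 0" using FG[of 0] 0 h(1) by (simp add: F_def)
  have inj: "inj_on G (ball 0 1)" using GF by (metis inj_onI)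
  obtain k where k: "k holomorphic_on ball 0 1" "\<And>z. cmod z < 1 \<Longrightarrow> G z = z * k z" "deriv G 0 = k 0"
    using Schwarz3[OF G G0] by metis
  have k0: "k z \<noteq> 0" if "z \<in> ball 0 1" for z
  proof (cases "z = 0")
    case True
    then show ?thesis using holomorphic_injective_imp_regular[OF G _ inj, of 0] k(3) by simp
  next
    case False
    then have "G z \<noteq> G 0" using inj that by (auto simp: inj_on_def)
    then show ?thesis using k(2)[of z] that G0 by auto
  qed
  obtain l where l: "continuous_on (ball 0 1) l" "\<And>z. z \<in> ball 0 1 \<Longrightarrow> k z = exp (l z)"
    using continuous_log_on_convex[OF convex_ball holomorphic_on_imp_continuous_on[OF k(1)] k0] by blast
  have "continuous_on K F"
    by (rule continuous_on_subset[OF holomorphic_on_imp_continuous_on[OF F]]) simp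
  then have FK: "compact (F ` K)" "F ` K \<subseteq> ball 0 1"
    using r(4) FG by (auto intro: compact_continuous_image simp del: mem_ball)
  obtain s where s: "s \<ge> 0" "s < 1" "F ` K \<subseteq> cball 0 s"
  proof -
    have "F ` K \<noteq> {}" using r by auto
    then obtain x where x: "x \<in> F ` K" "\<And>y. y \<in> F ` K \<Longrightarrow> dist 0 y \<le> dist 0 x"
      using distance_attains_sup[OF FK(1), of 0] by auto
    show thesis
      by (rule that[of "dist 0 x"]) (use x FK(2) in auto)
  qed
  \<comment> \<open>The circle of radius \<open>\<rho>\<close> surrounds the image of the hole.  Its preimage \<open>G z = z * exp (l z)\<close> winds
    once around the origin, because \<open>l\<close> is single-valued on the disc.\<close>
  define \<rho> where "\<rho> = (s + 1) / 2"
  have \<rho>: "0 < \<rho>" "\<rho> < 1" "s < \<rho>" using s by (auto simp: \<rho>_def)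
  define z where "z t = \<rho> * exp (2 * of_real pi * \<i> * of_real t)" for t :: real
  have zn: "cmod (z t) = \<rho>" for t using \<rho> by (simp add: z_def norm_mult)
  define c where "c t = ln \<rho> + 2 * of_real pi * \<i> * of_real t + l (z t)" for t :: real
  show thesis
  proof
    show "continuous_on {0..1} c" unfolding c_def
    proof (intro continuous_intros continuous_on_compose2[OF l(1)])
      show "continuous_on {0..1} z" unfolding z_def by (intro continuous_intros)
      show "z ` {0..1} \<subseteq> ball 0 1" using zn \<rho> by auto
    qed
    show "c 1 = c 0 + 2 * of_real pi * \<i>" by (simp add: c_def z_def)
    fix t :: real assume "t \<in> {0..1}"
    have "exp (c t) = z t * k (z t)"
      using \<rho> l(2)[of "z t"] zn by (simp add: c_def exp_add z_def exp_of_real flip: of_real_exp)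
    then have e: "exp (c t) = G (z t)" using k(2)[of "z t"] zn \<rho> by simp
    have "G (z t) \<in> \<Omega> \<union> K" "F (G (z t)) = z t" using GF[of "z t"] zn \<rho> by auto
    moreover have "G (z t) \<notin> K" 
    proof
      assume "G (z t) \<in> K"
      then have "z t \<in> cball 0 s" using s(3) calculation by (metis image_subset_iff)
      then show False using zn \<rho> by auto
    qed
    ultimately show "exp (c t) \<in> \<Omega>" using e by auto
  qed
qed

lemma exp_eq_iff_shift: "exp w = exp z \<longleftrightarrow> (\<exists>n::int. w = z + of_int n * (2 * of_real pi * \<i>))"
  unfolding exp_eq by (simp add: mult_ac)

lemma exp_shift: "exp (z + of_int n * (2 * of_real pi * \<i>)) = exp z"
  unfolding exp_eq_iff_shift by blast

lemma connected_component_of_path: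
  assumes "continuous_on {0..1} l" "\<And>t::real. t \<in> {0..1} \<Longrightarrow> l t \<in> S"
  shows "connected_component S (l 0) (l 1)"
  unfolding connected_component_def
  by (rule exI[of _ "l ` {0..1}"]) (use assms in \<open>auto intro!: connected_continuous_image\<close>)

text \<open>A path in \<open>\<Omega>\<close> lifts through the exponential map and joins any point of the preimage to some translate of \<open>c 0\<close>;
  the lifted loop \<open>c\<close> joins these translates to each other.\<close>

lemma exp_preimage_connected:
  assumes \<Omega>: "open \<Omega>" "connected \<Omega>" "0 \<notin> \<Omega>"
    and c: "continuous_on {0..1} c" "\<And>t::real. t \<in> {0..1} \<Longrightarrow> exp (c t) \<in> \<Omega>" "c 1 = c 0 + 2 * of_real pi * \<i>"
  shows "connected (exp -` \<Omega> :: complex set)"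
proof -
  let ?S = "exp -` \<Omega> :: complex set"
  have S: "c 0 + of_int n * (2 * of_real pi * \<i>) \<in> ?S" for n
    using c(2)[of 0] by (simp only: vimage_eq exp_shift) simp
  have shift: "connected_component ?S (c 0 + of_int n * (2 * of_real pi * \<i>)) (c 0 + of_int (n + 1) * (2 * of_real pi * \<i>))" for n
  proof -
    have "connected_component ?S (c 0 + of_int n * (2 * of_real pi * \<i>)) (c 1 + of_int n * (2 * of_real pi * \<i>))"
    proof (rule connected_component_of_path[of "\<lambda>t. c t + of_int n * (2 * of_real pi * \<i>)" ?S])
      show "continuous_on {0..1} (\<lambda>t. c t + of_int n * (2 * of_real pi * \<i>))"
        using c(1) by (intro continuous_intros)
      show "c t + of_int n * (2 * of_real pi * \<i>) \<in> ?S" if "t \<in> {0..1}" for t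
        using c(2)[OF that] by (simp only: vimage_eq exp_shift)
    qed
    moreover have "c 1 + of_int n * (2 * of_real pi * \<i>) = c 0 + of_int (n + 1) * (2 * of_real pi * \<i>)"
      using c(3) by (simp add: algebra_simps)
    ultimately show ?thesis by simp
  qed
  have all: "connected_component ?S (c 0) (c 0 + of_int n * (2 * of_real pi * \<i>))" for n
  proof (induction n rule: int_induct[where k = 0])
    case base
    show ?case using S[of 0] by simp
  next
    case (step1 i)
    then show ?case using shift[of i] connected_component_trans by blast
  next
    case (step2 i)
    then show ?case using shift[of "i - 1"] connected_component_trans connected_component_sym
      by (metis diff_add_cancel)
  qed
  have "connected_component ?S w (c 0)" if w: "w \<in> ?S" for w
  proof -
    have "path_connected \<Omega>" using \<Omega> by (simp add: connected_open_path_connected)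
    then obtain p where p: "path p" "path_image p \<subseteq> \<Omega>" "pathstart p = exp w" "pathfinish p = exp (c 0)"
    proof -
      have "exp w \<in> \<Omega>" "exp (c 0) \<in> \<Omega>" using w c(2)[of 0] by auto
      with \<open>path_connected \<Omega>\<close> show thesis unfolding path_connected_def using that by blast
    qed
    have pt: "p t \<in> \<Omega>" if "t \<in> {0..1}" for t using p(2) that by (auto simp: path_image_def)
    have cp: "continuous_on {0..1} p" using p(1) by (simp add: path_def)
    have ct: "convex {0..1::real}" by simp
    have nz: "p t \<noteq> 0" if "t \<in> {0..1}" for t using pt[OF that] \<Omega>(3) by metis
    obtain l where l: "continuous_on {0..1} l" "\<And>t. t \<in> {0..1} \<Longrightarrow> p t = exp (l t)"
      using continuous_log_on_convex[OF ct cp nz] by blast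
    have "exp (l 0) = exp w" using l(2)[of 0] p(3) by (simp add: pathstart_def)
    then obtain n :: int where n: "l 0 = w + of_int n * (2 * of_real pi * \<i>)" unfolding exp_eq_iff_shift by blast
    define m where "m t = l t - of_int n * (2 * of_real pi * \<i>)" for t
    have em: "exp (m t) = p t" if "t \<in> {0..1}" for t
      using l(2)[OF that] exp_shift[of "m t" n] by (simp only: m_def diff_add_cancel)
    have "connected_component ?S (m 0) (m 1)"
    proof (rule connected_component_of_path)
      show "continuous_on {0..1} m" unfolding m_def using l(1) by (intro continuous_intros)
      show "m t \<in> ?S" if "t \<in> {0..1}" for t using em[OF that] pt[OF that] by simp
    qed
    moreover have "m 0 = w" using n by (simp add: m_def)
    moreover have "exp (m 1) = exp (c 0)" using em[of 1] p(4) by (simp add: pathfinish_def)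
    then obtain k :: int where "m 1 = c 0 + of_int k * (2 * of_real pi * \<i>)"
      unfolding exp_eq_iff_shift by blast
    ultimately show ?thesis using all[of k] connected_component_trans connected_component_sym by metis
  qed
  then show ?thesis unfolding connected_iff_connected_component
    by (meson connected_component_sym connected_component_trans)
qed

lemma open_exp_preimage: "open \<Omega> \<Longrightarrow> open (exp -` \<Omega> :: complex set)"
  by (intro open_vimage continuous_intros)

text \<open>The exponential map is open, so it maps a compact relatively open part of the complement of the preimage to
  such a part of the complement of \<open>\<Omega>\<close>.  That part misses the origin, so it cannot be \<open>K\<close>.\<close>

lemma ring_exp_preimage_simply_connected:
  assumes R: "ring_with_hole \<Omega> K" and 0: "0 \<in> K" and unb: "\<not> bounded (- \<Omega>)"
  shows "simply_connected (exp -` \<Omega> :: complex set)"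
proof -
  let ?S = "exp -` \<Omega> :: complex set"
  have r: "open \<Omega>" "connected \<Omega>" "K \<inter> \<Omega> = {}"
    and hole: "\<And>M. compact M \<Longrightarrow> M \<inter> \<Omega> = {} \<Longrightarrow> open (\<Omega> \<union> M) \<Longrightarrow> M = {} \<or> M = K"
    using R unfolding ring_with_hole_def by blast+
  have nz: "0 \<notin> \<Omega>" using r 0 by auto
  have op: "open ?S" using r by (intro open_exp_preimage)
  obtain c :: "real \<Rightarrow> complex" where "continuous_on {0..1} c"
    "\<And>t. t \<in> {0..1} \<Longrightarrow> exp (c t) \<in> \<Omega>" "c 1 = c 0 + 2 * of_real pi * \<i>"
    by (rule ring_with_hole_loop[OF assms]) (rule that; assumption)
  then have conn: "connected ?S" by (rule exp_preimage_connected[OF r(1,2) nz])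
  have "M = {}" if M: "compact M" "M \<inter> ?S = {}" "open (?S \<union> M)" for M :: "complex set"
  proof -
    have "exp ` ?S = \<Omega>" using nz by (auto simp: image_iff) (metis exp_Ln)
    moreover have "open (exp ` (?S \<union> M))"
    proof (rule open_mapping_thm[where S = UNIV])
      have "exp 0 \<noteq> exp (1::complex)" using exp_of_real[where 'a=complex, of 1] by (simp add: complex_eq_iff)
      then show "\<not> exp constant_on (UNIV :: complex set)" unfolding constant_on_def by (metis UNIV_I)
    qed (use M in \<open>auto intro!: holomorphic_intros\<close>)
    ultimately have "open (\<Omega> \<union> exp ` M)" by (simp add: image_Un)
    moreover have "compact (exp ` M)" using M by (intro compact_continuous_image continuous_intros)
    moreover have "exp ` M \<inter> \<Omega> = {}" using M by auto
    ultimately have "exp ` M = {} \<or> exp ` M = K" using hole by blast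
    then show "M = {}" using 0 by (metis exp_not_eq_zero image_iff image_is_empty)
  qed
  then show "simply_connected ?S"
    by (rule no_hole_imp_simply_connected[OF op conn])
qed

text \<open>The difference is continuous with discrete values.\<close>

lemma continuous_logs_differ_by_period:
  fixes f g :: "'a::topological_space \<Rightarrow> complex"
  assumes S: "connected S" and f: "continuous_on S f" and g: "continuous_on S g"
    and e: "\<And>x. x \<in> S \<Longrightarrow> exp (f x) = exp (g x)"
  shows "\<exists>n::int. \<forall>x\<in>S. f x = g x + of_int n * (2 * of_real pi * \<i>)"
proof (cases "S = {}")
  case False
  then obtain x0 where x0: "x0 \<in> S" by blast
  define h where "h x = (f x - g x) / (2 * of_real pi * \<i>)" for x
  have hint: "\<exists>n::int. h x = of_int n" if x: "x \<in> S" for x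
  proof -
    obtain n :: int where "f x = g x + of_int n * (2 * of_real pi * \<i>)"
      using e[OF x] unfolding exp_eq_iff_shift by blast
    then have "h x = of_int n" by (simp add: h_def)
    then show ?thesis ..
  qed
  have "h constant_on S"
  proof (rule continuous_discrete_range_constant[OF S])
    show "continuous_on S h" unfolding h_def using f g by (intro continuous_intros) auto
    show "\<exists>e>0. \<forall>y. y \<in> S \<and> h y \<noteq> h x \<longrightarrow> e \<le> norm (h y - h x)" if x: "x \<in> S" for x
    proof (intro exI[of _ 1] conjI allI impI)
      fix y assume y: "y \<in> S \<and> h y \<noteq> h x"
      obtain m n :: int where mn: "h y = of_int m" "h x = of_int n" using hint x y by metis
      then have "m \<noteq> n" using y by auto
      then have "1 \<le> \<bar>real_of_int (m - n)\<bar>" by linarith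
      also have "\<dots> = norm (h y - h x)" unfolding mn by (metis norm_of_int of_int_diff)
      finally show "1 \<le> norm (h y - h x)" .
    qed simp
  qed
  then obtain c where c: "\<And>x. x \<in> S \<Longrightarrow> h x = c" by (auto simp: constant_on_def)
  obtain n :: int where n: "c = of_int n" using hint[OF x0] c[OF x0] by auto
  have "f x = g x + of_int n * (2 * of_real pi * \<i>)" if "x \<in> S" for x
  proof -
    have "f x - g x = c * (2 * of_real pi * \<i>)" using c[OF that] by (simp add: h_def field_simps)
    then show ?thesis using n by (simp add: algebra_simps)
  qed
  then show ?thesis by blast
qed simp

lemma exp_period: "exp (w + 2 * of_real pi * \<i>) = exp w"
  using exp_shift[of w 1] by simp

section \<open>Quotients of the exponential covering and automorphisms of the disc\<close>

text \<open>Locally the function on \<open>\<Omega>\<close> is \<open>E\<close> composed with a branch of the logarithm.  Periodicity makes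
  the choice of branch irrelevant.\<close>

lemma exp_descent:
  fixes E :: "complex \<Rightarrow> complex"
  assumes \<Omega>: "open \<Omega>" "0 \<notin> \<Omega>" and E: "E holomorphic_on (exp -` \<Omega>)"
    and per: "\<And>w w'. exp w \<in> \<Omega> \<Longrightarrow> exp w = exp w' \<Longrightarrow> E w = E w'"
  obtains e where "e holomorphic_on \<Omega>" "\<And>w. exp w \<in> \<Omega> \<Longrightarrow> e (exp w) = E w"
proof
  define e where "e z = E (Ln z)" for z
  show ee: "e (exp w) = E w" if "exp w \<in> \<Omega>" for w
    unfolding e_def by (rule per) (use that in auto)
  show "e holomorphic_on \<Omega>"
    unfolding holomorphic_on_open[OF \<Omega>(1)]
  proof
    fix z assume z: "z \<in> \<Omega>"
    with \<Omega> have "z \<noteq> 0" by auto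
    define w where "w = Ln z"
    have w: "exp w = z" using \<open>z \<noteq> 0\<close> by (simp add: w_def)
    define l where "l x = Ln (x / z) + w" for x
    have l: "exp (l x) = x" if "x \<noteq> 0" for x using that \<open>z \<noteq> 0\<close> w by (simp add: l_def exp_add)
    have "open (exp -` \<Omega> :: complex set)" using \<Omega>(1) by (intro open_vimage) (auto intro!: continuous_intros)
    then have "E field_differentiable at (l z)"
      using E z w by (auto simp: holomorphic_on_open field_differentiable_def l_def \<open>z \<noteq> 0\<close>)
    moreover have "l field_differentiable at z"
      unfolding l_def field_differentiable_def using \<open>z \<noteq> 0\<close>
      by (intro exI) (auto intro!: derivative_eq_intros)
    ultimately have "(E \<circ> l) field_differentiable at z"
      by (rule field_differentiable_compose[rotated])
    then obtain D where D: "((E \<circ> l) has_field_derivative D) (at z)" by (auto simp: field_differentiable_def)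
    have "(e has_field_derivative D) (at z)"
    proof (rule has_field_derivative_transform_within_open[OF D \<Omega>(1) z])
      fix x assume "x \<in> \<Omega>"
      then show "(E \<circ> l) x = e x" using l[of x] ee[of "l x"] \<Omega>(2) by (metis comp_apply)
    qed
    then show "\<exists>f'. (e has_field_derivative f') (at z)" by blast
  qed
qed

text \<open>The map \<open>exp (2\<pi>\<i> Q / c)\<close> identifies points exactly when the values of \<open>Q\<close> differ by a multiple of
  \<open>c\<close>, that is, exactly when the exponential map identifies them.\<close>

lemma exp_quotient_biholomorphic:
  fixes Q :: "complex \<Rightarrow> complex" and c :: real
  assumes \<Omega>: "open \<Omega>" "0 \<notin> \<Omega>" and Q: "Q holomorphic_on (exp -` \<Omega>)" "bij_betw Q (exp -` \<Omega>) Y"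
    and c: "c \<noteq> 0" and shift: "\<And>w. exp w \<in> \<Omega> \<Longrightarrow> Q (w + 2 * of_real pi * \<i>) = Q w + c"
  obtains e where "e holomorphic_on \<Omega>" "bij_betw e \<Omega> ((\<lambda>q. exp (2 * of_real pi * \<i> * q / c)) ` Y)"
proof -
  let ?S = "exp -` \<Omega> :: complex set"
  define E where "E w = exp (2 * of_real pi * \<i> * Q w / c)" for w
  have inj: "inj_on Q ?S" and im: "Q ` ?S = Y" using Q by (auto simp: bij_betw_def)
  have shn: "Q (w + of_int n * (2 * of_real pi * \<i>)) = Q w + of_int n * c" if w: "exp w \<in> \<Omega>" for n :: int and w
  proof -
    have ex: "exp (w + of_int i * (2 * of_real pi * \<i>)) \<in> \<Omega>" for i using w exp_shift[of w i] by simp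
    show ?thesis
    proof (induction n rule: int_induct[where k = 0])
      case base
      show ?case by simp
    next
      case (step1 i)
      then show ?case using shift[OF ex[of i]] by (simp add: algebra_simps)
    next
      case (step2 i)
      then show ?case using shift[OF ex[of "i - 1"]] by (simp add: algebra_simps)
    qed
  qed
  have EE: "E w = E w' \<longleftrightarrow> exp w = exp w'" if w: "exp w \<in> \<Omega>" "exp w' \<in> \<Omega>" for w w'
  proof
    assume "exp w = exp w'"
    then obtain n :: int where n: "w = w' + of_int n * (2 * of_real pi * \<i>)" unfolding exp_eq_iff_shift by blast
    have "2 * of_real pi * \<i> * Q w / c = 2 * of_real pi * \<i> * Q w' / c + of_int n * (2 * of_real pi * \<i>)"
      using shn[OF w(2), of n] n c by (simp add: field_simps)
    then show "E w = E w'" unfolding E_def exp_eq_iff_shift by blast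
  next
    assume "E w = E w'"
    then obtain n :: int where n: "2 * of_real pi * \<i> * Q w / c = 2 * of_real pi * \<i> * Q w' / c + of_int n * (2 * of_real pi * \<i>)"
      unfolding E_def exp_eq_iff_shift by blast
    have "(2 * of_real pi * \<i>) * Q w = (2 * of_real pi * \<i>) * (Q w' + of_int n * c)"
      using n c by (simp add: field_simps)
    then have "Q w = Q w' + of_int n * c" by simp
    then have "Q w = Q (w' + of_int n * (2 * of_real pi * \<i>))" using shn[OF w(2), of n] by simp
    then have "w = w' + of_int n * (2 * of_real pi * \<i>)"
      using inj w exp_shift[of w' n] by (auto simp: inj_on_def)
    then show "exp w = exp w'" using exp_shift[of w' n] by simp
  qed
  have "E holomorphic_on ?S" unfolding E_def using Q c by (auto intro!: holomorphic_intros)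
  then obtain e where e: "e holomorphic_on \<Omega>" "\<And>w. exp w \<in> \<Omega> \<Longrightarrow> e (exp w) = E w"
    using exp_descent[OF \<Omega>, of E] EE by metis
  have lift: "\<exists>w. z = exp w" if "z \<in> \<Omega>" for z using that \<Omega>(2) by (metis exp_Ln)
  have "inj_on e \<Omega>"
  proof (rule inj_onI)
    fix x y assume xy: "x \<in> \<Omega>" "y \<in> \<Omega>" "e x = e y"
    obtain v w where "x = exp v" "y = exp w" using lift xy by blast
    then show "x = y" using EE[of v w] e(2)[of v] e(2)[of w] xy by simp
  qed
  moreover have "e ` \<Omega> = E ` ?S"
  proof
    show "e ` \<Omega> \<subseteq> E ` ?S"
    proof
      fix y assume "y \<in> e ` \<Omega>"
      then obtain x where x: "x \<in> \<Omega>" "y = e x" by blast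
      then obtain w where "x = exp w" using lift by blast
      then show "y \<in> E ` ?S" using x e(2)[of w] by auto
    qed
    show "E ` ?S \<subseteq> e ` \<Omega>" using e(2) by (force simp: image_iff)
  qed
  moreover have "E ` ?S = (\<lambda>q. exp (2 * of_real pi * \<i> * q / c)) ` Y"
    unfolding im[symmetric] image_image E_def ..
  ultimately show thesis using that[OF e(1)] by (simp add: bij_betw_def)
qed

text \<open>After a Moebius transformation the automorphism fixes the origin; by the Schwarz lemma applied to it and
  to its inverse it is then a rotation.\<close>

lemma disc_automorphism_Moebius:
  assumes t: "t holomorphic_on ball 0 1" "s holomorphic_on ball 0 1"
    and ts: "\<And>z. z \<in> ball 0 1 \<Longrightarrow> t z \<in> ball 0 1 \<and> s (t z) = z"
            "\<And>z. z \<in> ball 0 1 \<Longrightarrow> s z \<in> ball 0 1 \<and> t (s z) = z"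
  obtains a u where "cmod a < 1" "cmod u = 1" "\<And>z. z \<in> ball 0 1 \<Longrightarrow> t z = u * (z - a) / (1 - cnj a * z)"
proof -
  define a where "a = s 0"
  have a: "cmod a < 1" using ts(2)[of 0] by (simp add: a_def)
  let ?M = "Moebius_function 0 (- a)" and ?N = "Moebius_function 0 a"
  have M: "?M holomorphic_on ball 0 1" "?N holomorphic_on ball 0 1"
    using Moebius_function_holomorphic a by auto
  have Mb: "?M z \<in> ball 0 1" "?N z \<in> ball 0 1" if "z \<in> ball 0 1" for z
    using Moebius_function_norm_lt_1 a that by auto
  have MN: "?M (?N z) = z" "?N (?M z) = z" if "z \<in> ball 0 1" for z
    using Moebius_function_compose[of "-a" a z] Moebius_function_compose[of a "-a" z] a that by auto
  define f where "f = t \<circ> ?M"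
  define g where "g = ?N \<circ> s"
  have f: "f holomorphic_on ball 0 1" unfolding f_def
    by (rule holomorphic_on_compose_gen[OF M(1) t(1)]) (use Mb in auto)
  have g: "g holomorphic_on ball 0 1" unfolding g_def
    by (rule holomorphic_on_compose_gen[OF t(2) M(2)]) (use ts in auto)
  have f0: "f 0 = 0" using ts(2)[of 0] by (simp add: f_def Moebius_function_simple a_def)
  have g0: "g 0 = 0" by (simp add: g_def Moebius_function_simple a_def)
  have fb: "cmod (f z) < 1" if "cmod z < 1" for z using that ts Mb by (auto simp: f_def)
  have gb: "cmod (g z) < 1" if "cmod z < 1" for z using that ts Mb by (auto simp: g_def)
  have gf: "g (f z) = z" if "z \<in> ball 0 1" for z
    using that ts(1)[of "?M z"] Mb[OF that] MN[OF that] by (simp add: f_def g_def)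
  have nf: "cmod (f z) = cmod z" if "cmod z < 1" for z
    using Schwarz_Lemma(1)[OF f f0 fb that] Schwarz_Lemma(1)[OF g g0 gb fb[OF that]] gf[of z] that
    by simp
  obtain u where u: "\<And>z. cmod z < 1 \<Longrightarrow> f z = u * z" "cmod u = 1"
  proof -
    have "cmod (1/2 :: complex) < 1 \<and> (1/2 :: complex) \<noteq> 0 \<and> cmod (f (1/2)) = cmod (1/2)"
      using nf[of "1/2"] by simp
    then show thesis using Schwarz_Lemma(3)[OF f f0 fb, of 0] that by (metis norm_zero zero_less_one)
  qed
  have "t z = u * (z - a) / (1 - cnj a * z)" if "z \<in> ball 0 1" for z
  proof -
    have "f (?N z) = u * ?N z" using u(1) Mb(2)[OF that] by simp
    moreover have "f (?N z) = t z" using MN(1)[OF that] by (simp add: f_def)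
    ultimately show ?thesis by (simp add: Moebius_function_simple)
  qed
  then show thesis using that a u by blast
qed

abbreviation upper_half_plane :: "complex set" where "upper_half_plane \<equiv> {z. Im z > 0}"

text \<open>The fixed-point equation is quadratic and its roots are symmetric in the unit circle, so an
  automorphism without fixed points in the disc has one on the circle.  A Cayley transform sends
  it to infinity.\<close>

lemma fixed_point_free_disc_automorphism:
  assumes t: "t holomorphic_on ball 0 1" "s holomorphic_on ball 0 1"
    and ts: "\<And>z. z \<in> ball 0 1 \<Longrightarrow> t z \<in> ball 0 1 \<and> s (t z) = z"
            "\<And>z. z \<in> ball 0 1 \<Longrightarrow> s z \<in> ball 0 1 \<and> t (s z) = z"
    and nofix: "\<And>z. z \<in> ball 0 1 \<Longrightarrow> t z \<noteq> z"
  obtains C \<mu> \<beta> where "C holomorphic_on ball 0 1" "bij_betw C (ball 0 1) upper_half_plane"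
    "\<And>z. z \<in> ball 0 1 \<Longrightarrow> C (t z) = \<mu> * C z + \<beta>"
proof -
  obtain a u where a: "cmod a < 1" and u: "cmod u = 1"
    and tz: "\<And>z. z \<in> ball 0 1 \<Longrightarrow> t z = u * (z - a) / (1 - cnj a * z)"
    using disc_automorphism_Moebius[OF t ts] by metis
  have nz: "1 - cnj a * z \<noteq> 0" if "cmod z \<le> 1" for z
  proof
    assume "1 - cnj a * z = 0"
    then have "1 = cmod a * cmod z" by (metis complex_mod_cnj norm_mult norm_one right_minus_eq)
    then show False using a that
      by (smt (verit) mult_left_le norm_ge_zero)
  qed
  have a0: "a \<noteq> 0" using tz[of 0] nofix[of 0] by auto
  have fixeq: "t z = z" if "z \<in> ball 0 1" "cnj a * z\<^sup>2 + (u - 1) * z - u * a = 0" for z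
  proof -
    have "u * (z - a) = z * (1 - cnj a * z)" using that(2) by (simp add: algebra_simps power2_eq_square)
    then show ?thesis using tz[OF that(1)] nz[of z] that(1) by simp
  qed
  obtain \<zeta> where \<zeta>: "cnj a * \<zeta>\<^sup>2 + (u - 1) * \<zeta> - u * a = 0"
  proof -
    define d where "d = csqrt ((u - 1)\<^sup>2 + 4 * cnj a * (u * a))"
    have "d\<^sup>2 = (u - 1)\<^sup>2 + 4 * cnj a * (u * a)" by (simp add: d_def)
    then have "cnj a * ((1 - u + d) / (2 * cnj a))\<^sup>2 + (u - 1) * ((1 - u + d) / (2 * cnj a)) - u * a = 0"
      using a0 by (simp add: power2_eq_square divide_simps) algebra
    then show thesis using that by blast
  qed
  have u0: "u \<noteq> 0" "u * cnj u = 1" "cnj u * u = 1"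
    using u by (auto simp: complex_norm_square[symmetric] mult.commute)
  have \<zeta>0: "\<zeta> \<noteq> 0" using \<zeta> a0 u0 by auto
  have "\<not> cmod \<zeta> < 1" using fixeq[OF _ \<zeta>] nofix by auto
  \<comment> \<open>The roots of the fixed-point equation are symmetric in the unit circle.\<close>
  moreover have "\<not> cmod \<zeta> > 1"
  proof
    assume gt: "cmod \<zeta> > 1"
    define z where "z = inverse (cnj \<zeta>)"
    have z: "z \<in> ball 0 1" using gt by (simp add: z_def norm_inverse inverse_less_1_iff)
    have cz: "cnj \<zeta> * z = 1" using \<zeta>0 by (simp add: z_def)
    have "a * (cnj \<zeta>)\<^sup>2 + (cnj u - 1) * cnj \<zeta> - cnj u * cnj a = 0"
      using arg_cong[OF \<zeta>, of cnj] by simp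
    then have "(- u * z\<^sup>2) * (a * (cnj \<zeta>)\<^sup>2 + (cnj u - 1) * cnj \<zeta> - cnj u * cnj a) = 0" by simp
    moreover have "(- u * z\<^sup>2) * (a * (cnj \<zeta>)\<^sup>2 + (cnj u - 1) * cnj \<zeta> - cnj u * cnj a) =
       - u * a * (cnj \<zeta> * z)\<^sup>2 + (u - u * cnj u) * (cnj \<zeta> * z) * z + u * cnj u * cnj a * z\<^sup>2"
      by (simp add: algebra_simps power2_eq_square)
    ultimately have e: "- u * a * 1\<^sup>2 + (u - 1) * 1 * z + 1 * cnj a * z\<^sup>2 = 0"
      by (simp only: cz u0(2))
    have "cnj a * z\<^sup>2 + (u - 1) * z - u * a = - u * a * 1\<^sup>2 + (u - 1) * 1 * z + 1 * cnj a * z\<^sup>2"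
      by simp
    then have "cnj a * z\<^sup>2 + (u - 1) * z - u * a = 0" using e by (rule trans)
    then show False using fixeq[OF z] nofix[OF z] by simp
  qed
  ultimately have n1: "cmod \<zeta> = 1" by simp
  \<comment> \<open>The Cayley transform that sends \<open>\<zeta>\<close> to infinity, and its inverse.\<close>
  define C where "C z = \<i> * (\<zeta> + z) / (\<zeta> - z)" for z
  define D where "D v = \<zeta> * (v - \<i>) / (v + \<i>)" for v
  have ne: "\<zeta> - z \<noteq> 0" if "z \<in> ball 0 1" for z using that n1 by auto
  have C: "C holomorphic_on ball 0 1"
    unfolding C_def using ne by (auto intro!: holomorphic_intros)
  have ImC: "Im (C z) = (1 - (cmod z)\<^sup>2) / (cmod (\<zeta> - z))\<^sup>2" if "\<zeta> - z \<noteq> 0" for z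
  proof -
    have "C z = \<i> * ((\<zeta> + z) * cnj (\<zeta> - z)) / (cmod (\<zeta> - z))\<^sup>2"
      using that unfolding C_def complex_norm_square by simp
    moreover have "Im (\<i> * ((\<zeta> + z) * cnj (\<zeta> - z))) = (cmod \<zeta>)\<^sup>2 - (cmod z)\<^sup>2"
      unfolding cmod_power2 by (simp add: algebra_simps power2_eq_square)
    ultimately show ?thesis using n1 by simp
  qed
  have bij: "bij_betw C (ball 0 1) upper_half_plane"
  proof (rule bij_betw_byWitness[where f' = D])
    show "\<forall>z\<in>ball 0 1. D (C z) = z"
    proof
      fix z :: complex assume z: "z \<in> ball 0 1"
      have "C z - \<i> = 2 * \<i> * z / (\<zeta> - z)" "C z + \<i> = 2 * \<i> * \<zeta> / (\<zeta> - z)"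
        using ne[OF z] by (auto simp: C_def field_simps)
      then show "D (C z) = z" using ne[OF z] \<zeta>0 by (simp add: D_def)
    qed
    show "\<forall>v\<in>upper_half_plane. C (D v) = v"
    proof
      fix v assume "v \<in> upper_half_plane"
      then have v: "v + \<i> \<noteq> 0" by (auto simp: complex_eq_iff)
      have "\<zeta> + D v = 2 * \<zeta> * v / (v + \<i>)" "\<zeta> - D v = 2 * \<i> * \<zeta> / (v + \<i>)"
        using v by (auto simp: D_def field_simps)
      then show "C (D v) = v" using v \<zeta>0 by (simp add: C_def)
    qed
    show "C ` ball 0 1 \<subseteq> upper_half_plane"
    proof clarify
      fix z :: complex assume z: "z \<in> ball 0 1"
      then have "(cmod z)\<^sup>2 < 1" by (simp add: power_less_one_iff)
      then show "Im (C z) > 0" unfolding ImC[OF ne[OF z]] using ne[OF z] by simp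
    qed
    show "D ` upper_half_plane \<subseteq> ball 0 1"
    proof clarify
      fix v assume v: "Im v > 0"
      then have "(cmod (v - \<i>))\<^sup>2 < (cmod (v + \<i>))\<^sup>2" unfolding cmod_power2 by (simp add: power2_eq_square algebra_simps)
      then have "cmod (v - \<i>) < cmod (v + \<i>)" by (rule power_less_imp_less_base) simp
      then show "D v \<in> ball 0 1" using n1 by (auto simp: D_def norm_mult norm_divide divide_less_eq)
    qed
  qed
  \<comment> \<open>Because \<open>\<zeta>\<close> is fixed, \<open>\<zeta> - t z\<close> vanishes at \<open>\<zeta>\<close> only.  So \<open>C \<circ> t\<close>, like \<open>C\<close>, is a linear function
    of \<open>z\<close> divided by \<open>\<zeta> - z\<close>, and such functions are affine functions of \<open>C\<close>.\<close>
  have fz: "u * (\<zeta> - a) = \<zeta> * (1 - cnj a * \<zeta>)"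
    using \<zeta> by (simp add: algebra_simps power2_eq_square)
  define m where "m = \<zeta> * cnj a + u"
  have den: "\<zeta> * (1 - cnj a * z) - u * (z - a) = m * (\<zeta> - z)" for z
    using fz by (simp add: m_def algebra_simps)
  have m0: "m \<noteq> 0"
  proof
    assume "m = 0"
    then have "\<zeta> * cnj a = - u" by (simp add: m_def add_eq_0_iff2)
    then have "cmod (\<zeta> * cnj a) = 1" using u by simp
    then show False using n1 a by (simp add: norm_mult)
  qed
  define \<mu> where "\<mu> = ((\<zeta> * (1 - cnj a * \<zeta>) + u * (\<zeta> - a)) / m) / (2 * \<zeta>)"
  define \<beta> where "\<beta> = \<i> * (\<mu> - (u - \<zeta> * cnj a) / m)"
  have "C (t z) = \<mu> * C z + \<beta>" if z: "z \<in> ball 0 1" for z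
  proof -
    have d: "1 - cnj a * z \<noteq> 0" using nz[of z] z by simp
    have 1: "\<zeta> + t z = (\<zeta> * (1 - cnj a * z) + u * (z - a)) / (1 - cnj a * z)"
            "\<zeta> - t z = (m * (\<zeta> - z)) / (1 - cnj a * z)"
      unfolding den[symmetric] tz[OF z] using d by (simp_all add: add_divide_distrib diff_divide_distrib)
    have "C (t z) = \<i> * (\<zeta> * (1 - cnj a * z) + u * (z - a)) / (m * (\<zeta> - z))"
      unfolding C_def 1 using d by simp
    moreover have "\<mu> * C z + \<beta> = \<i> * (\<zeta> * (1 - cnj a * z) + u * (z - a)) / (m * (\<zeta> - z))"
      unfolding C_def \<beta>_def \<mu>_def using ne[OF z] m0 \<zeta>0 by (simp add: divide_simps) (simp add: algebra_simps)
    ultimately show ?thesis by simp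
  qed
  then show thesis using that[OF C bij] by blast
qed

text \<open>The image of the half-plane is a half-plane.  It stays above the real axis only if \<open>\<mu>\<close> is real and
  positive, and it reaches down to the axis only if \<open>\<beta>\<close> is real.\<close>

lemma half_plane_affine_real:
  assumes bij: "bij_betw (\<lambda>z. \<mu> * z + \<beta>) upper_half_plane upper_half_plane"
  shows "\<mu> \<in> \<real>" "Re \<mu> > 0" "\<beta> \<in> \<real>"
proof -
  have pos: "Re \<mu> * y + Im \<mu> * x + Im \<beta> > 0" if "y > 0" for x y
  proof -
    have "Complex x y \<in> upper_half_plane" using that by simp
    then have "\<mu> * Complex x y + \<beta> \<in> upper_half_plane" using bij_betwE[OF bij] by blast
    then show ?thesis by (simp add: algebra_simps)
  qed
  have l0: "\<mu> \<noteq> 0"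
  proof
    assume "\<mu> = 0"
    then have "\<mu> * \<i> + \<beta> = \<mu> * (2 * \<i>) + \<beta>" by simp
    moreover have "inj_on (\<lambda>z. \<mu> * z + \<beta>) upper_half_plane" using bij by (simp add: bij_betw_def)
    ultimately have "\<i> = 2 * \<i>" using inj_onD[of "\<lambda>z. \<mu> * z + \<beta>" upper_half_plane \<i> "2 * \<i>"] by simp
    then show False by simp
  qed
  have Iml: "Im \<mu> = 0"
  proof (rule ccontr)
    assume n: "Im \<mu> \<noteq> 0"
    have "Re \<mu> * 1 + Im \<mu> * ((- Re \<mu> - Im \<beta>) / Im \<mu>) + Im \<beta> > 0" by (rule pos) simp
    then show False using n by simp
  qed
  show "\<mu> \<in> \<real>" using Iml by (simp add: complex_is_Real_iff)
  show Rel: "Re \<mu> > 0"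
  proof (rule ccontr)
    assume "\<not> Re \<mu> > 0"
    then have n: "Re \<mu> < 0" using l0 Iml by (auto simp: complex_eq_iff)
    have "Re \<mu> * ((\<bar>Im \<beta>\<bar> + 1) / - Re \<mu>) + Im \<mu> * 0 + Im \<beta> > 0"
      by (rule pos) (use n in \<open>simp add: divide_pos_neg\<close>)
    moreover have "Re \<mu> * ((\<bar>Im \<beta>\<bar> + 1) / - Re \<mu>) = - (\<bar>Im \<beta>\<bar> + 1)" using n by simp
    ultimately show False by simp
  qed
  have "\<not> Im \<beta> < 0"
  proof
    assume n: "Im \<beta> < 0"
    have "Re \<mu> * (- Im \<beta> / Re \<mu>) + Im \<mu> * 0 + Im \<beta> > 0"
      by (rule pos) (use n Rel in \<open>simp add: field_simps\<close>)
    then show False using Rel by simp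
  qed
  moreover have "\<not> Im \<beta> > 0"
  proof
    assume n: "Im \<beta> > 0"
    have "Complex 0 (Im \<beta> / 2) \<in> (\<lambda>z. \<mu> * z + \<beta>) ` upper_half_plane"
      using bij n by (auto simp: bij_betw_def)
    then obtain z where z: "Im z > 0" "Complex 0 (Im \<beta> / 2) = \<mu> * z + \<beta>" by auto
    have "Im \<beta> / 2 = Re \<mu> * Im z + Im \<beta>" using arg_cong[OF z(2), of Im] Iml by simp
    moreover have "Re \<mu> * Im z > 0" using Rel z by simp
    ultimately show False using n by simp
  qed
  ultimately show "\<beta> \<in> \<real>" by (simp add: complex_is_Real_iff)
qed

section \<open>Ends of injective images of the punctured disc\<close>

text \<open>As a map into the sphere, \<open>f\<close> extends to the puncture, and its value there, finite or infinite, is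
  isolated in the complement of the image.\<close>

lemma punctured_disc_end:
  fixes f :: "complex \<Rightarrow> complex"
  assumes f: "f holomorphic_on (ball 0 1 - {0})" and inj: "inj_on f (ball 0 1 - {0})"
  shows "(\<exists>p. p \<notin> f ` (ball 0 1 - {0}) \<and> open (insert p (f ` (ball 0 1 - {0})))) \<or> bounded (- (f ` (ball 0 1 - {0})))"
proof -
  let ?D = "ball 0 1 - {0 :: complex}"
  have oD: "open ?D" by (simp add: open_delete)
  have opn: "open (f ` U)" if "open U" "U \<subseteq> ?D" for U
    using open_mapping_thm3[of f U] that f inj holomorphic_on_subset inj_on_subset by blast
  \<comment> \<open>By injectivity, \<open>f\<close> near \<open>0\<close> avoids the open set \<open>f ` ?B\<close>, hence a disc about \<open>q\<close>.  So
    \<open>1 / (f - q)\<close> is bounded near \<open>0\<close> and its singularity is removable.\<close>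
  define q where "q = f (1/2)"
  let ?B = "ball (1/2 :: complex) (1/4)"
  have far: "cmod z > 1/4" if "z \<in> ?B" for z
    using that norm_triangle_sub[of "1/2" z] by (simp add: dist_norm)
  have B: "?B \<subseteq> ?D"
  proof
    fix z assume z: "z \<in> ?B"
    have "cmod z \<le> cmod (1/2 :: complex) + cmod (z - 1/2)" by (rule norm_triangle_sub)
    then show "z \<in> ?D" using z far[OF z] by (auto simp: dist_norm norm_minus_commute)
  qed
  have "open (f ` ?B)" "q \<in> f ` ?B" using opn[OF _ B] by (auto simp: q_def)
  then obtain \<epsilon> where \<epsilon>: "\<epsilon> > 0" "ball q \<epsilon> \<subseteq> f ` ?B" by (meson openE)
  define N where "N = ball (0 :: complex) (1/4)"
  have ND: "N - {0} \<subseteq> ?D" by (auto simp: N_def)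
  have away: "cmod (f z - q) \<ge> \<epsilon>" if z: "z \<in> N - {0}" for z
  proof (rule ccontr)
    assume "\<not> ?thesis"
    then have "f z \<in> f ` ?B" using \<epsilon>(2) by (auto simp: dist_norm norm_minus_commute)
    then obtain v where v: "v \<in> ?B" "f z = f v" by blast
    then have "z = v" using inj z ND B by (meson inj_onD subsetD)
    then show False using far[OF v(1)] z by (simp add: N_def)
  qed
  define G where "G z = inverse (f z - q)" for z
  have fN: "f holomorphic_on (N - {0})" using f ND holomorphic_on_subset by blast
  have nz: "f z - q \<noteq> 0" if "z \<in> N - {0}" for z using away[OF that] \<epsilon>(1) by auto
  have G: "G holomorphic_on (N - {0})"
    unfolding G_def using fN nz by (intro holomorphic_intros) auto
  have Gb: "cmod (G z) \<le> inverse \<epsilon>" if "z \<in> N - {0}" for z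
    unfolding G_def norm_inverse using away[OF that] \<epsilon>(1) by (intro le_imp_inverse_le) auto
  have "\<exists>g. g holomorphic_on N \<and> (\<forall>z\<in>N - {0}. g z = G z)"
  proof (rule holomorphic_on_extend_bounded[THEN iffD2, OF G])
    have "eventually (\<lambda>z. z \<in> N - {0}) (at 0)"
      by (rule eventually_at_in_open) (auto simp: N_def)
    then have "eventually (\<lambda>z. cmod (G z) \<le> inverse \<epsilon>) (at 0)"
      by (rule eventually_mono) (rule Gb)
    then show "\<exists>B. eventually (\<lambda>z. cmod (G z) \<le> B) (at 0)" by blast
  qed (simp add: N_def)
  then obtain g where g: "g holomorphic_on N" "\<And>z. z \<in> N - {0} \<Longrightarrow> g z = G z" by blast
  have gf: "f z = q + inverse (g z)" "g z \<noteq> 0" if "z \<in> N - {0}" for z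
    using g(2)[OF that] nz[OF that] by (auto simp: G_def)
  have injg: "inj_on g (N - {0})"
  proof (rule inj_onI)
    fix x y assume xy: "x \<in> N - {0}" "y \<in> N - {0}" "g x = g y"
    then have "f x = f y" using gf(1) by simp
    then show "x = y" using inj ND xy by (meson inj_onD subsetD)
  qed
  have oN: "open N" "connected N" "0 \<in> N" by (auto simp: N_def)
  have gconst: "\<not> g constant_on N"
  proof
    assume "g constant_on N"
    then have "g (1/8) = g (1/16)" unfolding constant_on_def N_def by (auto simp: norm_divide)
    moreover have "(1/8 :: complex) \<in> N - {0}" "(1/16 :: complex) \<in> N - {0}" by (auto simp: N_def norm_divide)
    ultimately have "(1/8 :: complex) = 1/16" by (rule inj_onD[OF injg])
    then show False by simp
  qed
  have gopen: "open (g ` U)" if "open U" "U \<subseteq> N" for U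
    using open_mapping_thm[OF g(1) oN(1,2) that gconst] .
  show ?thesis
  proof (cases "g 0 = 0")
    case True
    \<comment> \<open>Here \<open>f\<close> has a pole at \<open>0\<close>, and its range covers a neighbourhood of infinity.\<close>
    have "open (g ` N)" "0 \<in> g ` N" using gopen[of N] oN True by force+
    then obtain \<delta> where \<delta>: "\<delta> > 0" "ball 0 \<delta> \<subseteq> g ` N" by (meson openE)
    have "- (f ` ?D) \<subseteq> cball q (inverse \<delta>)"
    proof
      fix v assume v: "v \<in> - (f ` ?D)"
      show "v \<in> cball q (inverse \<delta>)"
      proof (rule ccontr)
        assume "v \<notin> cball q (inverse \<delta>)"
        then have d: "inverse \<delta> < cmod (v - q)" by (simp add: dist_norm norm_minus_commute)
        then have "v - q \<noteq> 0" using \<delta>(1) by auto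
        have "inverse (cmod (v - q)) < \<delta>"
          using less_imp_inverse_less[OF d] \<delta>(1) by simp
        then have "inverse (v - q) \<in> g ` N" using \<delta>(2) by (auto simp: norm_inverse)
        then obtain z where z: "z \<in> N" "g z = inverse (v - q)" by auto
        then have "z \<noteq> 0" using True \<open>v - q \<noteq> 0\<close> by auto
        then have "f z = v" using gf(1)[of z] z by simp
        then show False using v z \<open>z \<noteq> 0\<close> ND by auto
      qed
    qed
    then have "bounded (- (f ` ?D))" using bounded_cball bounded_subset by blast
    then show ?thesis ..
  next
    case False
    \<comment> \<open>Here \<open>f\<close> extends holomorphically with the value \<open>p\<close> at \<open>0\<close>.\<close>
    define p where "p = q + inverse (g 0)"
    have gnz: "g z \<noteq> 0" if "z \<in> N" for z
      using that False gf(2)[of z] by (cases "z = 0") auto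
    have holF: "(\<lambda>z. q + inverse (g z)) holomorphic_on N"
      using g(1) gnz by (intro holomorphic_intros) auto
    have Fconst: "\<not> (\<lambda>z. q + inverse (g z)) constant_on N"
      using gconst unfolding constant_on_def by (metis (no_types, lifting) add_left_cancel inverse_inverse_eq)
    have "open ((\<lambda>z. q + inverse (g z)) ` N)"
      by (rule open_mapping_thm[OF holF oN(1,2) oN(1) order_refl Fconst])
    moreover have "(\<lambda>z. q + inverse (g z)) ` N = insert p (f ` (N - {0}))"
    proof -
      have "N = insert 0 (N - {0})" using oN(3) by auto
      then have "(\<lambda>z. q + inverse (g z)) ` N = insert p ((\<lambda>z. q + inverse (g z)) ` (N - {0}))"
        by (metis (no_types, lifting) image_insert p_def)
      also have "(\<lambda>z. q + inverse (g z)) ` (N - {0}) = f ` (N - {0})"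
        by (intro image_cong refl) (simp add: gf(1))
      finally show ?thesis .
    qed
    ultimately have o1: "open (insert p (f ` (N - {0})) \<union> f ` ?D)" using opn[OF oD] by (metis open_Un order_refl)
    have e1: "insert p (f ` (N - {0})) \<union> f ` ?D = insert p (f ` ?D)" using ND by auto
    have "p \<notin> f ` ?D"
    proof
      assume "p \<in> f ` ?D"
      then obtain z2 where z2: "z2 \<in> ?D" "p = f z2" by blast
      define V where "V = ball z2 (cmod z2 / 2) \<inter> ?D"
      have V: "open V" "V \<subseteq> ?D" "z2 \<in> V" using z2 oD by (auto simp: V_def)
      have "continuous_on N (\<lambda>z. q + inverse (g z))" using holF holomorphic_on_imp_continuous_on by blast
      then have "isCont (\<lambda>z. q + inverse (g z)) 0" using oN continuous_on_eq_continuous_at by blast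
      then have lim: "((\<lambda>z. q + inverse (g z)) \<longlongrightarrow> p) (at 0)" by (simp add: isCont_def p_def)
      have "open (f ` V)" "p \<in> f ` V" using opn[OF V(1,2)] V(3) z2 by auto
      then have "eventually (\<lambda>z. q + inverse (g z) \<in> f ` V) (at 0)" using lim by (simp add: topological_tendstoD)
      moreover have "eventually (\<lambda>z. z \<in> N \<inter> ball 0 (cmod z2 / 2) - {0}) (at 0)"
        using oN z2 by (intro eventually_at_in_open) auto
      ultimately have "eventually (\<lambda>z. q + inverse (g z) \<in> f ` V \<and> z \<in> N \<inter> ball 0 (cmod z2 / 2) - {0}) (at 0)"
        by (rule eventually_conj)
      then obtain z where z: "q + inverse (g z) \<in> f ` V" "z \<in> N \<inter> ball 0 (cmod z2 / 2) - {0}"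
        using eventually_happens trivial_limit_at by blast
      then have zN: "z \<in> N - {0}" by auto
      then have "f z \<in> f ` V" using z(1) gf(1) by simp
      then obtain v where v: "v \<in> V" "f z = f v" by blast
      have "z = v" using inj_onD[OF inj v(2)] zN ND v(1) V(2) by blast
      then have "z \<in> V" using v(1) by simp
      then have "cmod (z2 - z) < cmod z2 / 2" by (simp add: V_def dist_norm)
      moreover have "cmod z < cmod z2 / 2" using z(2) by simp
      moreover have "cmod z2 \<le> cmod z + cmod (z2 - z)" by (rule norm_triangle_sub)
      ultimately show False by linarith
    qed
    moreover have "open (insert p (f ` ?D))" using o1 unfolding e1 .
    ultimately show ?thesis by blast
  qed
qed

section \<open>Uniformization of doubly connected domains\<close>

lemma homeo_image_eq_vimage:
  assumes "\<And>z. G (F z) = z" "\<And>z. F (G z) = z"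
  shows "F ` X = G -` X"
  using assms by (auto simp: image_iff) metis

lemma homeo_open_image:
  fixes F G :: "complex \<Rightarrow> complex"
  assumes "continuous_on UNIV G" "\<And>z. G (F z) = z" "\<And>z. F (G z) = z" "open X"
  shows "open (F ` X)"
proof -
  have "F ` X = G -` X" by (rule homeo_image_eq_vimage) fact+
  then show ?thesis using assms(1,4) by (simp add: open_vimage)
qed

lemma ring_with_hole_homeo:
  fixes F G :: "complex \<Rightarrow> complex"
  assumes F: "continuous_on UNIV F" and G: "continuous_on UNIV G"
    and GF: "\<And>z. G (F z) = z" and FG: "\<And>z. F (G z) = z" and R: "ring_with_hole \<Omega> K"
  shows "ring_with_hole (F ` \<Omega>) (F ` K)"
proof -
  have r: "open \<Omega>" "connected \<Omega>" "\<Omega> \<noteq> {}" "compact K" "K \<noteq> {}" "K \<inter> \<Omega> = {}" "open (\<Omega> \<union> K)"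
    and hole: "\<And>M. compact M \<Longrightarrow> M \<inter> \<Omega> = {} \<Longrightarrow> open (\<Omega> \<union> M) \<Longrightarrow> M = {} \<or> M = K"
    using R unfolding ring_with_hole_def by blast+
  have inj: "inj F" using GF by (metis injI)
  have cF: "continuous_on X F" for X using F continuous_on_subset by blast
  have cG: "continuous_on X G" for X using G continuous_on_subset by blast
  have FGi: "F ` G ` X = X" for X by (simp add: image_image FG)
  have GFi: "G ` F ` X = X" for X by (simp add: image_image GF)
  have "M = {} \<or> M = F ` K" if M: "compact M" "M \<inter> F ` \<Omega> = {}" "open (F ` \<Omega> \<union> M)" for M
  proof -
    have "compact (G ` M)" using M cG by (simp add: compact_continuous_image)
    moreover have "G ` M \<inter> \<Omega> = {}" using M(2) FG by (auto simp: image_iff) (metis disjoint_iff imageI)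
    moreover have "open (\<Omega> \<union> G ` M)"
      using homeo_open_image[OF F FG GF M(3)] by (simp add: image_Un GFi)
    ultimately have "G ` M = {} \<or> G ` M = K" by (rule hole)
    then show ?thesis using FGi by (metis image_is_empty)
  qed
  moreover have "open (F ` \<Omega>)" "open (F ` \<Omega> \<union> F ` K)"
    using homeo_open_image[OF G GF FG] r by (simp_all flip: image_Un)
  moreover have "connected (F ` \<Omega>)" "compact (F ` K)"
    using r cF by (auto intro: connected_continuous_image compact_continuous_image)
  moreover have "F ` K \<inter> F ` \<Omega> = {}" using r(6) inj by (metis image_Int image_empty)
  ultimately show ?thesis unfolding ring_with_hole_def using r by blast
qed

lemma conformally_equivalent_trans:
  assumes "conformally_equivalent A B" "conformally_equivalent B C"
  shows "conformally_equivalent A C"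
proof -
  obtain f g where f: "f holomorphic_on A" "bij_betw f A B" and g: "g holomorphic_on B" "bij_betw g B C"
    using assms unfolding conformally_equivalent_def by blast
  have "(g \<circ> f) holomorphic_on A"
    by (rule holomorphic_on_compose_gen[OF f(1) g(1)]) (use f(2) in \<open>simp add: bij_betw_def\<close>)
  then show ?thesis unfolding conformally_equivalent_def using bij_betw_trans[OF f(2) g(2)] by blast
qed

lemma conformally_equivalent_sym:
  assumes "open A" "conformally_equivalent A B"
  shows "conformally_equivalent B A"
proof -
  obtain f where f: "f holomorphic_on A" "inj_on f A" "f ` A = B"
    using assms unfolding conformally_equivalent_def bij_betw_def by blast
  obtain g where g: "g holomorphic_on f ` A" "\<And>z. z \<in> A \<Longrightarrow> g (f z) = z"
    using holomorphic_has_inverse[OF f(1) assms(1) f(2)] by metis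
  have "bij_betw g B A"
    by (rule bij_betw_byWitness[where f' = f]) (use f g(2) in auto)
  then show ?thesis using g(1) f(3) unfolding conformally_equivalent_def by blast
qed

text \<open>Inversion of the target, which reverses the direction of the translation.\<close>

lemma conformally_equivalent_negate_period:
  assumes "conformally_equivalent A ((\<lambda>q. exp (2 * of_real pi * \<i> * q / of_real c)) ` Y)"
  shows "conformally_equivalent A ((\<lambda>q. exp (2 * of_real pi * \<i> * q / of_real (- c))) ` Y)"
proof -
  let ?X = "(\<lambda>q. exp (2 * of_real pi * \<i> * q / of_real c)) ` Y"
  have "inverse ` ?X = (\<lambda>q. exp (2 * of_real pi * \<i> * q / of_real (- c))) ` Y"
    unfolding image_image by (intro image_cong refl) (simp add: exp_minus[symmetric])
  moreover have "inverse holomorphic_on ?X" by (intro holomorphic_intros) auto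
  moreover have "inj_on inverse ?X" by (auto intro: inj_onI)
  ultimately have "conformally_equivalent ?X ((\<lambda>q. exp (2 * of_real pi * \<i> * q / of_real (- c))) ` Y)"
    unfolding conformally_equivalent_def bij_betw_def by blast
  then show ?thesis using assms conformally_equivalent_trans by blast
qed

lemma exp_image_halfplane:
  fixes c :: real assumes c: "c > 0"
  shows "(\<lambda>q. exp (2 * of_real pi * \<i> * q / of_real c)) ` {q. Im q > 0} = ball 0 1 - {0}"
proof -
  have n: "cmod (exp (2 * of_real pi * \<i> * q / of_real c)) = exp (- (2 * pi * Im q / c))" for q
    by (simp add: Re_divide_of_real)
  have inv: "exp (2 * of_real pi * \<i> * (of_real c * Ln z / (2 * of_real pi * \<i>)) / of_real c) = z" if "z \<noteq> 0" for z
    using that c by simp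
  show ?thesis
  proof (intro equalityI subsetI)
    fix z assume "z \<in> (\<lambda>q. exp (2 * of_real pi * \<i> * q / of_real c)) ` {q. Im q > 0}"
    then show "z \<in> ball 0 1 - {0}" using c n by (auto simp: dist_norm)
  next
    fix z :: complex assume z: "z \<in> ball 0 1 - {0}"
    let ?q = "of_real c * Ln z / (2 * of_real pi * \<i>)"
    have e: "z = exp (2 * of_real pi * \<i> * ?q / of_real c)" using inv z by simp
    then have "cmod z = exp (- (2 * pi * Im ?q / c))" using n by metis
    then have "exp (- (2 * pi * Im ?q / c)) < 1" using z by simp
    then have "Im ?q > 0" using c by (simp add: zero_less_divide_iff zero_less_mult_iff)
    then show "z \<in> (\<lambda>q. exp (2 * of_real pi * \<i> * q / of_real c)) ` {q. Im q > 0}"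
      using e by blast
  qed
qed

lemma exp_image_strip:
  fixes c :: real assumes c: "c > 0"
  shows "(\<lambda>q. exp (2 * of_real pi * \<i> * q / of_real c)) ` {q. 0 < Im q \<and> Im q < pi} = annulus (exp (- (2 * pi\<^sup>2 / c))) 1"
proof -
  have n: "cmod (exp (2 * of_real pi * \<i> * q / of_real c)) = exp (- (2 * pi * Im q / c))" for q
    by (simp add: Re_divide_of_real)
  have inv: "exp (2 * of_real pi * \<i> * (of_real c * Ln z / (2 * of_real pi * \<i>)) / of_real c) = z" if "z \<noteq> 0" for z
    using that c by simp
  have iff: "exp (- (2 * pi\<^sup>2 / c)) < exp (- (2 * pi * y / c)) \<and> exp (- (2 * pi * y / c)) < 1 \<longleftrightarrow> 0 < y \<and> y < pi" for y
  proof -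
    have "exp (- (2 * pi\<^sup>2 / c)) < exp (- (2 * pi * y / c)) \<longleftrightarrow> 2 * pi * y < 2 * pi * pi"
      using c by (simp add: divide_less_cancel power2_eq_square)
    moreover have "\<dots> \<longleftrightarrow> y < pi" by simp
    moreover have "exp (- (2 * pi * y / c)) < 1 \<longleftrightarrow> y > 0"
      using c by (simp add: zero_less_divide_iff zero_less_mult_iff)
    ultimately show ?thesis by blast
  qed
  show ?thesis
  proof (intro equalityI subsetI)
    fix z assume "z \<in> (\<lambda>q. exp (2 * of_real pi * \<i> * q / of_real c)) ` {q. 0 < Im q \<and> Im q < pi}"
    then obtain q where q: "z = exp (2 * of_real pi * \<i> * q / of_real c)" "0 < Im q \<and> Im q < pi" by blast
    then have "cmod z = exp (- (2 * pi * Im q / c))" using n by metis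
    then show "z \<in> annulus (exp (- (2 * pi\<^sup>2 / c))) 1" using q(2) iff by (simp add: annulus_def)
  next
    fix z :: complex assume z: "z \<in> annulus (exp (- (2 * pi\<^sup>2 / c))) 1"
    then have z0: "z \<noteq> 0" by (auto simp: annulus_def)
    let ?q = "of_real c * Ln z / (2 * of_real pi * \<i>)"
    have e: "z = exp (2 * of_real pi * \<i> * ?q / of_real c)" using inv z0 by simp
    then have "cmod z = exp (- (2 * pi * Im ?q / c))" using n by metis
    then have "0 < Im ?q \<and> Im ?q < pi" using z iff[of "Im ?q"] by (simp add: annulus_def)
    then show "z \<in> (\<lambda>q. exp (2 * of_real pi * \<i> * q / of_real c)) ` {q. 0 < Im q \<and> Im q < pi}"
      using e by blast
  qed
qed

lemma bij_betw_Ln_half_plane: "bij_betw Ln {z. Im z > 0} {q. 0 < Im q \<and> Im q < pi}"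
proof (rule bij_betw_byWitness[where f' = exp])
  show "\<forall>z\<in>{z. Im z > 0}. exp (Ln z) = z" by (intro ballI exp_Ln) auto
  show "\<forall>q\<in>{q. 0 < Im q \<and> Im q < pi}. Ln (exp q) = q" using pi_gt_zero by (auto intro!: Ln_exp)
  show "Ln ` {z. Im z > 0} \<subseteq> {q. 0 < Im q \<and> Im q < pi}" using Im_Ln_pos_lt_imp by fastforce
  show "exp ` {q. 0 < Im q \<and> Im q < pi} \<subseteq> {z. Im z > 0}"
    by (auto simp: Im_exp intro!: mult_pos_pos sin_gt_zero)
qed

text \<open>The translation by \<open>2\<pi>\<i>\<close> is a fixed-point free automorphism of the preimage, and the Riemann map
  makes it one of the disc.\<close>

lemma exp_preimage_half_plane_coordinate:
  assumes \<Omega>: "open \<Omega>" "\<Omega> \<noteq> {}" "0 \<notin> \<Omega>" "\<Omega> \<noteq> - {0}"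
    and sc: "simply_connected (exp -` \<Omega> :: complex set)"
  obtains P :: "complex \<Rightarrow> complex" and l \<beta> :: real where
    "P holomorphic_on exp -` \<Omega>" "bij_betw P (exp -` \<Omega>) upper_half_plane" "l > 0"
    "\<And>w. exp w \<in> \<Omega> \<Longrightarrow> P (w + 2 * of_real pi * \<i>) = of_real l * P w + of_real \<beta>"
proof -
  let ?S = "exp -` \<Omega> :: complex set"
  have oS: "open ?S" using \<Omega>(1) by (rule open_exp_preimage)
  have lift: "\<exists>w. z = exp w" if "z \<noteq> 0" for z :: complex using that by (metis exp_Ln)
  have ne: "?S \<noteq> {}"
  proof -
    obtain z where "z \<in> \<Omega>" using \<Omega>(2) by blast
    moreover then have "z \<noteq> 0" using \<Omega>(3) by metis
    ultimately show ?thesis using lift by auto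
  qed
  have nU: "?S \<noteq> UNIV"
  proof
    assume "?S = UNIV"
    then have "z \<in> \<Omega>" if "z \<noteq> 0" for z using lift[OF that] by auto
    then show False using \<Omega>(3,4) by auto
  qed
  obtain f g where f: "f holomorphic_on ?S" and g: "g holomorphic_on ball 0 1"
    and fg: "\<And>z. z \<in> ?S \<Longrightarrow> f z \<in> ball 0 1 \<and> g (f z) = z"
    and gf: "\<And>z. z \<in> ball 0 1 \<Longrightarrow> g z \<in> ?S \<and> f (g z) = z"
    using Riemann_mapping_theorem[of ?S] oS sc ne nU by (metis (no_types, lifting))
  have sh: "w + 2 * of_real pi * \<i> \<in> ?S" "w - 2 * of_real pi * \<i> \<in> ?S" if "w \<in> ?S" for w
    using that exp_shift[of w 1] exp_shift[of w "-1"] by simp_all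
  define t where "t z = f (g z + 2 * of_real pi * \<i>)" for z
  define s where "s z = f (g z - 2 * of_real pi * \<i>)" for z
  have hol: "t holomorphic_on ball 0 1" "s holomorphic_on ball 0 1"
  proof -
    have "(\<lambda>z. g z + 2 * of_real pi * \<i>) holomorphic_on ball 0 1"
         "(\<lambda>z. g z - 2 * of_real pi * \<i>) holomorphic_on ball 0 1" using g by (auto intro!: holomorphic_intros)
    from this[THEN holomorphic_on_compose_gen[OF _ f]]
    show "t holomorphic_on ball 0 1" "s holomorphic_on ball 0 1"
      using gf sh unfolding t_def[abs_def] s_def[abs_def] o_def by blast+
  qed
  have ts: "t z \<in> ball 0 1 \<and> s (t z) = z" "s z \<in> ball 0 1 \<and> t (s z) = z" if z: "z \<in> ball 0 1" for z
  proof -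
    have gz: "g z \<in> ?S" "f (g z) = z" using gf[OF z] by auto
    have 1: "f (g z + 2 * of_real pi * \<i>) \<in> ball 0 1" "g (f (g z + 2 * of_real pi * \<i>)) = g z + 2 * of_real pi * \<i>"
            "f (g z - 2 * of_real pi * \<i>) \<in> ball 0 1" "g (f (g z - 2 * of_real pi * \<i>)) = g z - 2 * of_real pi * \<i>"
      using fg[OF sh(1)[OF gz(1)]] fg[OF sh(2)[OF gz(1)]] by auto
    show "t z \<in> ball 0 1 \<and> s (t z) = z" unfolding t_def s_def 1(2) using 1(1) gz(2) by simp
    show "s z \<in> ball 0 1 \<and> t (s z) = z" unfolding t_def s_def 1(4) using 1(3) gz(2) by simp
  qed
  have nofix: "t z \<noteq> z" if z: "z \<in> ball 0 1" for z
  proof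
    assume "t z = z"
    then have "g (t z) = g z" by simp
    moreover have "g (t z) = g z + 2 * of_real pi * \<i>"
      using fg[OF sh(1)] gf[OF z] by (simp add: t_def)
    ultimately show False by simp
  qed
  obtain C \<mu> \<beta> where C: "C holomorphic_on ball 0 1" "bij_betw C (ball 0 1) upper_half_plane"
    and Ct: "\<And>z. z \<in> ball 0 1 \<Longrightarrow> C (t z) = \<mu> * C z + \<beta>"
    using fixed_point_free_disc_automorphism[OF hol ts nofix] by metis
  have "bij_betw t (ball 0 1) (ball 0 1)"
    by (rule bij_betw_byWitness[where f' = s]) (use ts in \<open>auto simp del: mem_ball\<close>)
  then have "bij_betw (C \<circ> t) (ball 0 1) upper_half_plane" using C(2) by (rule bij_betw_trans)
  then have "bij_betw ((\<lambda>z. \<mu> * z + \<beta>) \<circ> C) (ball 0 1) upper_half_plane"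
    by (subst bij_betw_cong[where g = "C \<circ> t"]) (use Ct in auto)
  then have aff: "bij_betw (\<lambda>z. \<mu> * z + \<beta>) upper_half_plane upper_half_plane"
    using bij_betw_comp_iff[OF C(2)] by blast
  note re = half_plane_affine_real[OF aff]
  define P where "P = C \<circ> f"
  have fb: "bij_betw f ?S (ball 0 1)"
    by (rule bij_betw_byWitness[where f' = g]) (use fg gf in blast)+
  show thesis
  proof (rule that[of P "Re \<mu>" "Re \<beta>"])
    show "P holomorphic_on ?S" unfolding P_def
      by (rule holomorphic_on_compose_gen[OF f C(1)]) (use fg in blast)
    show "bij_betw P ?S upper_half_plane" unfolding P_def using fb C(2) by (rule bij_betw_trans)
    show "Re \<mu> > 0" by (rule re)
    fix w assume "exp w \<in> \<Omega>"
    then have w: "w \<in> ?S" by simp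
    have "P (w + 2 * of_real pi * \<i>) = C (t (f w))" using fg[OF w] by (simp add: P_def t_def)
    also have "\<dots> = \<mu> * P w + \<beta>" using Ct fg[OF w] by (simp add: P_def)
    finally show "P (w + 2 * of_real pi * \<i>) = of_real (Re \<mu>) * P w + of_real (Re \<beta>)"
      using re(1,3) by simp
  qed
qed

text \<open>The domain is the quotient of a half-plane by the group generated by \<open>z \<mapsto> l z + \<beta>\<close>, and it is an annulus
  unless \<open>l = 1\<close>.\<close>

theorem doubly_connected_uniformization:
  assumes R: "ring_with_hole \<Omega> K" and unb: "\<not> bounded (- \<Omega>)"
    and noiso: "\<And>k. k \<notin> \<Omega> \<Longrightarrow> \<not> open (insert k \<Omega>)"
  obtains r R where "0 < r" "r < R" "conformally_equivalent \<Omega> (annulus r R)"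
proof -
  \<comment> \<open>A translation puts the origin into the hole.\<close>
  obtain k0 where k0: "k0 \<in> K" using R unfolding ring_with_hole_def by blast
  define F where "F z = z - k0" for z :: complex
  define G where "G z = z + k0" for z :: complex
  have FG: "continuous_on UNIV F" "continuous_on UNIV G" "\<And>z. G (F z) = z" "\<And>z. F (G z) = z"
    by (auto simp: F_def G_def intro!: continuous_intros)
  define \<Omega>0 where "\<Omega>0 = F ` \<Omega>"
  have R0: "ring_with_hole \<Omega>0 (F ` K)" unfolding \<Omega>0_def by (rule ring_with_hole_homeo[OF FG R])
  have zK: "0 \<in> F ` K" using k0 by (auto simp: F_def)
  have r0: "open \<Omega>0" "\<Omega>0 \<noteq> {}" "F ` K \<inter> \<Omega>0 = {}" using R0 unfolding ring_with_hole_def by blast+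
  have z0: "0 \<notin> \<Omega>0" using zK r0(3) by blast
  have compl: "- \<Omega>0 = F ` (- \<Omega>)"
  proof -
    have "bij F" using FG(3,4) by (metis bijI' )
    then show ?thesis unfolding \<Omega>0_def by (simp add: bij_image_Compl_eq)
  qed
  have unb0: "\<not> bounded (- \<Omega>0)"
  proof
    assume "bounded (- \<Omega>0)"
    then have "bounded ((\<lambda>z. k0 + z) ` (- \<Omega>0))" by (rule bounded_translation)
    moreover have "(\<lambda>z. k0 + z) ` (- \<Omega>0) = - \<Omega>" unfolding compl by (simp add: image_image F_def)
    ultimately show False using unb by simp
  qed
  have noiso0: "\<not> open (insert k \<Omega>0)" if "k \<notin> \<Omega>0" for k
  proof
    assume "open (insert k \<Omega>0)"
    then have "open (G ` insert k \<Omega>0)" by (rule homeo_open_image[OF FG(1) FG(4,3)])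
    moreover have "G ` insert k \<Omega>0 = insert (G k) \<Omega>" by (simp add: \<Omega>0_def image_image FG(3))
    moreover have "G k \<notin> \<Omega>" using that FG(4) by (metis \<Omega>0_def imageI)
    ultimately show False using noiso by metis
  qed
  have np: "\<Omega>0 \<noteq> - {0}"
  proof
    assume "\<Omega>0 = - {0}"
    then have "insert 0 \<Omega>0 = UNIV" by auto
    then show False using noiso0[OF z0] by simp
  qed
  have inj_F: "conformally_equivalent \<Omega> \<Omega>0"
    unfolding conformally_equivalent_def \<Omega>0_def bij_betw_def F_def
    by (intro exI[of _ "\<lambda>z. z - k0"]) (auto intro!: holomorphic_intros inj_onI)
  obtain P l \<beta> where P: "P holomorphic_on exp -` \<Omega>0" "bij_betw P (exp -` \<Omega>0) upper_half_plane" "l > 0"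
    "\<And>w. exp w \<in> \<Omega>0 \<Longrightarrow> P (w + 2 * of_real pi * \<i>) = of_real l * P w + of_real \<beta>"
    using exp_preimage_half_plane_coordinate[OF r0(1,2) z0 np
      ring_exp_preimage_simply_connected[OF R0 zK unb0]] by metis
  have shS: "exp (w + 2 * of_real pi * \<i>) = exp w" for w :: complex using exp_shift[of w 1] by simp
  show thesis
  proof (cases "l = 1")
    case True
    \<comment> \<open>The translation is parabolic, so \<open>\<Omega>0\<close> is a punctured disc.  Its puncture would be an isolated
      point of the complement, finite or at infinity.\<close>
    have sh: "P (w + 2 * of_real pi * \<i>) = P w + of_real \<beta>" if "exp w \<in> \<Omega>0" for w
      using P(4)[OF that] True by simp
    have "\<beta> \<noteq> 0"
    proof
      assume b: "\<beta> = 0"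
      obtain z where z: "z \<in> \<Omega>0" using r0 by blast
      then have "z \<noteq> 0" using z0 by metis
      then have w: "exp (Ln z) \<in> \<Omega>0" using z by simp
      have "P (Ln z + 2 * of_real pi * \<i>) = P (Ln z)" using sh[OF w] b by simp
      moreover have "inj_on P (exp -` \<Omega>0)" using P(2) by (simp add: bij_betw_def)
      ultimately have "Ln z + 2 * of_real pi * \<i> = Ln z"
        using inj_onD[of P "exp -` \<Omega>0" "Ln z + 2 * of_real pi * \<i>" "Ln z"] w shS by simp
      then show False by simp
    qed
    then obtain e where e: "e holomorphic_on \<Omega>0"
      "bij_betw e \<Omega>0 ((\<lambda>q. exp (2 * of_real pi * \<i> * q / of_real \<beta>)) ` upper_half_plane)"
      using exp_quotient_biholomorphic[OF r0(1) z0 P(1,2) _ sh] by metis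
    then have "conformally_equivalent \<Omega>0 ((\<lambda>q. exp (2 * of_real pi * \<i> * q / of_real \<beta>)) ` upper_half_plane)"
      unfolding conformally_equivalent_def by blast
    then have "conformally_equivalent \<Omega>0 (ball 0 1 - {0})"
      using conformally_equivalent_negate_period[of \<Omega>0 \<beta> upper_half_plane] \<open>\<beta> \<noteq> 0\<close>
        exp_image_halfplane[of \<beta>] exp_image_halfplane[of "- \<beta>"] by (cases "\<beta> > 0") auto
    then have "conformally_equivalent (ball 0 1 - {0}) \<Omega>0" by (rule conformally_equivalent_sym[OF r0(1)])
    then obtain f where f: "f holomorphic_on (ball 0 1 - {0})" "inj_on f (ball 0 1 - {0})" "f ` (ball 0 1 - {0}) = \<Omega>0"
      unfolding conformally_equivalent_def bij_betw_def by blast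
    show thesis using punctured_disc_end[OF f(1,2)] noiso0 unb0 unfolding f(3) by blast
  next
    case False
    \<comment> \<open>The translation is hyperbolic.  After its finite fixed point \<open>x0\<close> is moved to the origin, the
      logarithm turns the half-plane into a strip and the dilation by \<open>l\<close> into a translation.\<close>
    define x0 where "x0 = \<beta> / (1 - l)"
    define Q where "Q w = Ln (P w - of_real x0)" for w
    have Pim: "Im (P w - of_real x0) > 0" if "exp w \<in> \<Omega>0" for w
      using bij_betwE[OF P(2)] that by auto
    have b1: "bij_betw (\<lambda>z. z - of_real x0) upper_half_plane upper_half_plane"
      by (rule bij_betw_byWitness[where f' = "\<lambda>z. z + of_real x0"]) auto
    have Qb: "bij_betw Q (exp -` \<Omega>0) {q. 0 < Im q \<and> Im q < pi}"
      using bij_betw_trans[OF bij_betw_trans[OF P(2) b1] bij_betw_Ln_half_plane]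
      by (simp add: Q_def[abs_def] o_def)
    have Qh: "Q holomorphic_on (exp -` \<Omega>0)"
      unfolding Q_def using P(1) Pim by (intro holomorphic_intros) (force simp: complex_nonpos_Reals_iff)+
    have c0: "ln l \<noteq> 0" using False P(3) by simp
    have Qs: "Q (w + 2 * of_real pi * \<i>) = Q w + of_real (ln l)" if w: "exp w \<in> \<Omega>0" for w
    proof -
      have "x0 * (1 - l) = \<beta>" using False by (simp add: x0_def)
      then have "\<beta> - x0 = - (l * x0)" by (simp add: algebra_simps)
      then have "of_real \<beta> - of_real x0 = - (of_real l * of_real x0 :: complex)"
        by (metis of_real_diff of_real_minus of_real_mult)
      then have "P (w + 2 * of_real pi * \<i>) - of_real x0 = of_real l * (P w - of_real x0)"
        using P(4)[OF w] by (simp add: algebra_simps)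
      moreover have "P w - of_real x0 \<noteq> 0" using Pim[OF w] by auto
      ultimately show ?thesis using P(3) by (simp add: Q_def Ln_times_of_real Ln_of_real)
    qed
    obtain e where e: "e holomorphic_on \<Omega>0"
      "bij_betw e \<Omega>0 ((\<lambda>q. exp (2 * of_real pi * \<i> * q / of_real (ln l))) ` {q. 0 < Im q \<and> Im q < pi})"
      using exp_quotient_biholomorphic[OF r0(1) z0 Qh Qb c0 Qs] by metis
    then have "conformally_equivalent \<Omega>0 ((\<lambda>q. exp (2 * of_real pi * \<i> * q / of_real (ln l))) ` {q. 0 < Im q \<and> Im q < pi})"
      unfolding conformally_equivalent_def by blast
    then have "conformally_equivalent \<Omega>0 (annulus (exp (- (2 * pi\<^sup>2 / \<bar>ln l\<bar>))) 1)"
      using conformally_equivalent_negate_period[of \<Omega>0 "ln l" "{q. 0 < Im q \<and> Im q < pi}"] c0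
        exp_image_strip[of "ln l"] exp_image_strip[of "- ln l"] by (cases "ln l > 0") auto
    then have "conformally_equivalent \<Omega> (annulus (exp (- (2 * pi\<^sup>2 / \<bar>ln l\<bar>))) 1)"
      using inj_F conformally_equivalent_trans by blast
    then show thesis by (rule that[rotated 2]) (use c0 in auto)
  qed
qed

section \<open>Areas of images of rectangles\<close>

text \<open>The coordinate isomorphism onto \<open>real^2\<close>, where the change of variables formula is stated.\<close>

definition vec2 :: "complex \<Rightarrow> real^2" where "vec2 z = vector [Re z, Im z]"
definition of_vec2 :: "real^2 \<Rightarrow> complex" where "of_vec2 x = Complex (x $ 1) (x $ 2)"

lemma vec2_nth [simp]: "vec2 z $ 1 = Re z" "vec2 z $ 2 = Im z"
  by (simp_all add: vec2_def)

lemma of_vec2_sel [simp]: "Re (of_vec2 x) = x $ 1" "Im (of_vec2 x) = x $ 2"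
  by (simp_all add: of_vec2_def)

lemma vec2_of_vec2 [simp]: "vec2 (of_vec2 x) = x" "of_vec2 (vec2 z) = z"
  by (simp_all add: vec_eq_iff forall_2 complex_eq_iff)

lemma bounded_linear_vec2: "bounded_linear vec2"
  unfolding linear_conv_bounded_linear[symmetric] by (rule linearI; simp add: vec_eq_iff forall_2)

lemma bounded_linear_of_vec2: "bounded_linear of_vec2"
  unfolding linear_conv_bounded_linear[symmetric] by (rule linearI; simp add: complex_eq_iff)

lemma det_affine_derivative:
  "det (matrix (\<lambda>x. vec2 (a * of_vec2 x + b * cnj (of_vec2 x)))) = (cmod a)\<^sup>2 - (cmod b)\<^sup>2"
  unfolding cmod_power2
  by (simp add: det_2 matrix_def axis_def power2_eq_square algebra_simps)

lemma has_integral_real2_pair: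
  fixes f :: "real^2 \<Rightarrow> real"
  assumes "(f has_integral i) (cbox (vector [x1, y1]) (vector [x2, y2]))"
  shows "((\<lambda>(s, t). f (vector [s, t])) has_integral i) (cbox (x1, y1) (x2, y2))"
proof -
  define g where "g = (\<lambda>(s, t). vector [s, t] :: real^2)"
  define h where "h x = (x $ 1, x $ 2)" for x :: "real^2"
  have hg: "h (g x) = x" for x by (cases x) (simp add: g_def h_def)
  have gh: "g (h x) = x" for x by (simp add: g_def h_def vec_eq_iff forall_2)
  have gbox: "g ` cbox u v = cbox (g u) (g v)" for u v
  proof -
    have "x \<in> g ` cbox u v \<longleftrightarrow> x \<in> cbox (g u) (g v)" for x
    proof -
      have "x \<in> g ` cbox u v \<longleftrightarrow> h x \<in> cbox u v" using hg gh by (metis image_iff)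
      also have "\<dots> \<longleftrightarrow> x \<in> cbox (g u) (g v)"
        by (cases u, cases v) (simp add: h_def g_def mem_box_cart forall_2 cbox_Pair_eq)
      finally show ?thesis .
    qed
    then show ?thesis by blast
  qed
  have hbox: "h ` cbox u v = cbox (h u) (h v)" for u v
    using gbox[of "h u" "h v"] hg gh by (metis (no_types, lifting) image_image image_ident image_cong)
  have "bounded_linear g" unfolding g_def
    linear_conv_bounded_linear[symmetric] by (rule linearI; auto simp: vec_eq_iff forall_2)
  then have cont: "continuous (at x) g" for x by (simp add: linear_continuous_at)
  have cont_g: "measure lborel (g ` cbox u v) = 1 * measure lborel (cbox u v)" for u v
  proof -
    obtain u1 u2 v1 v2 where uv: "u = (u1, u2)" "v = (v1, v2)" by (cases u, cases v) auto
    show ?thesis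
    proof (cases "u1 \<le> v1 \<and> u2 \<le> v2")
      case True
      then have "cbox (g u) (g v) \<noteq> {}" unfolding uv g_def by (simp add: interval_ne_empty_cart forall_2)
      then have "measure lborel (cbox (g u) (g v)) = (v1 - u1) * (v2 - u2)"
        by (simp add: content_cbox_cart uv g_def UNIV_2)
      then show ?thesis using True unfolding gbox by (simp add: uv content_Pair)
    next
      case False
      then have "cbox u v = {}" unfolding uv by (auto simp: cbox_Pair_eq)
      then show ?thesis by simp
    qed
  qed
  have "((\<lambda>x. f (g x)) has_integral (1 / 1) *\<^sub>R i) (h ` cbox (vector [x1, y1]) (vector [x2, y2]))"
    by (rule has_integral_twiddle[where f = f and g = g and h = h, OF _ hg gh cont _ _ cont_g assms])
       (use gbox hbox in \<open>simp, blast+\<close>)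
  then show ?thesis unfolding hbox by (simp add: g_def h_def case_prod_unfold)
qed

text \<open>The change of variables formula, followed by Fubini's theorem.\<close>

lemma area_image_le:
  fixes L a b :: "complex \<Rightarrow> complex" and x1 x2 y1 y2 u1 u2 v1 v2 :: real
  defines "Q \<equiv> cbox (Complex x1 y1) (Complex x2 y2)"
  assumes der: "\<And>w. w \<in> Q \<Longrightarrow> (L has_derivative (\<lambda>v. a w * v + b w * cnj v)) (at w)"
    and cont: "continuous_on Q a" "continuous_on Q b" and inj: "inj_on L Q"
    and im: "L ` Q \<subseteq> cbox (Complex u1 v1) (Complex u2 v2)" and uv: "u1 \<le> u2" "v1 \<le> v2"
  shows "integral {x1..x2} (\<lambda>s. integral {y1..y2} (\<lambda>t. \<bar>(cmod (a (Complex s t)))\<^sup>2 - (cmod (b (Complex s t)))\<^sup>2\<bar>))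
     \<le> (u2 - u1) * (v2 - v1)"
proof -
  define J where "J w = \<bar>(cmod (a w))\<^sup>2 - (cmod (b w))\<^sup>2\<bar>" for w
  define f where "f x = vec2 (L (of_vec2 x))" for x
  define f' where "f' x = (\<lambda>v. vec2 (a (of_vec2 x) * of_vec2 v + b (of_vec2 x) * cnj (of_vec2 v)))" for x
  define S :: "(real^2) set" where "S = cbox (vector [x1, y1]) (vector [x2, y2])"
  have mem: "of_vec2 x \<in> Q \<longleftrightarrow> x \<in> S" for x
    by (simp add: Q_def S_def mem_box_cart forall_2 in_cbox_complex_iff)
  have dv: "(vec2 has_derivative vec2) F" "(of_vec2 has_derivative of_vec2) F'" for F F'
    by (rule bounded_linear_imp_has_derivative bounded_linear_vec2 bounded_linear_of_vec2)+
  have derf: "(f has_derivative f' x) (at x within S)" if "x \<in> S" for x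
  proof -
    have "(L has_derivative (\<lambda>v. a (of_vec2 x) * v + b (of_vec2 x) * cnj v)) (at (of_vec2 x))"
      using der mem that by blast
    from diff_chain_at[OF dv(2) this]
    have "(L \<circ> of_vec2 has_derivative (\<lambda>v. a (of_vec2 x) * v + b (of_vec2 x) * cnj v) \<circ> of_vec2) (at x)" .
    from diff_chain_at[OF this dv(1)]
    have "(f has_derivative f' x) (at x)" by (simp add: f_def[abs_def] f'_def o_def)
    then show ?thesis by (rule has_derivative_at_withinI)
  qed
  have injf: "inj_on f S"
  proof (rule inj_onI)
    fix x y assume xy: "x \<in> S" "y \<in> S" "f x = f y"
    then have "of_vec2 (f x) = of_vec2 (f y)" by simp
    then have "L (of_vec2 x) = L (of_vec2 y)" by (simp only: f_def vec2_of_vec2)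
    then have "of_vec2 x = of_vec2 y" using inj mem xy by (meson inj_onD)
    then have "vec2 (of_vec2 x) = vec2 (of_vec2 y)" by simp
    then show "x = y" by simp
  qed
  have detf: "\<bar>det (matrix (f' x))\<bar> = J (of_vec2 x)" for x
    unfolding f'_def det_affine_derivative J_def ..
  have contJ: "continuous_on Q J" unfolding J_def using cont by (intro continuous_intros)
  have contJ2: "continuous_on S (\<lambda>x. J (of_vec2 x))"
    by (rule continuous_on_compose2[OF contJ]) (use mem linear_continuous_on[OF bounded_linear_of_vec2] in auto)
  then obtain m where m: "((\<lambda>x. J (of_vec2 x)) has_integral m) S"
    using integrable_continuous S_def by blast
  have "S \<in> sets lebesgue" by (simp add: S_def)
  from has_measure_differentiable_image[OF this derf injf, of m] m
  have meas: "f ` S \<in> lmeasurable" "measure lebesgue (f ` S) = m" by (simp_all add: detf)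
  have sub: "f ` S \<subseteq> cbox (vector [u1, v1]) (vector [u2, v2])"
  proof clarify
    fix x assume "x \<in> S"
    then have "L (of_vec2 x) \<in> cbox (Complex u1 v1) (Complex u2 v2)" using im mem by blast
    then show "f x \<in> cbox (vector [u1, v1]) (vector [u2, v2])"
      by (simp add: f_def mem_box_cart forall_2 in_cbox_complex_iff)
  qed
  have "m \<le> measure lebesgue (cbox (vector [u1, v1]) (vector [u2, v2] :: real^2))"
    unfolding meas(2)[symmetric] by (rule measure_mono_fmeasurable[OF sub]) (use meas(1) in auto)
  also have "\<dots> = (u2 - u1) * (v2 - v1)"
  proof -
    have "cbox (vector [u1, v1]) (vector [u2, v2] :: real^2) \<noteq> {}" using uv by (simp add: interval_ne_empty_cart forall_2)
    then show ?thesis by (simp add: content_cbox_cart UNIV_2)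
  qed
  finally have m_le: "m \<le> (u2 - u1) * (v2 - v1)" .
  have "((\<lambda>(s, t). J (of_vec2 (vector [s, t]))) has_integral m) (cbox (x1, y1) (x2, y2))"
    by (rule has_integral_real2_pair) (use m S_def in simp)
  moreover have "of_vec2 (vector [s, t]) = Complex s t" for s t by (simp add: of_vec2_def)
  ultimately have mp: "((\<lambda>(s, t). J (Complex s t)) has_integral m) (cbox (x1, y1) (x2, y2))" by simp
  have "continuous_on (cbox (x1, y1) (x2, y2)) (\<lambda>p. J (Complex (fst p) (snd p)))"
  proof (rule continuous_on_compose2[OF contJ])
    show "continuous_on (cbox (x1, y1) (x2, y2)) (\<lambda>p. Complex (fst p) (snd p))"
      by (intro continuous_intros)
    show "(\<lambda>p. Complex (fst p) (snd p)) ` cbox (x1, y1) (x2, y2) \<subseteq> Q"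
      by (auto simp: Q_def in_cbox_complex_iff cbox_Pair_eq)
  qed
  then have "continuous_on (cbox (x1, y1) (x2, y2)) (\<lambda>(s, t). J (Complex s t))" by (simp add: case_prod_beta)
  from integral_prod_continuous[OF this] mp
  have "m = integral (cbox x1 x2) (\<lambda>s. integral (cbox y1 y2) (\<lambda>t. J (Complex s t)))"
    by (metis (no_types, lifting) integral_unique case_prod_conv integral_cong)
  then show ?thesis using m_le by (simp add: J_def)
qed

section \<open>The length-area inequality\<close>

text \<open>Bounded errors disappear when the number of periods grows.\<close>

lemma of_nat_mult_le_imp_le:
  fixes x y c :: real
  assumes "\<And>n::nat. n \<ge> 1 \<Longrightarrow> of_nat n * x \<le> of_nat n * y + c"
  shows "x \<le> y"
proof (rule ccontr)
  assume "\<not> x \<le> y"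
  then have d: "x - y > 0" by simp
  obtain n :: nat where n: "of_nat n > c / (x - y)" "n \<ge> 1"
  proof -
    obtain m :: nat where "of_nat m > c / (x - y)" using reals_Archimedean2 by blast
    then show thesis using that[of "Suc m"] by simp
  qed
  then have "c < of_nat n * (x - y)" using d by (simp add: pos_divide_less_eq)
  then show False using assms[OF n(2)] by (simp add: right_diff_distrib)
qed

text \<open>\<open>Im (\<i> * (a - b))\<close> is the vertical derivative of the imaginary part.  Its square is at most
  \<open>K = (1 + k) / (1 - k)\<close> times the Jacobian, and \<open>y\<^sup>2 \<ge> 2 M y - M\<^sup>2\<close> replaces the Cauchy-Schwarz
  inequality in the length-area argument.\<close>

lemma jacobian_lower_bound:
  fixes a b :: complex and k M :: real
  assumes k: "0 \<le> k" "k < 1" and ba: "cmod b \<le> k * cmod a"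
  shows "(1 - k) / (1 + k) * (2 * M * Im (\<i> * (a - b)) - M\<^sup>2) \<le> \<bar>(cmod a)\<^sup>2 - (cmod b)\<^sup>2\<bar>"
proof -
  let ?y = "Im (\<i> * (a - b))"
  have "?y\<^sup>2 - (2 * M * ?y - M\<^sup>2) = (?y - M)\<^sup>2" by (simp add: power2_eq_square algebra_simps)
  then have 1: "2 * M * ?y - M\<^sup>2 \<le> ?y\<^sup>2" using zero_le_power2[of "?y - M"] by linarith
  have "\<bar>?y\<bar> \<le> cmod (\<i> * (a - b))" by (rule abs_Im_le_cmod)
  also have "\<dots> = cmod (a - b)" by (simp add: norm_mult)
  also have "\<dots> \<le> cmod a + cmod b" by (rule norm_triangle_ineq4)
  also have "\<dots> \<le> (1 + k) * cmod a" using ba by (simp add: algebra_simps)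
  finally have "?y\<^sup>2 \<le> ((1 + k) * cmod a)\<^sup>2" by (rule abs_le_square_iff[THEN iffD1, OF order_trans]) simp
  then have 2: "2 * M * ?y - M\<^sup>2 \<le> (1 + k)\<^sup>2 * (cmod a)\<^sup>2" using 1 by (simp add: power_mult_distrib)
  have "(1 - k) / (1 + k) * (2 * M * ?y - M\<^sup>2) \<le> (1 - k) / (1 + k) * ((1 + k)\<^sup>2 * (cmod a)\<^sup>2)"
    using k 2 by (intro mult_left_mono) auto
  also have "\<dots> = (1 - k\<^sup>2) * (cmod a)\<^sup>2"
    using k by (simp add: power2_eq_square field_simps)
  also have "\<dots> = (cmod a)\<^sup>2 - (k * cmod a)\<^sup>2" by (simp add: power_mult_distrib algebra_simps)
  also have "\<dots> \<le> (cmod a)\<^sup>2 - (cmod b)\<^sup>2"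
    using power_mono[OF ba, of 2] by simp
  finally show ?thesis by linarith
qed

text \<open>Over \<open>n\<close> periods, each vertical segment is stretched over a height of \<open>2\<pi> \<bar>N\<bar> n\<close>.  This bounds the area of
  the image of the rectangle below by a multiple of \<open>n\<close>, while the image lies in a box of area
  \<open>(u2 - u1) (2\<pi> \<bar>N\<bar> n + 2 B)\<close>.  Comparing as \<open>n\<close> grows avoids counting overlaps modulo the
  period.\<close>

lemma strip_length_area:
  fixes L a b :: "complex \<Rightarrow> complex" and N :: int and s1 s2 u1 u2 k :: real
  defines "Q \<equiv> {w. s1 \<le> Re w \<and> Re w \<le> s2}"
  assumes s: "s1 \<le> s2"
    and der: "\<And>w. w \<in> Q \<Longrightarrow> (L has_derivative (\<lambda>v. a w * v + b w * cnj v)) (at w)"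
    and cont: "continuous_on Q a" "continuous_on Q b"
    and inj: "inj_on L Q"
    and shift: "\<And>w. w \<in> Q \<Longrightarrow> L (w + 2 * of_real pi * \<i>) = L w + of_int N * (2 * of_real pi * \<i>)"
    and N: "N \<noteq> 0"
    and Re: "\<And>w. w \<in> Q \<Longrightarrow> u1 \<le> Re (L w) \<and> Re (L w) \<le> u2"
    and k: "0 \<le> k" "k < 1" and ba: "\<And>w. w \<in> Q \<Longrightarrow> cmod (b w) \<le> k * cmod (a w)"
  shows "(s2 - s1) * ((1 - k) / (1 + k)) \<le> u2 - u1"
proof -
  define \<kappa> where "\<kappa> = (1 - k) / (1 + k)"
  have \<kappa>: "\<kappa> > 0" using k by (simp add: \<kappa>_def)
  have shn: "L (w + of_nat j * (2 * of_real pi * \<i>)) = L w + of_nat j * (of_int N * (2 * of_real pi * \<i>))"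
    if "w \<in> Q" for w j
  proof (induction j)
    case (Suc j)
    have "w + of_nat j * (2 * of_real pi * \<i>) \<in> Q" using that by (simp add: Q_def)
    from shift[OF this] Suc show ?case by (simp add: algebra_simps)
  qed simp
  have contL: "continuous_on Q L"
    by (rule continuous_at_imp_continuous_on) (use der has_derivative_continuous in blast)
  have u: "u1 \<le> u2" using Re[of "Complex s1 0"] s by (simp add: Q_def)
  \<comment> \<open>A bound \<open>B\<close> for \<open>L\<close> over one period controls its imaginary part over \<open>n\<close> periods up to a
    constant.\<close>
  define Q0 where "Q0 = cbox (Complex s1 0) (Complex s2 (2 * pi))"
  have Q0: "Q0 \<subseteq> Q" by (auto simp: Q0_def Q_def in_cbox_complex_iff)
  have "compact (L ` Q0)"
    by (rule compact_continuous_image[OF continuous_on_subset[OF contL Q0]]) (simp add: Q0_def)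
  then have "bounded (L ` Q0)" by (rule compact_imp_bounded)
  then obtain B where B: "\<And>w. w \<in> Q0 \<Longrightarrow> cmod (L w) \<le> B" unfolding bounded_iff by blast
  have "Complex s1 0 \<in> Q0" using s by (simp add: Q0_def in_cbox_complex_iff)
  then have B0: "B \<ge> 0" using B norm_ge_zero order_trans by blast
  have main: "of_nat n * ((s2 - s1) * \<kappa> * (2 * pi * (real_of_int N)\<^sup>2)) \<le> of_nat n * ((u2 - u1) * (2 * pi * \<bar>real_of_int N\<bar>)) + (u2 - u1) * (2 * B)"
    if n: "n \<ge> 1" for n :: nat
  proof -
    define T where "T = 2 * pi * of_nat n"
    have T: "T > 0" using n by (simp add: T_def)
    define R where "R = cbox (Complex s1 0) (Complex s2 T)"
    have RQ: "R \<subseteq> Q" by (auto simp: R_def Q_def in_cbox_complex_iff)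
    define v1 where "v1 = min 0 (2 * pi * N * n) - B"
    define v2 where "v2 = max 0 (2 * pi * N * n) + B"
    have "max 0 x - min 0 x = \<bar>x\<bar>" for x :: real by (simp add: max_def min_def)
    then have "max 0 (2 * pi * N * n) - min 0 (2 * pi * N * n) = of_nat n * (2 * pi * \<bar>real_of_int N\<bar>)"
      by (simp add: abs_mult)
    moreover have "min 0 (2 * pi * N * n) \<le> max 0 (2 * pi * N * n)" by simp
    ultimately have v: "v1 \<le> v2" "v2 - v1 = of_nat n * (2 * pi * \<bar>real_of_int N\<bar>) + 2 * B"
      using B0 unfolding v1_def v2_def by linarith+
    have im: "L ` R \<subseteq> cbox (Complex u1 v1) (Complex u2 v2)"
    proof clarify
      fix w assume w: "w \<in> R"
      then have wI: "0 \<le> Im w" "Im w \<le> T" "s1 \<le> Re w" "Re w \<le> s2" by (auto simp: R_def in_cbox_complex_iff)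
      obtain j :: nat where j: "j \<le> n" "of_nat j * (2 * pi) \<le> Im w" "Im w \<le> of_nat j * (2 * pi) + 2 * pi"
      proof -
        define j where "j = nat \<lfloor>Im w / (2 * pi)\<rfloor>"
        have f: "real j = of_int \<lfloor>Im w / (2 * pi)\<rfloor>" using wI(1) by (simp add: j_def)
        have 1: "real j \<le> Im w / (2 * pi)" "Im w / (2 * pi) < real j + 1" unfolding f by linarith+
        have 2: "Im w / (2 * pi) \<le> n" using wI(2) by (simp add: T_def pos_divide_le_eq mult_ac)
        have 3: "real j \<le> real n" using 1(1) 2 by linarith
        show thesis
        proof (rule that[of j])
          show "j \<le> n" using 3 by simp
          show "of_nat j * (2 * pi) \<le> Im w" using 1(1) by (simp add: pos_le_divide_eq)
          have "Im w < (real j + 1) * (2 * pi)" using 1(2) by (simp add: pos_divide_less_eq)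
          then show "Im w \<le> of_nat j * (2 * pi) + 2 * pi" by (simp add: algebra_simps)
        qed
      qed
      define w0 where "w0 = w - of_nat j * (2 * of_real pi * \<i>)"
      have w0: "w0 \<in> Q0" using j wI by (simp add: w0_def Q0_def in_cbox_complex_iff algebra_simps)
      have "L w = L w0 + of_nat j * (of_int N * (2 * of_real pi * \<i>))"
        using shn[of w0 j] w0 Q0 by (auto simp: w0_def)
      then have "Im (L w) = Im (L w0) + j * (N * (2 * pi))" by simp
      moreover have "\<bar>Im (L w0)\<bar> \<le> B" using B[OF w0] abs_Im_le_cmod[of "L w0"] by linarith
      moreover have e: "2 * pi * N * n = real n * (N * (2 * pi))" by simp
      have "min 0 (2 * pi * N * n) \<le> j * (N * (2 * pi)) \<and> j * (N * (2 * pi)) \<le> max 0 (2 * pi * N * n)"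
      proof (cases "N \<ge> 0")
        case True
        then have "real j * (N * (2 * pi)) \<le> real n * (N * (2 * pi))" using j(1) by (intro mult_right_mono) auto
        moreover have "0 \<le> real j * (N * (2 * pi))" using True by simp
        ultimately show ?thesis unfolding e by linarith
      next
        case False
        then have "real n * (N * (2 * pi)) \<le> real j * (N * (2 * pi))" using j(1) 
          by (intro mult_right_mono_neg) (auto simp: mult_le_0_iff)
        moreover have "real j * (N * (2 * pi)) \<le> 0" using False by (simp add: mult_le_0_iff)
        ultimately show ?thesis unfolding e by linarith
      qed
      ultimately have "v1 \<le> Im (L w) \<and> Im (L w) \<le> v2" unfolding v1_def v2_def by linarith
      then show "L w \<in> cbox (Complex u1 v1) (Complex u2 v2)"
        using Re[of w] w RQ by (auto simp: in_cbox_complex_iff)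
    qed
    define J where "J s t = \<bar>(cmod (a (Complex s t)))\<^sup>2 - (cmod (b (Complex s t)))\<^sup>2\<bar>" for s t
    have area: "integral {s1..s2} (\<lambda>s. integral {0..T} (J s)) \<le> (u2 - u1) * (v2 - v1)"
      unfolding J_def
      by (rule area_image_le[OF _ _ _ _ _ u v(1), where L = L])
         (use der cont RQ inj im in \<open>auto simp: R_def[symmetric] intro: continuous_on_subset inj_on_subset\<close>)
    have contJ: "continuous_on (cbox (s1, 0) (s2, T)) (\<lambda>(s, t). J s t)"
    proof -
      have c: "continuous_on (cbox (s1, 0) (s2, T)) (\<lambda>p. Complex (fst p) (snd p))"
        by (intro continuous_intros)
      have sub: "(\<lambda>p. Complex (fst p) (snd p)) ` cbox (s1, 0) (s2, T) \<subseteq> Q"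
        by (auto simp: Q_def cbox_Pair_eq)
      show ?thesis unfolding J_def case_prod_beta
        by (intro continuous_intros continuous_on_compose2[OF cont(1) c sub] continuous_on_compose2[OF cont(2) c sub])
    qed
    \<comment> \<open>The vertical segment at \<open>s\<close> is mapped to a curve that climbs by \<open>2 * pi * N * n\<close>.\<close>
    have inner: "\<kappa> * (2 * pi * (real_of_int N)\<^sup>2) * n \<le> integral {0..T} (J s)" if st: "s \<in> {s1..s2}" for s
    proof -
      define A where "A t = \<i> * (a (Complex s t) - b (Complex s t))" for t
      have inQ: "Complex s t \<in> Q" for t using st by (simp add: Q_def)
      have derA: "((\<lambda>t. Im (L (Complex s t))) has_vector_derivative Im (A t)) (at t within {0..T})" for t
      proof -
        have "((\<lambda>t. Complex s t) has_derivative (\<lambda>t. Complex 0 t)) (at t)"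
          unfolding Complex_eq by (auto intro!: derivative_eq_intros)
        from diff_chain_at[OF this der[OF inQ]]
        have "((\<lambda>t. L (Complex s t)) has_derivative (\<lambda>v. a (Complex s t) * Complex 0 v + b (Complex s t) * cnj (Complex 0 v))) (at t)"
          by (simp add: o_def)
        from bounded_linear.has_derivative[OF bounded_linear_Im this]
        have "((\<lambda>t. Im (L (Complex s t))) has_derivative (\<lambda>v. Im (a (Complex s t) * Complex 0 v + b (Complex s t) * cnj (Complex 0 v)))) (at t)" .
        moreover have "(\<lambda>v. Im (a (Complex s t) * Complex 0 v + b (Complex s t) * cnj (Complex 0 v))) = (\<lambda>v. v *\<^sub>R Im (A t))"
          by (rule ext) (simp add: A_def algebra_simps)
        ultimately show ?thesis unfolding has_vector_derivative_def using has_derivative_at_withinI by metis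
      qed
      have "((\<lambda>t. Im (A t)) has_integral (Im (L (Complex s T)) - Im (L (Complex s 0)))) {0..T}"
        by (rule fundamental_theorem_of_calculus) (use T derA in auto)
      moreover have "Complex s T = Complex s 0 + of_nat n * (2 * of_real pi * \<i>)"
        by (simp add: complex_eq_iff T_def)
      then have "Im (L (Complex s T)) - Im (L (Complex s 0)) = n * (N * (2 * pi))"
        using shn[OF inQ[of 0], of n] by simp
      ultimately have "((\<lambda>t. Im (A t)) has_integral (n * (N * (2 * pi)))) {0..T}" by simp
      then have I1: "((\<lambda>t. 2 * real_of_int N * Im (A t)) has_integral (2 * real_of_int N * (n * (N * (2 * pi))))) {0..T}"
        by (rule has_integral_mult_right)
      have I2: "((\<lambda>t. (real_of_int N)\<^sup>2) has_integral ((real_of_int N)\<^sup>2 * T)) {0..T}"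
        using has_integral_const_real[of "(real_of_int N)\<^sup>2" 0 T] T by (simp add: mult_ac)
      have "((\<lambda>t. \<kappa> * (2 * real_of_int N * Im (A t) - (real_of_int N)\<^sup>2)) has_integral
          \<kappa> * (2 * real_of_int N * (n * (N * (2 * pi))) - (real_of_int N)\<^sup>2 * T)) {0..T}"
        by (rule has_integral_mult_right[OF has_integral_diff[OF I1 I2]])
      moreover have "\<kappa> * (2 * real_of_int N * (n * (N * (2 * pi))) - (real_of_int N)\<^sup>2 * T) = \<kappa> * (2 * pi * (real_of_int N)\<^sup>2) * n"
        by (simp add: T_def power2_eq_square algebra_simps)
      ultimately have I: "((\<lambda>t. \<kappa> * (2 * real_of_int N * Im (A t) - (real_of_int N)\<^sup>2)) has_integral (\<kappa> * (2 * pi * (real_of_int N)\<^sup>2) * n)) {0..T}"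
        by (simp only:)
      have cJ: "continuous_on {0..T} (J s)"
      proof -
        have "continuous_on {0..T} (\<lambda>t. (\<lambda>(s, t). J s t) (s, t))"
          by (rule continuous_on_compose2[OF contJ]) (use st in \<open>auto simp: cbox_Pair_eq intro!: continuous_intros\<close>)
        then show ?thesis by simp
      qed
      have "(J s has_integral integral {0..T} (J s)) {0..T}"
        using integrable_continuous_real[OF cJ] by (rule integrable_integral)
      moreover have "\<kappa> * (2 * real_of_int N * Im (A t) - (real_of_int N)\<^sup>2) \<le> J s t" for t
        unfolding \<kappa>_def A_def J_def using jacobian_lower_bound[OF k ba[OF inQ], of "real_of_int N" t] by simp
      ultimately show ?thesis using I has_integral_le by blast
    qed
    have "(s2 - s1) * (\<kappa> * (2 * pi * (real_of_int N)\<^sup>2) * n) = integral {s1..s2} (\<lambda>s. \<kappa> * (2 * pi * (real_of_int N)\<^sup>2) * n)"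
      using s by simp
    also have "\<dots> \<le> integral {s1..s2} (\<lambda>s. integral {0..T} (J s))"
    proof (rule integral_le)
      have "continuous_on (cbox s1 s2) (\<lambda>s. integral (cbox 0 T) (J s))"
        by (rule integral_continuous_on_param) (use contJ in \<open>simp add: cbox_Pair_eq\<close>)
      then show "(\<lambda>s. integral {0..T} (J s)) integrable_on {s1..s2}"
        by (simp add: integrable_continuous_real)
    qed (use inner in auto)
    also have "\<dots> \<le> (u2 - u1) * (of_nat n * (2 * pi * \<bar>real_of_int N\<bar>) + 2 * B)" using area v(2) by simp
    finally show ?thesis by (simp add: algebra_simps)
  qed
  have "(s2 - s1) * \<kappa> * (2 * pi * (real_of_int N)\<^sup>2) \<le> (u2 - u1) * (2 * pi * \<bar>real_of_int N\<bar>)"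
    by (rule of_nat_mult_le_imp_le[OF main])
  moreover have "(real_of_int N)\<^sup>2 = \<bar>real_of_int N\<bar> * \<bar>real_of_int N\<bar>" by (simp add: power2_eq_square flip: abs_mult)
  ultimately have "((s2 - s1) * \<kappa> * \<bar>real_of_int N\<bar>) * (2 * pi * \<bar>real_of_int N\<bar>) \<le> (u2 - u1) * (2 * pi * \<bar>real_of_int N\<bar>)"
    by (simp add: algebra_simps)
  then have le: "(s2 - s1) * \<kappa> * \<bar>real_of_int N\<bar> \<le> u2 - u1" using N by (simp add: mult_le_cancel_right)
  have "(s2 - s1) * \<kappa> * 1 \<le> (s2 - s1) * \<kappa> * \<bar>real_of_int N\<bar>"
    using s \<kappa> N by (intro mult_left_mono) auto
  then show ?thesis using le unfolding \<kappa>_def by simp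
qed

section \<open>Quasiconformal distortion of the modulus\<close>

definition log_strip :: "real \<Rightarrow> real \<Rightarrow> complex set" where
  "log_strip r R = {w. ln r < Re w \<and> Re w < ln R}"

lemma log_strip_props: "open (log_strip r R)" "convex (log_strip r R)" "connected (log_strip r R)"
proof -
  have e: "log_strip r R = {w. ln r < Re w} \<inter> {w. Re w < ln R}" by (auto simp: log_strip_def)
  show "open (log_strip r R)" unfolding e
    by (intro open_Int open_halfspace_Re_gt open_halfspace_Re_lt)
  show "convex (log_strip r R)" unfolding e
    by (intro convex_Int convex_halfspace_Re_gt convex_halfspace_Re_lt)
  then show "connected (log_strip r R)" by (rule convex_connected)
qed

lemma exp_in_annulus_iff: "0 < r \<Longrightarrow> 0 < R \<Longrightarrow> exp w \<in> annulus r R \<longleftrightarrow> w \<in> log_strip r R"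
proof -
  assume "0 < r" "0 < R"
  then have "r < exp (Re w) \<longleftrightarrow> ln r < Re w" "exp (Re w) < R \<longleftrightarrow> Re w < ln R"
    by (metis exp_less_cancel_iff exp_ln)+
  then show ?thesis by (simp add: annulus_def log_strip_def)
qed

lemma log_strip_shift: "w + 2 * of_real pi * \<i> \<in> log_strip r R \<longleftrightarrow> w \<in> log_strip r R"
  by (simp add: log_strip_def)

text \<open>Near \<open>w0\<close> a continuous logarithm is given by the principal branch.\<close>

lemma continuous_log_has_derivative:
  fixes L E :: "complex \<Rightarrow> complex"
  assumes S: "open S" "w0 \<in> S" and L: "continuous_on S L" and e: "\<And>w. w \<in> S \<Longrightarrow> exp (L w) = E w"
    and E: "(E has_derivative E') (at w0)"
  shows "(L has_derivative (\<lambda>v. E' v / E w0)) (at w0)"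
proof -
  have E0: "E w0 \<noteq> 0" using e[OF S(2)] by (metis exp_not_eq_zero)
  define U where "U = S \<inter> (\<lambda>w. L w - L w0) -` ball 0 pi"
  have "continuous_on S (\<lambda>w. L w - L w0)" using L by (intro continuous_intros)
  then have U: "open U" unfolding U_def by (rule continuous_open_preimage[OF _ S(1)]) simp
  have wU: "w0 \<in> U" using S(2) by (simp add: U_def)
  have eq: "L w0 + Ln (E w / E w0) = L w" if w: "w \<in> U" for w
  proof -
    have wS: "w \<in> S" and n: "cmod (L w - L w0) < pi" using w by (auto simp: U_def)
    have "\<bar>Im (L w - L w0)\<bar> < pi" using n abs_Im_le_cmod[of "L w - L w0"] by linarith
    then have "Ln (exp (L w - L w0)) = L w - L w0" by (intro Ln_exp) auto
    moreover have "exp (L w - L w0) = E w / E w0" using e[OF wS] e[OF S(2)] by (simp add: exp_diff)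
    ultimately show ?thesis by simp
  qed
  have d1: "((\<lambda>w. E w / E w0) has_derivative (\<lambda>v. E' v / E w0)) (at w0)"
    using E by (auto intro!: derivative_eq_intros simp: E0)
  have "(Ln has_field_derivative inverse (E w0 / E w0)) (at (E w0 / E w0))"
    by (rule has_field_derivative_Ln) (use E0 in auto)
  then have d2: "(Ln has_derivative (\<lambda>v. v)) (at (E w0 / E w0))"
  proof -
    have "(*) (inverse (E w0 / E w0)) = (\<lambda>v. v)" using E0 by (intro ext) simp
    then show ?thesis
      using \<open>(Ln has_field_derivative inverse (E w0 / E w0)) (at (E w0 / E w0))\<close>
      unfolding has_field_derivative_def by (simp only:)
  qed
  have "((\<lambda>w. Ln (E w / E w0)) has_derivative (\<lambda>v. E' v / E w0)) (at w0)"
    using diff_chain_at[OF d1 d2] by (simp add: o_def)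
  then have "((\<lambda>w. L w0 + Ln (E w / E w0)) has_derivative (\<lambda>v. E' v / E w0)) (at w0)"
    by (auto intro!: derivative_eq_intros)
  then show ?thesis by (rule has_derivative_transform_within_open[OF _ U wU eq])
qed

text \<open>The map lifts to a map \<open>L\<close> of logarithmic strips that commutes with the period up to a factor \<open>N\<close>.
  Since lifts have the same dilatation, the length-area inequality for strips applies.\<close>

theorem annulus_quasiconformal_modulus:
  fixes F G a b :: "complex \<Rightarrow> complex"
  assumes r: "0 < r" "r < R" "0 < r'" "r' < R'"
    and hom: "homeomorphism (annulus r R) (annulus r' R') F G"
    and s: "ln r < s1" "s1 \<le> s2" "s2 < ln R"
    and der: "\<And>w. s1 \<le> Re w \<Longrightarrow> Re w \<le> s2 \<Longrightarrow>
       ((\<lambda>w. F (exp w)) has_derivative (\<lambda>v. a w * v + b w * cnj v)) (at w)"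
    and cont: "continuous_on {w. s1 \<le> Re w \<and> Re w \<le> s2} a" "continuous_on {w. s1 \<le> Re w \<and> Re w \<le> s2} b"
    and k: "0 \<le> k" "k < 1" 
    and ba: "\<And>w. s1 \<le> Re w \<Longrightarrow> Re w \<le> s2 \<Longrightarrow> cmod (b w) \<le> k * cmod (a w)"
  shows "(s2 - s1) * ((1 - k) / (1 + k)) \<le> ln (R' / r')"
proof -
  have R: "0 < R" "0 < R'" using r by auto
  let ?S = "log_strip r R" and ?T = "log_strip r' R'"
  let ?Q = "{w. s1 \<le> Re w \<and> Re w \<le> s2}"
  have FA: "F z \<in> annulus r' R'" "G (F z) = z" if "z \<in> annulus r R" for z
    using hom that unfolding homeomorphism_def by auto
  have GA: "G z \<in> annulus r R" "F (G z) = z" if "z \<in> annulus r' R'" for z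
    using hom that unfolding homeomorphism_def by auto
  have expS: "exp w \<in> annulus r R" if "w \<in> ?S" for w using that exp_in_annulus_iff[OF r(1) R(1)] by simp
  have expT: "exp w \<in> annulus r' R'" if "w \<in> ?T" for w using that exp_in_annulus_iff[OF r(3) R(2)] by simp
  have nzA: "z \<noteq> 0" if "z \<in> annulus r R \<or> z \<in> annulus r' R'" for z using that r by (auto simp: annulus_def)
  have cF: "continuous_on ?S (\<lambda>w. F (exp w))"
    by (rule continuous_on_compose2[where f = exp and g = F and t = "annulus r R"])
       (use hom expS in \<open>auto simp: homeomorphism_def intro: continuous_on_exp\<close>)
  have cG: "continuous_on ?T (\<lambda>w. G (exp w))"
    by (rule continuous_on_compose2[where f = exp and g = G and t = "annulus r' R'"])
       (use hom expT in \<open>auto simp: homeomorphism_def intro: continuous_on_exp\<close>)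
  obtain L where L: "continuous_on ?S L" "\<And>w. w \<in> ?S \<Longrightarrow> F (exp w) = exp (L w)"
    using continuous_log_on_convex[OF log_strip_props(2) cF] nzA FA(1) expS by metis
  obtain M where M: "continuous_on ?T M" "\<And>w. w \<in> ?T \<Longrightarrow> G (exp w) = exp (M w)"
    using continuous_log_on_convex[OF log_strip_props(2) cG] nzA GA(1) expT by metis
  have LT: "L w \<in> ?T" if w: "w \<in> ?S" for w
    using FA(1)[OF expS[OF w]] L(2)[OF w] exp_in_annulus_iff[OF r(3) R(2)] by simp
  \<comment> \<open>\<open>M\<close> inverts \<open>L\<close> up to a period.  This makes \<open>L\<close> injective and its own period nonzero.\<close>
  have "\<exists>n::int. \<forall>w\<in>?S. M (L w) = w + of_int n * (2 * of_real pi * \<i>)"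
  proof (rule continuous_logs_differ_by_period[OF log_strip_props(3)])
    show "continuous_on ?S (\<lambda>w. M (L w))"
      by (rule continuous_on_compose2[OF M(1) L(1)]) (use LT in blast)
    show "continuous_on ?S (\<lambda>w. w)" by (rule continuous_on_id)
    fix w assume w: "w \<in> ?S"
    have "exp (M (L w)) = G (F (exp w))" using M(2)[OF LT[OF w]] L(2)[OF w] by simp
    then show "exp (M (L w)) = exp w" using FA(2)[OF expS[OF w]] by simp
  qed
  then obtain n :: int where n: "\<And>w. w \<in> ?S \<Longrightarrow> M (L w) = w + of_int n * (2 * of_real pi * \<i>)" by blast
  have injL: "inj_on L ?S"
  proof (rule inj_onI)
    fix x y assume x: "x \<in> ?S" and y: "y \<in> ?S" and "L x = L y"
    then have "M (L x) = M (L y)" by metis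
    then show "x = y" unfolding n[OF x] n[OF y] by (rule add_right_imp_eq)
  qed
  have "\<exists>N::int. \<forall>w\<in>?S. L (w + 2 * of_real pi * \<i>) = L w + of_int N * (2 * of_real pi * \<i>)"
  proof (rule continuous_logs_differ_by_period[OF log_strip_props(3)])
    show "continuous_on ?S (\<lambda>w. L (w + 2 * of_real pi * \<i>))"
    proof (rule continuous_on_compose2[OF L(1), where f = "\<lambda>w. w + 2 * of_real pi * \<i>"])
      show "continuous_on ?S (\<lambda>w. w + 2 * of_real pi * \<i>)" by (intro continuous_intros)
      show "(\<lambda>w. w + 2 * of_real pi * \<i>) ` ?S \<subseteq> ?S" by (simp only: image_subset_iff log_strip_shift) simp
    qed
    show "continuous_on ?S L" by fact
    fix w assume w: "w \<in> ?S"
    then have w': "w + 2 * of_real pi * \<i> \<in> ?S" by (simp only: log_strip_shift)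
    show "exp (L (w + 2 * of_real pi * \<i>)) = exp (L w)"
      unfolding L(2)[OF w, symmetric] L(2)[OF w', symmetric] exp_period ..
  qed
  then obtain N :: int where N: "\<And>w. w \<in> ?S \<Longrightarrow> L (w + 2 * of_real pi * \<i>) = L w + of_int N * (2 * of_real pi * \<i>)"
    by blast
  have QS: "?Q \<subseteq> ?S" using s by (auto simp: log_strip_def)
  have "N \<noteq> 0"
  proof
    assume "N = 0"
    have w: "of_real s1 \<in> ?S" using s by (auto simp: log_strip_def)
    then have w': "of_real s1 + 2 * of_real pi * \<i> \<in> ?S" by (simp only: log_strip_shift)
    have "L (of_real s1 + 2 * of_real pi * \<i>) = L (of_real s1)" using N[OF w] \<open>N = 0\<close> by simp
    then have "of_real s1 + 2 * of_real pi * \<i> = (of_real s1 :: complex)" by (rule inj_onD[OF injL _ w' w])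
    then show False by simp
  qed
  have "(s2 - s1) * ((1 - k) / (1 + k)) \<le> ln R' - ln r'"
  proof (rule strip_length_area[where L = L and a = "\<lambda>w. a w / F (exp w)" and b = "\<lambda>w. b w / F (exp w)" and N = N])
    fix w assume w: "w \<in> ?Q"
    then have wS: "w \<in> ?S" using QS by blast
    have "(L has_derivative (\<lambda>v. (a w * v + b w * cnj v) / F (exp w))) (at w)"
      by (rule continuous_log_has_derivative[OF log_strip_props(1) wS L(1)]) (use L(2) der w in auto)
    then show "(L has_derivative (\<lambda>v. a w / F (exp w) * v + b w / F (exp w) * cnj v)) (at w)"
      by (simp add: add_divide_distrib)
    show "L (w + 2 * of_real pi * \<i>) = L w + of_int N * (2 * of_real pi * \<i>)" by (rule N[OF wS])
    show "ln r' \<le> Re (L w) \<and> Re (L w) \<le> ln R'" using LT[OF wS] by (auto simp: log_strip_def)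
    show "cmod (b w / F (exp w)) \<le> k * cmod (a w / F (exp w))"
      using ba[of w] w by (auto simp: norm_divide divide_right_mono)
  next
    have c: "continuous_on ?Q (\<lambda>w. F (exp w))" using cF QS by (rule continuous_on_subset)
    have nz: "F (exp w) \<noteq> 0" if "w \<in> ?Q" for w using nzA FA(1) expS QS that by blast
    show "continuous_on ?Q (\<lambda>w. a w / F (exp w))" "continuous_on ?Q (\<lambda>w. b w / F (exp w))"
      using cont c nz by (auto intro!: continuous_on_divide)
    show "inj_on L ?Q" using injL QS by (rule inj_on_subset)
  qed (use s k \<open>N \<noteq> 0\<close> in auto)
  then show ?thesis using r R by (simp add: ln_div)
qed

section \<open>Derivatives of harmonic maps\<close>

text \<open>Young's form of the symmetry of second derivatives: the second difference is symmetric in \<open>d\<close> and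
  \<open>e\<close>, and the mean value theorem in the direction \<open>d\<close> expresses it by the derivative of \<open>D x d\<close> at the single point \<open>z\<close>.\<close>

lemma second_difference_quotient:
  fixes u :: "complex \<Rightarrow> real"
  assumes S: "open S" "z \<in> S" and D: "\<And>x. x \<in> S \<Longrightarrow> (u has_derivative D x) (at x)"
    and Dg: "((\<lambda>x. D x d) has_derivative g') (at z)" and de: "norm d \<le> 1" "norm e \<le> 1"
  shows "((\<lambda>t. (u (z + t *\<^sub>R d + t *\<^sub>R e) - u (z + t *\<^sub>R d) - u (z + t *\<^sub>R e) + u z) / t\<^sup>2) \<longlongrightarrow> g' e) (at_right 0)"
    (is "(?q \<longlongrightarrow> _) _")
proof (rule tendstoI)
  fix \<epsilon> :: real assume "\<epsilon> > 0"
  then have \<epsilon>: "\<epsilon> / 4 > 0" by simp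
  have lin: "linear g'" using Dg has_derivative_linear by blast
  obtain \<delta>1 where \<delta>1: "\<delta>1 > 0" "ball z \<delta>1 \<subseteq> S" using S openE by blast
  obtain \<delta>2 where \<delta>2: "\<delta>2 > 0"
    "\<And>x. norm (x - z) < \<delta>2 \<Longrightarrow> norm (D x d - D z d - g' (x - z)) \<le> \<epsilon> / 4 * norm (x - z)"
    using Dg \<epsilon> unfolding has_derivative_at_alt by metis
  define \<delta> where "\<delta> = min \<delta>1 \<delta>2 / 3"
  have \<delta>: "\<delta> > 0" "3 * \<delta> \<le> \<delta>1" "3 * \<delta> \<le> \<delta>2" using \<delta>1(1) \<delta>2(1) by (auto simp: \<delta>_def)
  have "dist (?q t) (g' e) < \<epsilon>" if t: "0 < t" "t < \<delta>" for t
  proof -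
    have nd: "norm (s *\<^sub>R d) \<le> t" "norm (s *\<^sub>R d + t *\<^sub>R e) \<le> 2 * t" if "0 \<le> s" "s \<le> t" for s
    proof -
      have 1: "s * norm d \<le> s * 1" "t * norm e \<le> t * 1" by (rule mult_left_mono; use that t de in simp)+
      have 2: "norm (s *\<^sub>R d) = s * norm d" "norm (t *\<^sub>R e) = t * norm e" using that t by simp_all
      show "norm (s *\<^sub>R d) \<le> t" using 1 2 that by linarith
      show "norm (s *\<^sub>R d + t *\<^sub>R e) \<le> 2 * t"
        using norm_triangle_ineq[of "s *\<^sub>R d" "t *\<^sub>R e"] 1 2 that by linarith
    qed
    have inS: "z + s *\<^sub>R d \<in> S" "z + s *\<^sub>R d + t *\<^sub>R e \<in> S" if "0 \<le> s" "s \<le> t" for s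
    proof -
      have "norm (z + s *\<^sub>R d - z) < \<delta>1" "norm (z + s *\<^sub>R d + t *\<^sub>R e - z) < \<delta>1"
        using nd[OF that] t \<delta> by (auto simp: add.assoc)
      then have "z + s *\<^sub>R d \<in> ball z \<delta>1" "z + s *\<^sub>R d + t *\<^sub>R e \<in> ball z \<delta>1"
        by (metis dist_commute dist_norm mem_ball)+
      then show "z + s *\<^sub>R d \<in> S" "z + s *\<^sub>R d + t *\<^sub>R e \<in> S" using \<delta>1(2) by blast+
    qed
    define \<phi> where "\<phi> s = u (z + s *\<^sub>R d + t *\<^sub>R e) - u (z + s *\<^sub>R d)" for s
    have d\<phi>: "(\<phi> has_real_derivative (D (z + s *\<^sub>R d + t *\<^sub>R e) d - D (z + s *\<^sub>R d) d)) (at s)" if "0 \<le> s" "s \<le> t" for s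
    proof -
      have 1: "((\<lambda>s. z + s *\<^sub>R d + t *\<^sub>R e) has_derivative (\<lambda>h. h *\<^sub>R d)) (at s)"
              "((\<lambda>s. z + s *\<^sub>R d) has_derivative (\<lambda>h. h *\<^sub>R d)) (at s)"
        by (auto intro!: derivative_eq_intros)
      have "(\<phi> has_derivative (\<lambda>h. D (z + s *\<^sub>R d + t *\<^sub>R e) (h *\<^sub>R d) - D (z + s *\<^sub>R d) (h *\<^sub>R d))) (at s)"
        unfolding \<phi>_def[abs_def]
        using diff_chain_at[OF 1(1) D[OF inS(2)[OF that]]] diff_chain_at[OF 1(2) D[OF inS(1)[OF that]]]
        by (auto intro!: has_derivative_diff simp: o_def)
      moreover have "D (z + s *\<^sub>R d + t *\<^sub>R e) (h *\<^sub>R d) - D (z + s *\<^sub>R d) (h *\<^sub>R d)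
         = (D (z + s *\<^sub>R d + t *\<^sub>R e) d - D (z + s *\<^sub>R d) d) * h" for h
        using linear_scale[OF has_derivative_linear[OF D[OF inS(1)[OF that]]]]
              linear_scale[OF has_derivative_linear[OF D[OF inS(2)[OF that]]]]
        by (simp add: algebra_simps)
      ultimately show ?thesis by (simp add: has_field_derivative_def)
    qed
    obtain s where s: "0 < s" "s < t" "\<phi> t - \<phi> 0 = (t - 0) * (D (z + s *\<^sub>R d + t *\<^sub>R e) d - D (z + s *\<^sub>R d) d)"
      using MVT2[OF t(1), of \<phi> "\<lambda>s. D (z + s *\<^sub>R d + t *\<^sub>R e) d - D (z + s *\<^sub>R d) d"] d\<phi> by auto
    have s': "0 \<le> s" "s \<le> t" using s by auto
    have n1: "norm (z + s *\<^sub>R d - z) < \<delta>2" "norm (z + s *\<^sub>R d + t *\<^sub>R e - z) < \<delta>2"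
      using nd[OF s'] t \<delta> by (auto simp: add.assoc)
    have e1: "norm (D (z + s *\<^sub>R d) d - D z d - g' (s *\<^sub>R d)) \<le> \<epsilon> / 4 * t"
      using \<delta>2(2)[OF n1(1)] unfolding add_diff_cancel_left'
      by (rule order_trans[OF _ mult_left_mono[OF nd(1)[OF s'] less_imp_le[OF \<epsilon>]]])
    have eq: "z + s *\<^sub>R d + t *\<^sub>R e - z = s *\<^sub>R d + t *\<^sub>R e" by simp
    have e2: "norm (D (z + s *\<^sub>R d + t *\<^sub>R e) d - D z d - g' (s *\<^sub>R d + t *\<^sub>R e)) \<le> \<epsilon> / 4 * (2 * t)"
      using \<delta>2(2)[OF n1(2)] unfolding eq
      by (rule order_trans[OF _ mult_left_mono[OF nd(2)[OF s'] less_imp_le[OF \<epsilon>]]])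
    have "g' (s *\<^sub>R d + t *\<^sub>R e) = g' (s *\<^sub>R d) + t * g' e"
      using linear_add[OF lin] linear_scale[OF lin] by simp
    then have "\<bar>D (z + s *\<^sub>R d + t *\<^sub>R e) d - D (z + s *\<^sub>R d) d - t * g' e\<bar> \<le> 3 * (\<epsilon> / 4) * t"
      using e1 e2 unfolding real_norm_def by linarith
    then have le: "\<bar>D (z + s *\<^sub>R d + t *\<^sub>R e) d - D (z + s *\<^sub>R d) d - t * g' e\<bar> \<le> 3 * (\<epsilon> / 4) * t" .
    have q: "?q t = (D (z + s *\<^sub>R d + t *\<^sub>R e) d - D (z + s *\<^sub>R d) d) / t"
    proof -
      have "u (z + t *\<^sub>R d + t *\<^sub>R e) - u (z + t *\<^sub>R d) - u (z + t *\<^sub>R e) + u z = \<phi> t - \<phi> 0" by (simp add: \<phi>_def)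
      then show ?thesis using s(3) t by (simp add: power2_eq_square)
    qed
    have "(?q t - g' e) * t = D (z + s *\<^sub>R d + t *\<^sub>R e) d - D (z + s *\<^sub>R d) d - t * g' e"
      unfolding q using t by (simp add: field_simps)
    then have "\<bar>?q t - g' e\<bar> * t = \<bar>D (z + s *\<^sub>R d + t *\<^sub>R e) d - D (z + s *\<^sub>R d) d - t * g' e\<bar>"
      using t by (metis abs_mult abs_of_pos)
    then have "\<bar>?q t - g' e\<bar> * t \<le> 3 * (\<epsilon> / 4) * t" using le by simp
    then have "\<bar>?q t - g' e\<bar> \<le> 3 * (\<epsilon> / 4)" using t by simp
    then show ?thesis using \<epsilon> by (simp add: dist_real_def)
  qed
  then show "eventually (\<lambda>t. dist (?q t) (g' e) < \<epsilon>) (at_right 0)"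
    using \<delta>(1) by (auto simp: eventually_at_right)
qed

lemma mixed_partials_equal:
  fixes u ux uy :: "complex \<Rightarrow> real"
  assumes S: "open S" "z \<in> S"
    and u: "\<And>x. x \<in> S \<Longrightarrow> (u has_derivative (\<lambda>w. ux x * Re w + uy x * Im w)) (at x)"
    and x: "(ux has_derivative (\<lambda>w. uxx * Re w + uxy * Im w)) (at z)"
    and y: "(uy has_derivative (\<lambda>w. uyx * Re w + uyy * Im w)) (at z)"
  shows "uxy = uyx"
proof -
  have 1: "((\<lambda>t. (u (z + t *\<^sub>R 1 + t *\<^sub>R \<i>) - u (z + t *\<^sub>R 1) - u (z + t *\<^sub>R \<i>) + u z) / t\<^sup>2) \<longlongrightarrow> uxx * Re \<i> + uxy * Im \<i>) (at_right 0)"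
    by (rule second_difference_quotient[OF S u]) (use x in auto)
  have 2: "((\<lambda>t. (u (z + t *\<^sub>R \<i> + t *\<^sub>R 1) - u (z + t *\<^sub>R \<i>) - u (z + t *\<^sub>R 1) + u z) / t\<^sup>2) \<longlongrightarrow> uyx * Re 1 + uyy * Im 1) (at_right 0)"
    by (rule second_difference_quotient[OF S u]) (use y in auto)
  have 3: "(\<lambda>t. (u (z + t *\<^sub>R \<i> + t *\<^sub>R 1) - u (z + t *\<^sub>R \<i>) - u (z + t *\<^sub>R 1) + u z) / t\<^sup>2)
     = (\<lambda>t. (u (z + t *\<^sub>R 1 + t *\<^sub>R \<i>) - u (z + t *\<^sub>R 1) - u (z + t *\<^sub>R \<i>) + u z) / t\<^sup>2)"
    by (rule ext) (simp add: add_ac diff_diff_eq)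
  have "uxx * Re \<i> + uxy * Im \<i> = uyx * Re 1 + uyy * Im 1"
    by (rule tendsto_unique[OF trivial_limit_at_right_real 1 2[unfolded 3]])
  then show ?thesis by simp
qed

text \<open>The Cauchy-Riemann equations of \<open>ux - \<i> uy\<close> are the Laplace equation and the symmetry of the
  mixed partial derivatives.\<close>

lemma harmonic_real_gradient_holomorphic:
  assumes "harmonic_real_on u S"
  obtains p where "p holomorphic_on S" "\<And>z. z \<in> S \<Longrightarrow> (u has_derivative (\<lambda>v. Re (p z * v))) (at z)"
proof -
  obtain ux uy uxx uxy uyx uyy where S: "open S"
    and d: "\<And>z. z \<in> S \<Longrightarrow> (u has_derivative (\<lambda>w. ux z * Re w + uy z * Im w)) (at z)"
     "\<And>z. z \<in> S \<Longrightarrow> (ux has_derivative (\<lambda>w. uxx z * Re w + uxy z * Im w)) (at z)"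
     "\<And>z. z \<in> S \<Longrightarrow> (uy has_derivative (\<lambda>w. uyx z * Re w + uyy z * Im w)) (at z)"
     "\<And>z. z \<in> S \<Longrightarrow> uxx z + uyy z = 0"
    using assms unfolding harmonic_real_on_def by blast
  define p where "p z = Complex (ux z) (- uy z)" for z
  have "(p has_field_derivative Complex (uxx z) (- uxy z)) (at z)" if z: "z \<in> S" for z
  proof -
    have eq: "uxy z = uyx z" by (rule mixed_partials_equal[OF S z d(1) d(2)[OF z] d(3)[OF z]])
    have "((\<lambda>z. of_real (ux z) - \<i> * of_real (uy z)) has_derivative
        (\<lambda>w. of_real (uxx z * Re w + uxy z * Im w) - \<i> * of_real (uyx z * Re w + uyy z * Im w))) (at z)"
      using d(2)[OF z] d(3)[OF z] by (intro derivative_intros)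
    moreover have "(\<lambda>z. of_real (ux z) - \<i> * of_real (uy z)) = p"
      by (rule ext) (simp add: p_def complex_eq_iff)
    moreover have "(\<lambda>w. of_real (uxx z * Re w + uxy z * Im w) - \<i> * of_real (uyx z * Re w + uyy z * Im w))
        = (*) (Complex (uxx z) (- uxy z))"
      using d(4)[OF z] by (intro ext) (simp add: complex_eq_iff eq[symmetric] eq_neg_iff_add_eq_0[symmetric])
    ultimately show ?thesis by (simp add: has_field_derivative_def)
  qed
  then have "p holomorphic_on S" using S by (auto simp: holomorphic_on_open)
  moreover have "(u has_derivative (\<lambda>v. Re (p z * v))) (at z)" if "z \<in> S" for z
    using d(1)[OF that] by (simp add: p_def)
  ultimately show thesis using that by blast
qed

text \<open>If \<open>p\<close> and \<open>q\<close> are the holomorphic gradients of the real and imaginary parts, then \<open>a\<close> and \<open>b\<close> are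
  \<open>(p + \<i> q) / 2\<close> and \<open>(p - \<i> q) / 2\<close>.\<close>

lemma harmonic_derivative_holomorphic:
  assumes "harmonic_on h S"
  obtains a b where "a holomorphic_on S" "b holomorphic_on S"
    "\<And>z. z \<in> S \<Longrightarrow> (h has_derivative (\<lambda>v. a z * v + cnj (b z * v))) (at z)"
proof -
  obtain p where p: "p holomorphic_on S" "\<And>z. z \<in> S \<Longrightarrow> ((\<lambda>z. Re (h z)) has_derivative (\<lambda>v. Re (p z * v))) (at z)"
    using harmonic_real_gradient_holomorphic assms unfolding harmonic_on_def by metis
  obtain q where q: "q holomorphic_on S" "\<And>z. z \<in> S \<Longrightarrow> ((\<lambda>z. Im (h z)) has_derivative (\<lambda>v. Re (q z * v))) (at z)"
    using harmonic_real_gradient_holomorphic assms unfolding harmonic_on_def by metis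
  show thesis
  proof (rule that[of "\<lambda>z. (p z + \<i> * q z) / 2" "\<lambda>z. (p z - \<i> * q z) / 2"])
    show "(\<lambda>z. (p z + \<i> * q z) / 2) holomorphic_on S" "(\<lambda>z. (p z - \<i> * q z) / 2) holomorphic_on S"
      using p q by (auto intro!: holomorphic_intros)
    fix z assume z: "z \<in> S"
    have "((\<lambda>z. of_real (Re (h z)) + \<i> * of_real (Im (h z))) has_derivative
        (\<lambda>v. of_real (Re (p z * v)) + \<i> * of_real (Re (q z * v)))) (at z)"
      by (intro has_derivative_add has_derivative_mult_right bounded_linear.has_derivative[OF bounded_linear_of_real])
         (use p(2)[OF z] q(2)[OF z] in auto)
    moreover have "(\<lambda>z. of_real (Re (h z)) + \<i> * of_real (Im (h z))) = h"
      by (rule ext) (simp add: complex_eq_iff)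
    moreover have "(\<lambda>v. of_real (Re (p z * v)) + \<i> * of_real (Re (q z * v))) =
      (\<lambda>v. (p z + \<i> * q z) / 2 * v + cnj ((p z - \<i> * q z) / 2 * v))"
      by (rule ext) (simp add: complex_eq_iff field_simps)
    ultimately show "(h has_derivative (\<lambda>v. (p z + \<i> * q z) / 2 * v + cnj ((p z - \<i> * q z) / 2 * v))) (at z)"
      by simp
  qed
qed

section \<open>The sense of an injective harmonic map\<close>

text \<open>The integer \<open>N\<close> is the winding number of the image of a small circle about \<open>z\<close> around \<open>h z\<close>.  On
  that circle \<open>h - h z\<close> is close to \<open>v \<mapsto> A v + cnj (B v)\<close>, whose first term dominates.\<close>

lemma index_one_if_sense_preserving:
  fixes h :: "complex \<Rightarrow> complex" and \<Lambda> :: "real \<Rightarrow> real \<Rightarrow> complex" and N :: int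
  assumes der: "(h has_derivative (\<lambda>v. A * v + cnj (B * v))) (at z)" and AB: "cmod B < cmod A"
    and \<rho>: "\<rho> > 0"
    and cont: "\<And>s. 0 < s \<Longrightarrow> s < \<rho> \<Longrightarrow> continuous_on UNIV (\<Lambda> s)"
    and log: "\<And>s \<theta>. 0 < s \<Longrightarrow> s < \<rho> \<Longrightarrow> exp (\<Lambda> s \<theta>) = h (z + of_real s * exp (\<i> * of_real \<theta>)) - h z"
    and per: "\<And>s \<theta>. 0 < s \<Longrightarrow> s < \<rho> \<Longrightarrow> \<Lambda> s (\<theta> + 2 * pi) = \<Lambda> s \<theta> + of_int N * (2 * of_real pi * \<i>)"
  shows "N = 1"
proof -
  define \<epsilon> where "\<epsilon> = (cmod A - cmod B) / 2"
  have \<epsilon>: "\<epsilon> > 0" "cmod B + \<epsilon> < cmod A" using AB by (auto simp: \<epsilon>_def field_simps)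
  obtain \<delta> where \<delta>: "\<delta> > 0" "\<And>y. norm (y - z) < \<delta> \<Longrightarrow>
      norm (h y - h z - (A * (y - z) + cnj (B * (y - z)))) \<le> \<epsilon> * norm (y - z)"
    using der \<epsilon>(1) unfolding has_derivative_at_alt by metis
  define s where "s = min \<delta> \<rho> / 2"
  have s: "0 < s" "s < \<delta>" "s < \<rho>" using \<delta>(1) \<rho> by (auto simp: s_def)
  define e where "e \<theta> = exp (\<i> * of_real \<theta>)" for \<theta> :: real
  have ne: "cmod (e \<theta>) = 1" "e \<theta> \<noteq> 0" for \<theta> by (simp_all add: e_def)
  have pe: "e (\<theta> + 2 * pi) = e \<theta>" for \<theta>
    using exp_shift[of "\<i> * of_real \<theta>" 1] by (simp add: e_def algebra_simps)
  define f where "f \<theta> = h (z + of_real s * e \<theta>) - h z" for \<theta>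
  define q where "q \<theta> = f \<theta> / (of_real s * A * e \<theta>)" for \<theta>
  have A0: "A \<noteq> 0" using AB by auto
  have d0: "of_real s * A * e \<theta> \<noteq> 0" for \<theta> using s A0 ne by simp
  have q1: "cmod (q \<theta> - 1) < 1" for \<theta>
  proof -
    have n: "norm (z + of_real s * e \<theta> - z) = s" using s ne by (simp add: norm_mult)
    have "norm (f \<theta> - (A * (of_real s * e \<theta>) + cnj (B * (of_real s * e \<theta>)))) \<le> \<epsilon> * s"
      using \<delta>(2)[of "z + of_real s * e \<theta>"] n s by (simp add: f_def)
    then have "norm ((f \<theta> - A * (of_real s * e \<theta>)) - cnj (B * (of_real s * e \<theta>))) \<le> \<epsilon> * s"
      by (simp add: diff_diff_eq)
    then have "norm (f \<theta> - A * (of_real s * e \<theta>)) \<le> norm (cnj (B * (of_real s * e \<theta>))) + \<epsilon> * s"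
      using norm_triangle_sub[of "f \<theta> - A * (of_real s * e \<theta>)" "cnj (B * (of_real s * e \<theta>))"] by linarith
    also have "norm (cnj (B * (of_real s * e \<theta>))) = cmod B * s" using s ne by (simp add: norm_mult)
    also have "cmod B * s + \<epsilon> * s < cmod A * s" using \<epsilon>(2) s by (simp flip: distrib_right)
    finally have lt: "norm (f \<theta> - A * (of_real s * e \<theta>)) < cmod A * s" .
    have "q \<theta> - 1 = (f \<theta> - A * (of_real s * e \<theta>)) / (of_real s * A * e \<theta>)"
      using d0[of \<theta>] by (simp add: q_def diff_divide_distrib mult_ac)
    then have "cmod (q \<theta> - 1) = norm (f \<theta> - A * (of_real s * e \<theta>)) / (cmod A * s)"
      using s ne by (simp add: norm_divide norm_mult)
    then show ?thesis using lt s A0 by (simp add: divide_less_eq)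
  qed
  have qpos: "q \<theta> \<notin> \<real>\<^sub>\<le>\<^sub>0" for \<theta>
  proof
    assume "q \<theta> \<in> \<real>\<^sub>\<le>\<^sub>0"
    then have "Re (q \<theta> - 1) \<le> -1" by (auto simp: complex_nonpos_Reals_iff)
    then show False using q1[of \<theta>] abs_Re_le_cmod[of "q \<theta> - 1"] by linarith
  qed
  have q0: "q \<theta> \<noteq> 0" for \<theta> using qpos[of \<theta>] by auto
  have f_log: "f \<theta> = exp (\<Lambda> s \<theta>)" for \<theta> using log[OF s(1,3)] by (simp add: f_def e_def)
  have ce: "continuous_on UNIV e" unfolding e_def by (intro continuous_intros)
  have cf: "continuous_on UNIV f" unfolding f_log using cont[OF s(1,3)] by (intro continuous_intros)
  have cq: "continuous_on UNIV q" unfolding q_def using d0 ce cf by (intro continuous_intros) auto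
  have "\<exists>n::int. \<forall>\<theta>\<in>UNIV. \<Lambda> s \<theta> = (\<i> * of_real \<theta> + Ln (of_real s * A) + Ln (q \<theta>)) + of_int n * (2 * of_real pi * \<i>)"
  proof (rule continuous_logs_differ_by_period)
    show "continuous_on UNIV (\<Lambda> s)" by (rule cont[OF s(1,3)])
    show "continuous_on UNIV (\<lambda>\<theta>. \<i> * of_real \<theta> + Ln (of_real s * A) + Ln (q \<theta>))"
      using cq qpos by (intro continuous_intros) auto
    fix \<theta> :: real
    have "exp (\<i> * of_real \<theta> + Ln (of_real s * A) + Ln (q \<theta>)) = e \<theta> * (of_real s * A) * q \<theta>"
      using q0 A0 s by (simp add: exp_add e_def)
    also have "\<dots> = f \<theta>" using d0[of \<theta>] by (simp add: q_def)
    finally show "exp (\<Lambda> s \<theta>) = exp (\<i> * of_real \<theta> + Ln (of_real s * A) + Ln (q \<theta>))"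
      using f_log by simp
  qed simp
  then obtain n :: int where n: "\<And>\<theta>. \<Lambda> s \<theta> = (\<i> * of_real \<theta> + Ln (of_real s * A) + Ln (q \<theta>)) + of_int n * (2 * of_real pi * \<i>)"
    by blast
  have fp: "f (2 * pi) = f 0" "q (2 * pi) = q 0" using pe[of 0] by (simp_all add: f_def q_def)
  have "\<Lambda> s (2 * pi) - \<Lambda> s 0 = \<i> * of_real (2 * pi)"
    unfolding n[of "2 * pi"] n[of 0] fp by simp
  moreover have "\<Lambda> s (2 * pi) - \<Lambda> s 0 = of_int N * (2 * of_real pi * \<i>)"
    using per[OF s(1,3), of 0] by simp
  ultimately have "of_int N * (2 * of_real pi * \<i>) = of_int 1 * (2 * of_real pi * \<i>)" by simp
  then have "(of_int N :: complex) = of_int 1" by (simp only: mult_cancel_right) simp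
  then show ?thesis by (simp only: of_int_eq_iff)
qed

text \<open>By injectivity the winding number of the image of the circle of radius \<open>s\<close> about \<open>z\<close> around \<open>h z\<close> is
  defined for all small \<open>s\<close>.  It cannot depend on \<open>z\<close> and \<open>s\<close>: on the convex set
  \<open>D\<close> of all triples \<open>(z, s, \<theta>)\<close> there is a single continuous logarithm of the difference.\<close>

lemma sense_locally_constant:
  fixes h :: "complex \<Rightarrow> complex"
  assumes inj: "inj_on h (ball z0 (2 * \<rho>))" and \<rho>: "\<rho> > 0"
    and der: "\<And>z. z \<in> ball z0 (2 * \<rho>) \<Longrightarrow> (h has_derivative (\<lambda>v. a z * v + cnj (b z * v))) (at z)"
    and z1: "z1 \<in> ball z0 \<rho>" "cmod (b z1) < cmod (a z1)"
    and z2: "z2 \<in> ball z0 \<rho>" "cmod (a z2) < cmod (b z2)"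
  shows False
proof -
  let ?B = "ball z0 (2 * \<rho>)"
  have ch: "continuous_on ?B h"
    by (rule continuous_at_imp_continuous_on) (use der has_derivative_continuous in blast)
  define D where "D = ball z0 \<rho> \<times> {0<..<\<rho>} \<times> (UNIV :: real set)"
  have D: "convex D" unfolding D_def by (intro convex_Times convex_ball) auto
  define pt where "pt p = fst p + of_real (fst (snd p)) * exp (\<i> * of_real (snd (snd p)))" for p :: "complex \<times> real \<times> real"
  have ptB: "pt p \<in> ?B" "fst p \<in> ?B" "pt p \<noteq> fst p" if "p \<in> D" for p
  proof -
    obtain z s \<theta> where p: "p = (z, s, \<theta>)" by (cases p) auto
    have zs: "dist z0 z < \<rho>" "0 < s" "s < \<rho>" using that by (auto simp: D_def p)
    have n: "cmod (of_real s * exp (\<i> * of_real \<theta>)) = s" using zs by (simp add: norm_mult)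
    have "dist z0 (pt p) \<le> dist z0 z + dist z (pt p)" by (rule dist_triangle)
    also have "dist z (pt p) = s" using n by (simp add: p pt_def dist_norm)
    finally show "pt p \<in> ?B" using zs by simp
    show "fst p \<in> ?B" using zs by (simp add: p)
    show "pt p \<noteq> fst p" using zs by (simp add: p pt_def)
  qed
  have c1: "continuous_on D pt" unfolding pt_def by (intro continuous_intros)
  have c2: "continuous_on D fst" by (intro continuous_intros)
  have "continuous_on D (\<lambda>p. h (pt p) - h (fst p))"
    by (intro continuous_on_diff continuous_on_compose2[OF ch c1] continuous_on_compose2[OF ch c2])
       (use ptB in blast)+
  moreover have "h (pt p) - h (fst p) \<noteq> 0" if "p \<in> D" for p
    using ptB[OF that] inj_onD[OF inj, of "pt p" "fst p"] by auto
  ultimately obtain \<Lambda> where \<Lambda>: "continuous_on D \<Lambda>" "\<And>p. p \<in> D \<Longrightarrow> h (pt p) - h (fst p) = exp (\<Lambda> p)"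
    using continuous_log_on_convex[OF D] by blast
  define sh where "sh p = (fst p, fst (snd p), snd (snd p) + 2 * pi)" for p :: "complex \<times> real \<times> real"
  have shD: "sh p \<in> D" if "p \<in> D" for p using that by (auto simp: D_def sh_def)
  have ptsh: "pt (sh p) = pt p" "fst (sh p) = fst p" for p
    using exp_shift[of "\<i> * of_real (snd (snd p))" 1] by (simp_all add: pt_def sh_def algebra_simps)
  have "\<exists>N::int. \<forall>p\<in>D. \<Lambda> (sh p) = \<Lambda> p + of_int N * (2 * of_real pi * \<i>)"
  proof (rule continuous_logs_differ_by_period)
    show "connected D" using D by (rule convex_connected)
    show "continuous_on D \<Lambda>" by (rule \<Lambda>)
    show "continuous_on D (\<lambda>p. \<Lambda> (sh p))"
    proof (rule continuous_on_compose2[OF \<Lambda>(1)])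
      show "continuous_on D sh" unfolding sh_def by (intro continuous_intros)
      show "sh ` D \<subseteq> D" using shD by blast
    qed
    fix p assume p: "p \<in> D"
    show "exp (\<Lambda> (sh p)) = exp (\<Lambda> p)"
      using \<Lambda>(2)[OF p] \<Lambda>(2)[OF shD[OF p]] unfolding ptsh by metis
  qed
  then obtain N :: int where N: "\<And>p. p \<in> D \<Longrightarrow> \<Lambda> (sh p) = \<Lambda> p + of_int N * (2 * of_real pi * \<i>)" by blast
  have inD: "(z, s, \<theta>) \<in> D" if "z \<in> ball z0 \<rho>" "0 < s" "s < \<rho>" for z s \<theta> using that by (simp add: D_def)
  have slice: "continuous_on UNIV (\<lambda>\<theta>. \<Lambda> (z, s, \<theta>))" if "z \<in> ball z0 \<rho>" "0 < s" "s < \<rho>" for z s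
    by (rule continuous_on_compose2[OF \<Lambda>(1)]) (use inD[OF that] in \<open>auto intro!: continuous_intros\<close>)
  have lg: "exp (\<Lambda> (z, s, \<theta>)) = h (z + of_real s * exp (\<i> * of_real \<theta>)) - h z"
    if "z \<in> ball z0 \<rho>" "0 < s" "s < \<rho>" for z s \<theta>
    using \<Lambda>(2)[OF inD[OF that, of \<theta>]] by (simp add: pt_def)
  have pr: "\<Lambda> (z, s, \<theta> + 2 * pi) = \<Lambda> (z, s, \<theta>) + of_int N * (2 * of_real pi * \<i>)"
    if "z \<in> ball z0 \<rho>" "0 < s" "s < \<rho>" for z s \<theta>
    using N[OF inD[OF that, of \<theta>]] by (simp add: sh_def)
  have zB: "z \<in> ?B" if "z \<in> ball z0 \<rho>" for z using that \<rho> by auto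
  have "N = 1"
    by (rule index_one_if_sense_preserving[OF der[OF zB[OF z1(1)]] z1(2) \<rho>, of "\<lambda>s \<theta>. \<Lambda> (z1, s, \<theta>)"])
       (use slice[OF z1(1)] lg[OF z1(1)] pr[OF z1(1)] in blast)+
  \<comment> \<open>At \<open>z2\<close> the conjugate of \<open>h\<close> preserves the orientation, and conjugation changes the sign of the
    period.\<close>
  moreover have "- N = 1"
  proof (rule index_one_if_sense_preserving[where h = "\<lambda>z. cnj (h z)" and \<Lambda> = "\<lambda>s \<theta>. cnj (\<Lambda> (z2, s, \<theta>))", OF _ z2(2) \<rho>])
    have "((\<lambda>z. cnj (h z)) has_derivative (\<lambda>v. cnj (a z2 * v + cnj (b z2 * v)))) (at z2)"
      by (rule bounded_linear.has_derivative[OF bounded_linear_cnj der[OF zB[OF z2(1)]]])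
    then show "((\<lambda>z. cnj (h z)) has_derivative (\<lambda>v. b z2 * v + cnj (a z2 * v))) (at z2)"
      by (simp add: add.commute)
    fix s \<theta> :: real assume s: "0 < s" "s < \<rho>"
    show "continuous_on UNIV (\<lambda>\<theta>. cnj (\<Lambda> (z2, s, \<theta>)))" using slice[OF z2(1) s] by (intro continuous_intros)
    show "exp (cnj (\<Lambda> (z2, s, \<theta>))) = cnj (h (z2 + of_real s * exp (\<i> * of_real \<theta>))) - cnj (h z2)"
      using lg[OF z2(1) s, of \<theta>] by (simp flip: exp_cnj)
    show "cnj (\<Lambda> (z2, s, \<theta> + 2 * pi)) = cnj (\<Lambda> (z2, s, \<theta>)) + of_int (- N) * (2 * of_real pi * \<i>)"
      using pr[OF z2(1) s, of \<theta>] by simp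
  qed
  ultimately show False by simp
qed

section \<open>The second complex dilatation\<close>

text \<open>Where the Jacobian vanishes identically, the quotient \<open>b / a\<close> is holomorphic of modulus one and so
  constant.  The image then lies on a line, against invariance of domain.\<close>

lemma degenerate_derivative_not_injective:
  fixes h a b :: "complex \<Rightarrow> complex"
  assumes r: "r > 0" and inj: "inj_on h (ball z0 r)"
    and ab: "a holomorphic_on ball z0 r" "b holomorphic_on ball z0 r"
    and der: "\<And>z. z \<in> ball z0 r \<Longrightarrow> (h has_derivative (\<lambda>v. a z * v + cnj (b z * v))) (at z)"
    and eq: "\<And>z. z \<in> ball z0 r \<Longrightarrow> cmod (b z) = cmod (a z)"
  shows False
proof -
  have a_nz: "\<exists>z1\<in>ball z0 r. a z1 \<noteq> 0"
  proof (rule ccontr)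
    assume "\<not> ?thesis"
    then have z: "a z = 0 \<and> b z = 0" if "z \<in> ball z0 r" for z using eq[OF that] that by auto
    have "\<exists>c. \<forall>x\<in>ball z0 r. h x = c"
    proof (rule has_derivative_zero_constant)
      fix x assume x: "x \<in> ball z0 r"
      show "(h has_derivative (\<lambda>_. 0)) (at x within ball z0 r)"
        using has_derivative_at_withinI[OF der[OF x]] z[OF x] by simp
    qed simp
    then have "h z0 = h (z0 + of_real (r / 2))" using r by (auto simp: dist_norm)
    then have "z0 = z0 + of_real (r / 2)" by (rule inj_onD[OF inj]) (use r in \<open>auto simp: dist_norm\<close>)
    then show False using r by simp
  qed
  then obtain z1 where z1: "z1 \<in> ball z0 r" "a z1 \<noteq> 0" by blast
  have "continuous_on (ball z0 r) a" using ab(1) by (rule holomorphic_on_imp_continuous_on)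
  then have "open (ball z0 r \<inter> a -` (- {0}))" by (rule continuous_open_preimage) auto
  then obtain r1 where r1: "r1 > 0" "ball z1 r1 \<subseteq> ball z0 r \<inter> a -` (- {0})"
    using z1 openE[of "ball z0 r \<inter> a -` (- {0})" z1] by auto
  let ?B = "ball z1 r1"
  have BB: "?B \<subseteq> ball z0 r" and anz: "a z \<noteq> 0" if "z \<in> ?B" for z using r1(2) that by auto
  have sub: "?B \<subseteq> ball z0 r" using r1(2) by auto
  have q: "(\<lambda>z. b z / a z) holomorphic_on ?B"
    using holomorphic_on_subset[OF ab(1) sub] holomorphic_on_subset[OF ab(2) sub] anz by (intro holomorphic_intros)
  have q1: "cmod (b z / a z) = 1" if "z \<in> ?B" for z using eq[of z] sub that anz[OF that] by (auto simp: norm_divide)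
  have "(\<lambda>z. b z / a z) constant_on ?B"
    by (rule maximum_modulus_principle[OF q, where U = ?B and \<xi> = z1]) (use q1 r1(1) in auto)
  then obtain c where c: "\<And>z. z \<in> ?B \<Longrightarrow> b z / a z = c" by (auto simp: constant_on_def)
  have bc: "b z = c * a z" if "z \<in> ?B" for z using c[OF that] anz[OF that] by (simp add: divide_eq_eq)
  have c1: "cmod c = 1" using q1[of z1] c[of z1] r1(1) by simp
  \<comment> \<open>Since \<open>b = c * a\<close> with \<open>c = \<gamma>\<^sup>2\<close> unimodular, the derivative of \<open>\<gamma> * h\<close> is real, so the image
    lies on a line.\<close>
  define \<gamma> where "\<gamma> = csqrt c"
  have g2: "\<gamma>\<^sup>2 = c" by (simp add: \<gamma>_def)
  have g1: "\<gamma> * cnj \<gamma> = 1"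
  proof -
    have "(cmod \<gamma>)\<^sup>2 = 1" using g2 c1 by (metis norm_power)
    then show ?thesis by (simp add: complex_norm_square[symmetric] del: of_real_power)
  qed
  have gc: "\<gamma> * cnj c = cnj \<gamma>"
  proof -
    have "\<gamma> * cnj c = (\<gamma> * cnj \<gamma>) * cnj \<gamma>" unfolding g2[symmetric] by (simp add: power2_eq_square mult_ac)
    then show ?thesis using g1 by simp
  qed
  have "\<exists>k. \<forall>x\<in>?B. Im (\<gamma> * h x) = k"
  proof (rule has_derivative_zero_constant)
    fix x assume x: "x \<in> ?B"
    have "((\<lambda>z. Im (\<gamma> * h z)) has_derivative (\<lambda>v. Im (\<gamma> * (a x * v + cnj (b x * v))))) (at x)"
      by (intro bounded_linear.has_derivative[OF bounded_linear_Im] has_derivative_mult_right der) (use sub x in blast)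
    moreover have "Im (\<gamma> * (a x * v + cnj (b x * v))) = 0" for v
    proof -
      have "\<gamma> * (a x * v + cnj (b x * v)) = \<gamma> * a x * v + (\<gamma> * cnj c) * cnj (a x * v)"
        unfolding bc[OF x] by (simp add: algebra_simps)
      also have "\<dots> = \<gamma> * a x * v + cnj (\<gamma> * a x * v)" unfolding gc by simp
      finally have e: "\<gamma> * (a x * v + cnj (b x * v)) = \<gamma> * a x * v + cnj (\<gamma> * a x * v)" .
      have "Im (w + cnj w) = 0" for w by simp
      then show ?thesis unfolding e .
    qed
    ultimately show "((\<lambda>z. Im (\<gamma> * h z)) has_derivative (\<lambda>_. 0)) (at x within ?B)"
      using has_derivative_at_withinI by (metis (no_types, lifting) ext)
  qed simp
  then obtain k where k: "\<And>x. x \<in> ?B \<Longrightarrow> Im (\<gamma> * h x) = k" by blast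
  have "continuous_on ?B h"
    by (rule continuous_at_imp_continuous_on) (use der sub has_derivative_continuous in blast)
  then have "open (h ` ?B)" by (rule invariance_of_domain) (use inj sub inj_on_subset in auto)
  moreover have "h z1 \<in> h ` ?B" using r1(1) by simp
  ultimately obtain e where e: "e > 0" "ball (h z1) e \<subseteq> h ` ?B" by (meson openE)
  have "(cmod \<gamma>)\<^sup>2 = 1" using g2 c1 by (metis norm_power)
  then have ng: "cmod \<gamma> = 1" using norm_ge_zero[of \<gamma>] by (auto simp: power2_eq_1_iff)
  have "h z1 + \<i> * of_real (e / 2) * cnj \<gamma> \<in> ball (h z1) e" using e(1) ng by (simp add: dist_norm norm_mult)
  with e(2) have "h z1 + \<i> * of_real (e / 2) * cnj \<gamma> \<in> h ` ?B" by (rule subsetD)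
  then obtain x where x: "h z1 + \<i> * of_real (e / 2) * cnj \<gamma> = h x" "x \<in> ?B" by (rule imageE)
  have "\<gamma> * h x = \<gamma> * h z1 + \<i> * of_real (e / 2) * (\<gamma> * cnj \<gamma>)" unfolding x(1)[symmetric] by (simp add: algebra_simps)
  then have "\<gamma> * h x = \<gamma> * h z1 + \<i> * of_real (e / 2)" unfolding g1 by simp
  then have "Im (\<gamma> * h x) = Im (\<gamma> * h z1) + e / 2" by simp
  then show False using k[OF x(2)] k[of z1] r1(1) e(1) by simp
qed

text \<open>Each point has a neighbourhood on which the Jacobian does not change sign.  The two open sets obtained for the
  two signs are disjoint, because on an overlap the Jacobian would vanish.\<close>

lemma injective_harmonic_sense:
  fixes h a b :: "complex \<Rightarrow> complex"
  assumes S: "open S" "connected S" and inj: "inj_on h S"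
    and ab: "a holomorphic_on S" "b holomorphic_on S"
    and der: "\<And>z. z \<in> S \<Longrightarrow> (h has_derivative (\<lambda>v. a z * v + cnj (b z * v))) (at z)"
  shows "(\<forall>z\<in>S. cmod (b z) \<le> cmod (a z)) \<or> (\<forall>z\<in>S. cmod (a z) \<le> cmod (b z))"
proof -
  define U where "U f g = {z \<in> S. \<exists>\<rho>>0. ball z \<rho> \<subseteq> S \<and> (\<forall>x\<in>ball z \<rho>. cmod (f x) \<le> cmod (g x))}"
    for f g :: "complex \<Rightarrow> complex"
  have oU: "open (U f g)" for f g
  proof (rule openI)
    fix z assume "z \<in> U f g"
    then obtain \<rho> where \<rho>: "\<rho> > 0" "ball z \<rho> \<subseteq> S" "\<forall>x\<in>ball z \<rho>. cmod (f x) \<le> cmod (g x)" by (auto simp: U_def)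
    have "ball z \<rho> \<subseteq> U f g"
    proof
      fix x assume x: "x \<in> ball z \<rho>"
      obtain \<rho>' where "\<rho>' > 0" "ball x \<rho>' \<subseteq> ball z \<rho>" using x openE[OF open_ball] by blast
      then show "x \<in> U f g" using x \<rho> unfolding U_def by blast
    qed
    then show "\<exists>e>0. ball z e \<subseteq> U f g" using \<rho>(1) by blast
  qed
  have cover: "S \<subseteq> U b a \<union> U a b"
  proof
    fix z assume z: "z \<in> S"
    obtain r where r: "r > 0" "ball z r \<subseteq> S" by (rule openE[OF S(1) z])
    have sub: "ball z (2 * (r / 2)) \<subseteq> S" using r by simp
    have "(\<forall>x\<in>ball z (r / 2). cmod (b x) \<le> cmod (a x)) \<or> (\<forall>x\<in>ball z (r / 2). cmod (a x) \<le> cmod (b x))"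
    proof (rule ccontr)
      assume "\<not> ?thesis"
      then obtain x y where x: "x \<in> ball z (r / 2)" "cmod (a x) < cmod (b x)"
        and y: "y \<in> ball z (r / 2)" "cmod (b y) < cmod (a y)" by (auto simp: not_le)
      show False
        by (rule sense_locally_constant[OF inj_on_subset[OF inj sub] _ der y x]) (use r sub in auto)
    qed
    moreover have "ball z (r / 2) \<subseteq> S" using r by (auto simp: subset_iff)
    ultimately show "z \<in> U b a \<union> U a b" using z r(1) unfolding U_def by (auto intro!: exI[of _ "r / 2"])
  qed
  have disj: "U b a \<inter> U a b \<inter> S = {}"
  proof (rule ccontr)
    assume "\<not> ?thesis"
    then obtain z where z: "z \<in> U b a" "z \<in> U a b" by blast
    obtain \<rho>1 where 1: "\<rho>1 > 0" "ball z \<rho>1 \<subseteq> S" "\<forall>x\<in>ball z \<rho>1. cmod (b x) \<le> cmod (a x)" using z(1) by (auto simp: U_def)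
    obtain \<rho>2 where 2: "\<rho>2 > 0" "\<forall>x\<in>ball z \<rho>2. cmod (a x) \<le> cmod (b x)" using z(2) by (auto simp: U_def)
    define \<rho> where "\<rho> = min \<rho>1 \<rho>2"
    have \<rho>: "\<rho> > 0" "ball z \<rho> \<subseteq> S" using 1 2 by (auto simp: \<rho>_def)
    show False
    proof (rule degenerate_derivative_not_injective[OF \<rho>(1) inj_on_subset[OF inj \<rho>(2)]
        holomorphic_on_subset[OF ab(1) \<rho>(2)] holomorphic_on_subset[OF ab(2) \<rho>(2)]])
      fix x assume x: "x \<in> ball z \<rho>"
      then show "(h has_derivative (\<lambda>v. a x * v + cnj (b x * v))) (at x)" using der \<rho>(2) by blast
      have "x \<in> ball z \<rho>1" "x \<in> ball z \<rho>2" using x by (auto simp: \<rho>_def)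
      then show "cmod (b x) = cmod (a x)" using 1(3) 2(2) by (simp add: antisym)
    qed
  qed
  have "U b a \<inter> S = {} \<or> U a b \<inter> S = {}"
    using connectedD[OF S(2) oU oU disj cover] .
  then have "S \<subseteq> U b a \<or> S \<subseteq> U a b" using cover by blast
  then show ?thesis
  proof
    assume s: "S \<subseteq> U b a"
    have "cmod (b z) \<le> cmod (a z)" if zS: "z \<in> S" for z
    proof -
      obtain \<rho> where "\<rho> > 0" "\<forall>x\<in>ball z \<rho>. cmod (b x) \<le> cmod (a x)" using s zS unfolding U_def by blast
      then show ?thesis by simp
    qed
    then show ?thesis by blast
  next
    assume s: "S \<subseteq> U a b"
    have "cmod (a z) \<le> cmod (b z)" if zS: "z \<in> S" for z
    proof -
      obtain \<rho> where "\<rho> > 0" "\<forall>x\<in>ball z \<rho>. cmod (a x) \<le> cmod (b x)" using s zS unfolding U_def by blast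
      then show ?thesis by simp
    qed
    then show ?thesis by blast
  qed
qed

text \<open>The quotient is bounded near each of its isolated singularities, which are thus removable.\<close>

lemma holomorphic_quotient_of_dominated:
  fixes a b :: "complex \<Rightarrow> complex"
  assumes S: "open S" "connected S" and ab: "a holomorphic_on S" "b holomorphic_on S"
    and le: "\<And>z. z \<in> S \<Longrightarrow> cmod (b z) \<le> cmod (a z)" and nz: "\<exists>z\<in>S. a z \<noteq> 0"
  obtains \<nu> where "\<nu> holomorphic_on S" "\<And>z. z \<in> S \<Longrightarrow> b z = \<nu> z * a z" "\<And>z. z \<in> S \<Longrightarrow> cmod (\<nu> z) \<le> 1"
proof
  define f where "f z = b z / a z" for z
  define \<nu> where "\<nu> = remove_sings f"
  have near: "\<exists>r>0. ball z r \<subseteq> S \<and> (\<forall>x\<in>ball z r - {z}. a x \<noteq> 0)" if z: "z \<in> S" for z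
  proof -
    obtain r0 where r0: "r0 > 0" "ball z r0 \<subseteq> S" by (rule openE[OF S(1) z])
    show ?thesis
    proof (cases "a z = 0")
      case True
      obtain w where w: "w \<in> S" "a w \<noteq> 0" using nz by blast
      obtain r where r: "r > 0" "ball z r \<subseteq> S" "\<And>x. x \<in> ball z r - {z} \<Longrightarrow> a x \<noteq> 0"
        using isolated_zeros[OF ab(1) S z True w] by blast
      then show ?thesis by blast
    next
      case False
      have "open (S \<inter> a -` (- {0}))"
        by (rule continuous_open_preimage[OF holomorphic_on_imp_continuous_on[OF ab(1)] S(1)]) auto
      then obtain r where "r > 0" "ball z r \<subseteq> S \<inter> a -` (- {0})" using openE[of "S \<inter> a -` (- {0})" z] z False by auto
      then show ?thesis by blast
    qed
  qed
  have f1: "cmod (f x) \<le> 1" if "x \<in> S" for x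
    using le[OF that] by (cases "a x = 0") (auto simp: f_def norm_divide divide_le_eq_1)
  have an: "\<nu> analytic_on {z} \<and> cmod (\<nu> z) \<le> 1" if z: "z \<in> S" for z
  proof -
    obtain r where r: "r > 0" "ball z r \<subseteq> S" "\<And>x. x \<in> ball z r - {z} \<Longrightarrow> a x \<noteq> 0" using near[OF z] by blast
    have fh: "f holomorphic_on ball z r - {z}"
      unfolding f_def using ab r(2,3) by (intro holomorphic_intros) (auto elim: holomorphic_on_subset)
    have iso: "isolated_singularity_at f z"
      unfolding isolated_singularity_at_def using r(1) fh by (auto simp: analytic_on_open open_delete intro!: exI[of _ r])
    have ev: "eventually (\<lambda>x. x \<in> ball z r - {z}) (at z)" by (rule eventually_at_in_open) (use r(1) in auto)
    have "\<exists>g. g holomorphic_on ball z r \<and> (\<forall>x\<in>ball z r - {z}. g x = f x)"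
    proof (rule holomorphic_on_extend_bounded[THEN iffD2, OF fh])
      have "eventually (\<lambda>x. cmod (f x) \<le> 1) (at z)" using ev by (rule eventually_mono) (use f1 r(2) in blast)
      then show "\<exists>B. eventually (\<lambda>x. cmod (f x) \<le> B) (at z)" by blast
    qed (use r(1) in simp)
    then obtain g where g: "g holomorphic_on ball z r" "\<And>x. x \<in> ball z r - {z} \<Longrightarrow> g x = f x" by blast
    have "isCont g z" using holomorphic_on_imp_continuous_on[OF g(1)] r(1) by (simp add: continuous_on_eq_continuous_at)
    then have "(g \<longlongrightarrow> g z) (at z)" by (simp add: isCont_def)
    then have lim: "(f \<longlongrightarrow> g z) (at z)"
      by (rule Lim_transform_eventually) (use ev g(2) in \<open>auto elim: eventually_mono\<close>)
    have 1: "\<nu> analytic_on {z}" unfolding \<nu>_def by (rule remove_sings_analytic_at[OF iso lim])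
    have "\<nu> z = g z" unfolding \<nu>_def by (rule remove_sings_eqI[OF lim])
    moreover have "cmod (g z) \<le> 1"
    proof (rule tendsto_upperbound[OF tendsto_norm[OF lim]])
      show "eventually (\<lambda>x. cmod (f x) \<le> 1) (at z)" using ev by (rule eventually_mono) (use f1 r(2) in blast)
    qed simp
    ultimately show ?thesis using 1 by simp
  qed
  show "\<nu> holomorphic_on S"
    using an analytic_on_analytic_at analytic_imp_holomorphic by blast
  show "cmod (\<nu> z) \<le> 1" if "z \<in> S" for z using an[OF that] ..
  show "b z = \<nu> z * a z" if z: "z \<in> S" for z
  proof (cases "a z = 0")
    case True
    then show ?thesis using le[OF z] by simp
  next
    case False
    have "a analytic_on {z}" "b analytic_on {z}"
      using ab S(1) z by (auto simp: analytic_on_open[symmetric] intro: analytic_on_subset)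
    then have "f analytic_on {z}" unfolding f_def using False by (intro analytic_intros) auto
    then have "\<nu> z = f z" unfolding \<nu>_def by (rule remove_sings_at_analytic)
    then show ?thesis using False by (simp add: f_def)
  qed
qed

text \<open>If \<open>\<nu>\<close> reached modulus one it would be constant by the maximum principle, and the Jacobian would
  vanish identically.\<close>

lemma injective_harmonic_beltrami:
  assumes S: "open S" "connected S" "S \<noteq> {}" and h: "harmonic_on h S" and inj: "inj_on h S"
  obtains f a \<nu> where "f = h \<or> f = (\<lambda>z. cnj (h z))" "a holomorphic_on S" "\<nu> holomorphic_on S"
    "\<And>z. z \<in> S \<Longrightarrow> cmod (\<nu> z) < 1"
    "\<And>z. z \<in> S \<Longrightarrow> (f has_derivative (\<lambda>v. a z * v + cnj (\<nu> z * a z * v))) (at z)"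
proof -
  obtain a b where ab: "a holomorphic_on S" "b holomorphic_on S"
    and der: "\<And>z. z \<in> S \<Longrightarrow> (h has_derivative (\<lambda>v. a z * v + cnj (b z * v))) (at z)"
    using harmonic_derivative_holomorphic[OF h] by metis
  have main: "\<exists>\<nu>. \<nu> holomorphic_on S \<and> (\<forall>z\<in>S. cmod (\<nu> z) < 1 \<and> b z = \<nu> z * a z)"
    if inj: "inj_on f S" and ab: "a holomorphic_on S" "b holomorphic_on S"
      and der: "\<And>z. z \<in> S \<Longrightarrow> (f has_derivative (\<lambda>v. a z * v + cnj (b z * v))) (at z)"
      and le: "\<forall>z\<in>S. cmod (b z) \<le> cmod (a z)" for f a b
  proof -
    have no_eq: "\<exists>z\<in>S. cmod (b z) \<noteq> cmod (a z)"
    proof (rule ccontr)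
      assume eq: "\<not> ?thesis"
      obtain z where z: "z \<in> S" using S(3) by blast
      obtain r where r: "r > 0" "ball z r \<subseteq> S" by (rule openE[OF S(1) z])
      show False
        by (rule degenerate_derivative_not_injective[OF r(1) inj_on_subset[OF inj r(2)]
              holomorphic_on_subset[OF ab(1) r(2)] holomorphic_on_subset[OF ab(2) r(2)]])
           (use der eq r(2) in blast)+
    qed
    have nz: "\<exists>z\<in>S. a z \<noteq> 0"
    proof -
      obtain z where z: "z \<in> S" "cmod (b z) \<noteq> cmod (a z)" using no_eq by blast
      then have "a z \<noteq> 0" using le by auto
      then show ?thesis using z(1) by blast
    qed
    obtain \<nu> where \<nu>: "\<nu> holomorphic_on S" "\<And>z. z \<in> S \<Longrightarrow> b z = \<nu> z * a z" "\<And>z. z \<in> S \<Longrightarrow> cmod (\<nu> z) \<le> 1"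
      using holomorphic_quotient_of_dominated[OF S(1,2) ab _ nz] le by metis
    have "cmod (\<nu> z) < 1" if z: "z \<in> S" for z
    proof (rule ccontr)
      assume "\<not> ?thesis"
      then have z1: "cmod (\<nu> z) = 1" using \<nu>(3)[OF z] by simp
      have "\<nu> constant_on S"
        by (rule maximum_modulus_principle[OF \<nu>(1) S(1,2) S(1) order_refl z]) (use \<nu>(3) z1 in simp)
      then have "cmod (\<nu> x) = 1" if "x \<in> S" for x using z1 z that by (auto simp: constant_on_def)
      then have "cmod (b x) = cmod (a x)" if "x \<in> S" for x using \<nu>(2)[OF that] that by (simp add: norm_mult)
      then show False using no_eq by blast
    qed
    then show ?thesis using \<nu> by blast
  qed
  from injective_harmonic_sense[OF S(1,2) inj ab der] show thesis
  proof
    assume "\<forall>z\<in>S. cmod (b z) \<le> cmod (a z)"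
    from main[OF inj ab der this] obtain \<nu> where
      \<nu>: "\<nu> holomorphic_on S" "\<And>z. z \<in> S \<Longrightarrow> cmod (\<nu> z) < 1" "\<And>z. z \<in> S \<Longrightarrow> b z = \<nu> z * a z" by blast
    show thesis by (rule that[of h a \<nu>]) (use ab \<nu> der in auto)
  next
    assume le: "\<forall>z\<in>S. cmod (a z) \<le> cmod (b z)"
    have inj': "inj_on (\<lambda>z. cnj (h z)) S" using inj by (simp add: inj_on_def)
    have der': "((\<lambda>z. cnj (h z)) has_derivative (\<lambda>v. b z * v + cnj (a z * v))) (at z)" if "z \<in> S" for z
      using bounded_linear.has_derivative[OF bounded_linear_cnj der[OF that]] by (simp add: add.commute)
    from main[OF inj' ab(2,1) der' le] obtain \<nu> where
      \<nu>: "\<nu> holomorphic_on S" "\<And>z. z \<in> S \<Longrightarrow> cmod (\<nu> z) < 1" "\<And>z. z \<in> S \<Longrightarrow> a z = \<nu> z * b z" by blast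
    show thesis by (rule that[of "\<lambda>z. cnj (h z)" b \<nu>]) (use ab \<nu> der' in auto)
  qed
qed

section \<open>Decay of bounded functions on a strip\<close>

lemma periodic_int:
  fixes f :: "complex \<Rightarrow> 'a"
  assumes "\<And>w. f (w + 2 * of_real pi * \<i>) = f w"
  shows "f (w + of_int n * (2 * of_real pi * \<i>)) = f w"
proof (induction n rule: int_induct[where k = 0])
  case (step1 i)
  then show ?case using assms[of "w + of_int i * (2 * of_real pi * \<i>)"] by (simp add: algebra_simps)
next
  case (step2 i)
  then show ?case using assms[of "w + of_int (i - 1) * (2 * of_real pi * \<i>)"] by (simp add: algebra_simps)
qed simp

lemma period_representative:
  obtains n :: int where "\<bar>Im (w + of_int n * (2 * of_real pi * \<i>))\<bar> \<le> pi"
proof -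
  define n where "n = - round (Im w / (2 * pi))"
  have "\<bar>of_int (round (Im w / (2 * pi))) - Im w / (2 * pi)\<bar> \<le> 1 / 2" by (rule of_int_round_abs_le)
  then have "\<bar>(of_int (round (Im w / (2 * pi))) - Im w / (2 * pi)) * (2 * pi)\<bar> \<le> 1 / 2 * (2 * pi)"
    unfolding abs_mult by (intro mult_mono) auto
  moreover have "(of_int (round (Im w / (2 * pi))) - Im w / (2 * pi)) * (2 * pi) = - Im (w + of_int n * (2 * of_real pi * \<i>))"
    by (simp add: n_def algebra_simps)
  ultimately show thesis using that[of n] by simp
qed

text \<open>\<open>Arctan\<close> is, up to scaling, the conformal map of the disc onto the strip.\<close>

lemma arctan_disc_strip:
  assumes z: "cmod z < 1" and \<tau>: "\<tau> > 0"
  shows "\<bar>Re (of_real (2 * \<tau> / pi) * Arctan z)\<bar> < \<tau> / 2"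
proof -
  have "\<bar>Re (Arctan z)\<bar> < pi / 4"
  proof -
    let ?q = "(1 - \<i> * z) / (1 + \<i> * z)"
    have ne: "1 + \<i> * z \<noteq> 0"
    proof
      assume "1 + \<i> * z = 0"
      then have "cmod (\<i> * z) = 1" by (metis add_eq_0_iff norm_minus_cancel norm_one)
      then show False using z by (simp add: norm_mult)
    qed
    have "?q = (1 - \<i> * z) * cnj (1 + \<i> * z) / of_real ((cmod (1 + \<i> * z))\<^sup>2)"
    proof -
      have "cnj (1 + \<i> * z) \<noteq> 0" using ne by (metis complex_cnj_zero_iff)
      then show ?thesis unfolding complex_norm_square by (rule mult_divide_mult_cancel_right[symmetric])
    qed
    then have "Re ?q = Re ((1 - \<i> * z) * cnj (1 + \<i> * z)) / (cmod (1 + \<i> * z))\<^sup>2" by (simp only: Re_divide_of_real)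
    moreover have "Re ((1 - \<i> * z) * cnj (1 + \<i> * z)) = 1 - (cmod z)\<^sup>2"
      unfolding cmod_power2 by (simp add: algebra_simps power2_eq_square)
    ultimately have "Re ?q > 0" using ne z by (simp add: power_less_one_iff)
    then have "\<bar>Im (Ln ?q)\<bar> < pi / 2" using Re_Ln_pos_lt_imp ne by blast
    moreover have "Re (Arctan z) = - Im (Ln ?q) / 2" by (simp add: Arctan_def)
    ultimately show ?thesis by simp
  qed
  then have "(2 * \<tau> / pi) * \<bar>Re (Arctan z)\<bar> < (2 * \<tau> / pi) * (pi / 4)"
    using \<tau> by (intro mult_strict_left_mono) auto
  moreover have "Re (of_real (2 * \<tau> / pi) * Arctan z) = (2 * \<tau> / pi) * Re (Arctan z)" by simp
  ultimately show ?thesis using \<tau> by (simp add: abs_mult)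
qed


text \<open>The Schwarz lemma for \<open>n\<close> composed with a conformal map of the disc onto the strip; the inverse
  map is the tangent, whose modulus on the imaginary axis is the hyperbolic tangent.\<close>

lemma strip_schwarz:
  fixes n :: "complex \<Rightarrow> complex" and \<tau> :: real
  assumes \<tau>: "\<tau> > 0" and n: "n holomorphic_on {w. \<bar>Re w\<bar> < \<tau> / 2}"
    and lt: "\<And>w. \<bar>Re w\<bar> < \<tau> / 2 \<Longrightarrow> cmod (n w) < 1" and n0: "n 0 = 0"
  shows "cmod (n (\<i> * of_real \<theta>)) \<le> \<bar>sinh (pi * \<theta> / (2 * \<tau>))\<bar> / cosh (pi * \<theta> / (2 * \<tau>))"
proof -
  define y where "y = pi * \<theta> / (2 * \<tau>)"
  define G where "G z = n (of_real (2 * \<tau> / pi) * Arctan z)" for z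
  have "(\<lambda>z. of_real (2 * \<tau> / pi) * Arctan z) holomorphic_on ball 0 1"
  proof (intro holomorphic_intros holomorphic_on_Arctan)
    fix z :: complex assume "z \<in> ball 0 1"
    then show "\<bar>Im z\<bar> < 1" using abs_Im_le_cmod[of z] by simp
  qed
  moreover have "(\<lambda>z. of_real (2 * \<tau> / pi) * Arctan z) ` ball 0 1 \<subseteq> {w. \<bar>Re w\<bar> < \<tau> / 2}"
  proof (rule image_subsetI)
    fix z :: complex assume "z \<in> ball 0 1"
    then have "cmod z < 1" by simp
    from arctan_disc_strip[OF this \<tau>]
    show "of_real (2 * \<tau> / pi) * Arctan z \<in> {w. \<bar>Re w\<bar> < \<tau> / 2}" by (simp only: mem_Collect_eq)
  qed
  ultimately have "n \<circ> (\<lambda>z. of_real (2 * \<tau> / pi) * Arctan z) holomorphic_on ball 0 1"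
    by (rule holomorphic_on_compose_gen[OF _ n])
  then have G: "G holomorphic_on ball 0 1" by (simp only: G_def[abs_def] o_def)
  have G0: "G 0 = 0" using n0 by (simp add: G_def)
  have Gb: "cmod (G z) < 1" if "cmod z < 1" for z
    unfolding G_def by (rule lt[OF arctan_disc_strip[OF that \<tau>]])
  define \<zeta> where "\<zeta> = tan (\<i> * of_real y)"
  have e: "exp (\<i> * (\<i> * of_real y)) = of_real (exp (- y))" "exp (- (\<i> * (\<i> * of_real y))) = of_real (exp y)"
    by (simp_all add: mult.assoc[symmetric] exp_of_real flip: of_real_minus)
  have sin: "sin (\<i> * of_real y) = \<i> * of_real (sinh y)"
    unfolding sin_exp_eq e by (simp add: sinh_field_def field_simps)
  have cos: "cos (\<i> * of_real y) = of_real (cosh y)"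
    unfolding cos_exp_eq e by (simp add: cosh_field_def add.commute)
  have nz: "cmod \<zeta> = \<bar>sinh y\<bar> / cosh y"
    unfolding \<zeta>_def tan_def sin cos by (simp add: norm_divide norm_mult)
  have "cosh y > 0" "\<bar>sinh y\<bar> < cosh y"
  proof -
    show "cosh y > 0" by simp
    have "cosh y - sinh y = exp (- y)" "cosh y + sinh y = exp y" by (simp_all add: cosh_minus_sinh cosh_plus_sinh)
    then show "\<bar>sinh y\<bar> < cosh y" using exp_gt_zero[of y] exp_gt_zero[of "- y"] by linarith
  qed
  then have z1: "cmod \<zeta> < 1" unfolding nz by (simp add: divide_less_eq)
  have "Arctan \<zeta> = \<i> * of_real y" unfolding \<zeta>_def by (rule Arctan_tan) simp
  then have "of_real (2 * \<tau> / pi) * Arctan \<zeta> = \<i> * of_real \<theta>"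
    using \<tau> by (simp add: y_def field_simps)
  then have "G \<zeta> = n (\<i> * of_real \<theta>)" by (simp add: G_def)
  moreover have "cmod (G \<zeta>) \<le> cmod \<zeta>" by (rule Schwarz_Lemma(1)[OF G G0 Gb z1])
  ultimately show ?thesis using nz by (simp add: y_def)
qed

lemma tanh_quotient_mono:
  fixes x y :: real
  assumes "\<bar>x\<bar> \<le> y" "y > 0" shows "\<bar>sinh x\<bar> / cosh x \<le> inverse (coth y)"
proof -
  have "\<bar>sinh x\<bar> = sinh \<bar>x\<bar>" by (simp add: abs_if)
  moreover have "cosh x = cosh \<bar>x\<bar>" by (simp add: abs_if)
  moreover have "sinh \<bar>x\<bar> * cosh y \<le> sinh y * cosh \<bar>x\<bar>"
  proof -
    have "sinh (y - \<bar>x\<bar>) \<ge> 0" using assms by simp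
    then show ?thesis by (simp add: sinh_diff mult.commute)
  qed
  ultimately show ?thesis using assms by (simp add: coth_def divide_simps mult.commute)
qed

text \<open>By periodicity it suffices to look at points of height at most \<open>\<pi>\<close>.\<close>

lemma middle_line_bound:
  fixes n :: "complex \<Rightarrow> complex" and \<tau> :: real
  assumes \<tau>: "\<tau> > 0" and n: "n holomorphic_on {w. \<bar>Re w\<bar> < \<tau> / 2}"
    and lt: "\<And>w. \<bar>Re w\<bar> < \<tau> / 2 \<Longrightarrow> cmod (n w) < 1" and n0: "n 0 = 0"
    and per: "\<And>w. n (w + 2 * of_real pi * \<i>) = n w" and w: "Re w = 0"
  shows "cmod (n w) \<le> inverse (mid_circle_bound \<tau>)"
proof -
  obtain j :: int where j: "\<bar>Im (w + of_int j * (2 * of_real pi * \<i>))\<bar> \<le> pi" by (rule period_representative)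
  define \<theta> where "\<theta> = Im (w + of_int j * (2 * of_real pi * \<i>))"
  have "w + of_int j * (2 * of_real pi * \<i>) = \<i> * of_real \<theta>" using w by (simp add: complex_eq_iff \<theta>_def)
  then have "n w = n (\<i> * of_real \<theta>)" using periodic_int[of n w j, OF per] by simp
  moreover have "cmod (n (\<i> * of_real \<theta>)) \<le> \<bar>sinh (pi * \<theta> / (2 * \<tau>))\<bar> / cosh (pi * \<theta> / (2 * \<tau>))"
    by (rule strip_schwarz[OF \<tau> n lt n0])
  moreover have "\<dots> \<le> inverse (coth (pi\<^sup>2 / (2 * \<tau>)))"
  proof (rule tanh_quotient_mono)
    have "pi * \<bar>\<theta>\<bar> \<le> pi * pi" using j by (simp add: \<theta>_def)
    then show "\<bar>pi * \<theta> / (2 * \<tau>)\<bar> \<le> pi\<^sup>2 / (2 * \<tau>)"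
      using \<tau> by (simp add: abs_mult power2_eq_square divide_right_mono)
  qed (use \<tau> in simp)
  ultimately show ?thesis by (simp add: mid_circle_bound_def)
qed

text \<open>Periodicity makes up for the missing compactness: the modulus attains its maximum over the whole strip
  within one period.\<close>

lemma periodic_strip_maximum:
  fixes G :: "complex \<Rightarrow> complex"
  assumes s: "0 < s" and G: "G holomorphic_on {w. 0 < Re w \<and> Re w < s}"
    and cont: "continuous_on {w. 0 \<le> Re w \<and> Re w \<le> s} G"
    and per: "\<And>w. cmod (G (w + 2 * of_real pi * \<i>)) = cmod (G w)"
    and bd: "\<And>w. Re w = 0 \<or> Re w = s \<Longrightarrow> cmod (G w) \<le> B"
    and w: "0 \<le> Re w" "Re w \<le> s"
  shows "cmod (G w) \<le> B"
proof -
  let ?C = "{w. 0 \<le> Re w \<and> Re w \<le> s}" and ?S = "{w. 0 < Re w \<and> Re w < s}"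
  define Q where "Q = cbox (Complex 0 (- pi)) (Complex s pi)"
  have QC: "Q \<subseteq> ?C" by (auto simp: Q_def in_cbox_complex_iff)
  have "0 \<in> Q" using s by (simp add: Q_def in_cbox_complex_iff)
  then have "compact Q" "Q \<noteq> {}" by (auto simp: Q_def)
  moreover have "continuous_on Q (\<lambda>w. cmod (G w))" using continuous_on_subset[OF cont QC] by (rule continuous_on_norm)
  ultimately obtain w0 where w0: "w0 \<in> Q" "\<And>x. x \<in> Q \<Longrightarrow> cmod (G x) \<le> cmod (G w0)"
    using continuous_attains_sup[of Q "\<lambda>w. cmod (G w)"] by blast
  have max: "cmod (G x) \<le> cmod (G w0)" if x: "x \<in> ?C" for x
  proof -
    obtain j :: int where j: "\<bar>Im (x + of_int j * (2 * of_real pi * \<i>))\<bar> \<le> pi" by (rule period_representative)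
    have "x + of_int j * (2 * of_real pi * \<i>) \<in> Q" using x j by (simp add: Q_def in_cbox_complex_iff abs_le_iff)
    then show ?thesis using w0(2) periodic_int[of "\<lambda>w. cmod (G w)" x j, OF per] by metis
  qed
  have "cmod (G w0) \<le> B"
  proof (cases "Re w0 = 0 \<or> Re w0 = s")
    case True
    then show ?thesis by (rule bd)
  next
    case False
    then have w0S: "w0 \<in> ?S" using w0(1) QC by auto
    have S: "?S = {w. 0 < Re w} \<inter> {w. Re w < s}" by auto
    have oS: "open ?S" unfolding S by (intro open_Int open_halfspace_Re_gt open_halfspace_Re_lt)
    have cS: "connected ?S" unfolding S
      by (intro convex_connected convex_Int convex_halfspace_Re_gt convex_halfspace_Re_lt)
    have "G constant_on ?S"
      by (rule maximum_modulus_principle[OF G oS cS oS order_refl w0S]) (use max in auto)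
    then obtain c where c: "\<And>x. x \<in> ?S \<Longrightarrow> G x = c" by (auto simp: constant_on_def)
    have lim: "((\<lambda>t. G (of_real t)) \<longlongrightarrow> G 0) (at 0 within {0..s})"
    proof -
      have "continuous_on {0..s} (\<lambda>t. G (of_real t))"
        by (rule continuous_on_compose2[OF cont]) (auto intro!: continuous_intros)
      moreover have "0 \<in> {0..s}" using s by simp
      ultimately have "((\<lambda>t. G (of_real t)) \<longlongrightarrow> G (of_real 0)) (at 0 within {0..s})"
        unfolding continuous_on_def by (rule bspec)
      then show ?thesis by (simp only: of_real_0)
    qed
    have "((\<lambda>t. G (of_real t)) \<longlongrightarrow> G 0) (at 0 within {0<..<s})"
      by (rule tendsto_within_subset[OF lim]) auto
    moreover have "eventually (\<lambda>t. G (of_real t) = c) (at 0 within {0<..<s})"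
      unfolding eventually_at_filter by (rule always_eventually) (use c in auto)
    ultimately have "((\<lambda>_. c) \<longlongrightarrow> G 0) (at 0 within {0<..<s})"
      using Lim_transform_eventually by fast
    moreover have "at 0 within {0<..<s} \<noteq> bot"
      using s by (simp add: trivial_limit_within islimpt_greaterThanLessThan1)
    ultimately have "G 0 = c" using tendsto_unique tendsto_const by metis
    then show ?thesis using bd[of 0] c[OF w0S] by simp
  qed
  then show ?thesis using max[of w] w by auto
qed

text \<open>Hadamard's three lines argument, applied to \<open>n w * exp (- \<alpha> w)\<close> on the strip \<open>0 \<le> Re w \<le> s\<close> with
  \<open>\<alpha> = 2 L / \<tau>\<close>, followed by the limit as \<open>s\<close> approaches \<open>\<tau> / 2\<close>.\<close>

lemma half_strip_decay:
  fixes n :: "complex \<Rightarrow> complex" and \<tau> L :: real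
  assumes \<tau>: "\<tau> > 0" and L: "L > 0" and n: "n holomorphic_on {w. \<bar>Re w\<bar> < \<tau> / 2}"
    and lt: "\<And>w. \<bar>Re w\<bar> < \<tau> / 2 \<Longrightarrow> cmod (n w) < 1"
    and per: "\<And>w. n (w + 2 * of_real pi * \<i>) = n w"
    and mid: "\<And>w. Re w = 0 \<Longrightarrow> cmod (n w) \<le> exp (- L)"
    and w: "0 \<le> Re w" "Re w < \<tau> / 2"
  shows "cmod (n w) \<le> exp (- L * (1 - Re w / (\<tau> / 2)))"
proof -
  define \<alpha> where "\<alpha> = 2 * L / \<tau>"
  have \<alpha>: "\<alpha> > 0" using \<tau> L by (simp add: \<alpha>_def)
  have *: "cmod (n w) \<le> exp (\<alpha> * (Re w - s))" if s: "Re w < s" "s < \<tau> / 2" for s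
  proof -
    have s0: "s > 0" using w s by linarith
    define G where "G v = n v * exp (- (of_real \<alpha> * v))" for v
    have nG: "cmod (G v) = cmod (n v) * exp (- (\<alpha> * Re v))" for v by (simp add: G_def norm_mult)
    have sub: "{w. 0 \<le> Re w \<and> Re w \<le> s} \<subseteq> {w. \<bar>Re w\<bar> < \<tau> / 2}" "{w. 0 < Re w \<and> Re w < s} \<subseteq> {w. \<bar>Re w\<bar> < \<tau> / 2}"
      using s by auto
    have hG: "G holomorphic_on {w. \<bar>Re w\<bar> < \<tau> / 2}" unfolding G_def using n by (intro holomorphic_intros)
    have "cmod (G w) \<le> exp (- (\<alpha> * s))"
    proof (rule periodic_strip_maximum[where G = G and w = w, OF s0])
      show "G holomorphic_on {w. 0 < Re w \<and> Re w < s}" by (rule holomorphic_on_subset[OF hG sub(2)])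
      show "continuous_on {w. 0 \<le> Re w \<and> Re w \<le> s} G"
        by (rule continuous_on_subset[OF holomorphic_on_imp_continuous_on[OF hG] sub(1)])
      show "cmod (G (v + 2 * of_real pi * \<i>)) = cmod (G v)" for v unfolding nG per by simp
      show "cmod (G v) \<le> exp (- (\<alpha> * s))" if v: "Re v = 0 \<or> Re v = s" for v
      proof (cases "Re v = 0")
        case True
        have "\<alpha> * s \<le> \<alpha> * (\<tau> / 2)" using s \<alpha> by (intro mult_left_mono) auto
        also have "\<dots> = L" using \<tau> by (simp add: \<alpha>_def)
        finally have "exp (- L) \<le> exp (- (\<alpha> * s))" by simp
        with mid[OF True] have "cmod (n v) \<le> exp (- (\<alpha> * s))" by (rule order_trans)
        then show ?thesis unfolding nG True by simp
      next
        case False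
        then have "Re v = s" using v by simp
        then have "cmod (n v) \<le> 1" using lt[of v] s s0 by simp
        then show ?thesis unfolding nG \<open>Re v = s\<close> by (simp add: mult_le_cancel_right1)
      qed
    qed (use w s in auto)
    then have "cmod (n w) * exp (- (\<alpha> * Re w)) * exp (\<alpha> * Re w) \<le> exp (- (\<alpha> * s)) * exp (\<alpha> * Re w)"
      unfolding nG by (rule mult_right_mono) simp
    then show ?thesis by (simp add: mult.assoc right_diff_distrib flip: exp_add)
  qed
  have "((\<lambda>s. exp (\<alpha> * (Re w - s))) \<longlongrightarrow> exp (\<alpha> * (Re w - \<tau> / 2))) (at_left (\<tau> / 2))"
    by (intro tendsto_intros)
  moreover have "eventually (\<lambda>s. cmod (n w) \<le> exp (\<alpha> * (Re w - s))) (at_left (\<tau> / 2))"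
    unfolding eventually_at_left[OF w(2)] using * w(2) by blast
  ultimately have "cmod (n w) \<le> exp (\<alpha> * (Re w - \<tau> / 2))"
    by (rule tendsto_lowerbound) simp
  also have "\<alpha> * (Re w - \<tau> / 2) = - L * (1 - Re w / (\<tau> / 2))"
    using \<tau> by (simp add: \<alpha>_def field_simps)
  finally show ?thesis .
qed

lemma strip_decay:
  fixes n :: "complex \<Rightarrow> complex" and \<tau> :: real
  assumes \<tau>: "\<tau> > 0" and n: "n holomorphic_on {w. \<bar>Re w\<bar> < \<tau> / 2}"
    and lt: "\<And>w. \<bar>Re w\<bar> < \<tau> / 2 \<Longrightarrow> cmod (n w) < 1" and n0: "n 0 = 0"
    and per: "\<And>w. n (w + 2 * of_real pi * \<i>) = n w" and w: "\<bar>Re w\<bar> < \<tau> / 2"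
  shows "cmod (n w) \<le> exp (- ln (mid_circle_bound \<tau>) * (1 - \<bar>Re w\<bar> / (\<tau> / 2)))"
proof -
  define L where "L = ln (mid_circle_bound \<tau>)"
  have m: "mid_circle_bound \<tau> > 1" by (rule mid_circle_bound_gt_1[OF \<tau>])
  have L: "L > 0" using m by (simp add: L_def)
  have e: "exp (- L) = inverse (mid_circle_bound \<tau>)" using m by (simp add: L_def exp_minus)
  have mid: "cmod (n v) \<le> exp (- L)" if "Re v = 0" for v
    unfolding e by (rule middle_line_bound[OF \<tau> n lt n0 per that])
  show ?thesis
  proof (cases "Re w \<ge> 0")
    case True
    then show ?thesis using half_strip_decay[OF \<tau> L n lt per mid, of w] w by (simp add: L_def)
  next
    case False
    have hn: "(\<lambda>v. n (- v)) holomorphic_on {w. \<bar>Re w\<bar> < \<tau> / 2}"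
    proof -
      have "n \<circ> uminus holomorphic_on {w. \<bar>Re w\<bar> < \<tau> / 2}"
        by (rule holomorphic_on_compose_gen[OF _ n]) (auto intro!: holomorphic_intros)
      then show ?thesis by (simp only: o_def)
    qed
    have pn: "n (- (v + 2 * of_real pi * \<i>)) = n (- v)" for v
      using per[of "- v - 2 * of_real pi * \<i>"] by (simp add: algebra_simps)
    have "cmod (n (- (- w))) \<le> exp (- L * (1 - Re (- w) / (\<tau> / 2)))"
      by (rule half_strip_decay[OF \<tau> L hn, of "- w"]) (use lt pn mid w False in auto)
    then show ?thesis using False by (simp add: L_def)
  qed
qed

section \<open>The conformal modulus and its behaviour under harmonic homeomorphisms\<close>

lemma open_annulus: "open (annulus r R)"
proof -
  have "annulus r R = cmod -` {r<..<R}" by (auto simp: annulus_def)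
  then show ?thesis by (simp add: open_vimage continuous_on_norm_id)
qed

lemma homeomorphism_of_injection:
  fixes F :: "complex \<Rightarrow> complex"
  assumes "continuous_on S F" "open S" "bij_betw F S T"
  obtains G where "homeomorphism S T F G"
  using invariance_of_domain_homeomorphism[of S F] assms by (auto simp: bij_betw_def)

text \<open>The distortion inequality for dilatation zero, on closed subannuli that exhaust the annulus.\<close>

lemma conformal_annuli_modulus_le:
  assumes r: "0 < r" "r < R" "0 < r'" "r' < R'"
    and eq: "conformally_equivalent (annulus r R) (annulus r' R')"
  shows "ln (R / r) \<le> ln (R' / r')"
proof -
  obtain F where F: "F holomorphic_on annulus r R" "bij_betw F (annulus r R) (annulus r' R')"
    using eq unfolding conformally_equivalent_def by blast
  obtain G where G: "homeomorphism (annulus r R) (annulus r' R') F G"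
    using homeomorphism_of_injection[OF holomorphic_on_imp_continuous_on[OF F(1)] open_annulus F(2)] .
  have R: "R > 0" using r by simp
  have le: "s2 - s1 \<le> ln (R' / r')" if s: "ln r < s1" "s1 \<le> s2" "s2 < ln R" for s1 s2
  proof -
    have inA: "exp w \<in> annulus r R" if "s1 \<le> Re w" "Re w \<le> s2" for w
      using exp_in_annulus_iff[OF r(1) R, of w] that s by (simp add: log_strip_def)
    have "(s2 - s1) * ((1 - 0) / (1 + 0)) \<le> ln (R' / r')"
    proof (rule annulus_quasiconformal_modulus[OF r G s, where a = "\<lambda>w. deriv F (exp w) * exp w" and b = "\<lambda>_. 0"])
      fix w assume w: "s1 \<le> Re w" "Re w \<le> s2"
      have "(F has_field_derivative deriv F (exp w)) (at (exp w))"
        by (rule holomorphic_derivI[OF F(1) open_annulus inA[OF w]])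
      from DERIV_chain2[OF this DERIV_exp]
      show "((\<lambda>w. F (exp w)) has_derivative (\<lambda>v. deriv F (exp w) * exp w * v + 0 * cnj v)) (at w)"
        by (simp add: has_field_derivative_def)
    next
      have "continuous_on (annulus r R) (deriv F)"
        by (rule holomorphic_on_imp_continuous_on[OF holomorphic_deriv[OF F(1) open_annulus]])
      then have "continuous_on {w. s1 \<le> Re w \<and> Re w \<le> s2} (\<lambda>w. deriv F (exp w))"
        by (rule continuous_on_compose2[where f = exp]) (use inA in \<open>auto intro: continuous_on_exp\<close>)
      then show "continuous_on {w. s1 \<le> Re w \<and> Re w \<le> s2} (\<lambda>w. deriv F (exp w) * exp w)"
        by (intro continuous_intros)
    qed auto
    then show ?thesis by simp
  qed
  have "ln R - ln r \<le> ln (R' / r')"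
  proof (rule field_le_epsilon)
    fix e :: real assume e: "e > 0"
    have lr: "ln r < ln R" using r by simp
    define d where "d = min (e / 2) ((ln R - ln r) / 4)"
    have d: "d > 0" "2 * d \<le> e" "2 * d < ln R - ln r" using e lr by (auto simp: d_def min_def)
    have "(ln R - d) - (ln r + d) \<le> ln (R' / r')" by (rule le) (use d in linarith)+
    then show "ln R - ln r \<le> ln (R' / r') + e" using d by linarith
  qed
  then show ?thesis using r by (simp add: ln_div)
qed

lemma conformal_modulus_eq:
  assumes \<Omega>: "open \<Omega>" "nondegenerate \<Omega>" and r: "0 < r" "r < R"
    and eq: "conformally_equivalent \<Omega> (annulus r R)"
  shows "conformal_modulus \<Omega> = ereal (ln (R / r))"
proof -
  have "(THE m. \<exists>r R. 0 < r \<and> r < R \<and> conformally_equivalent \<Omega> (annulus r R) \<and> m = ln (R / r)) = ln (R / r)"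
  proof (rule the_equality)
    show "\<exists>r' R'. 0 < r' \<and> r' < R' \<and> conformally_equivalent \<Omega> (annulus r' R') \<and> ln (R / r) = ln (R' / r')"
      using r eq by blast
    fix m assume "\<exists>r R. 0 < r \<and> r < R \<and> conformally_equivalent \<Omega> (annulus r R) \<and> m = ln (R / r)"
    then obtain r' R' where r': "0 < r'" "r' < R'" "conformally_equivalent \<Omega> (annulus r' R')" "m = ln (R' / r')" by blast
    have "conformally_equivalent (annulus r R) (annulus r' R')"
      using conformally_equivalent_trans[OF conformally_equivalent_sym[OF \<Omega>(1) eq] r'(3)] .
    moreover from this have "conformally_equivalent (annulus r' R') (annulus r R)"
      by (rule conformally_equivalent_sym[OF open_annulus])
    ultimately show "m = ln (R / r)"
      using conformal_annuli_modulus_le[OF r r'(1,2)] conformal_annuli_modulus_le[OF r'(1,2) r] r'(4) by simp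
  qed
  then show ?thesis using \<Omega>(2) by (simp add: conformal_modulus_def)
qed

text \<open>The affine map is \<open>v \<mapsto> v - \<kappa> cnj v\<close>, after a conjugation if \<open>h\<close> reverses the orientation, with
  \<open>\<kappa>\<close> the conjugate of the dilatation at a point \<open>p\<close> of the middle circle.\<close>

lemma harmonic_annulus_estimate:
  assumes r: "0 < r" "r < R" and \<Omega>: "open \<Omega>" "connected \<Omega>" "\<Omega> \<noteq> {}"
    and conf: "conformally_equivalent \<Omega> (annulus r R)"
    and h: "harmonic_on h \<Omega>" "homeomorphism \<Omega> \<Omega>' h g"
  obtains \<phi> where "affine_automorphism \<phi>"
    "\<And>r' R'. 0 < r' \<Longrightarrow> r' < R' \<Longrightarrow> conformally_equivalent (\<phi> ` \<Omega>') (annulus r' R') \<Longrightarrow>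
       modulus_profile (ln (R / r)) * ln (R / r) \<le> ln (R' / r')"
proof -
  have R: "R > 0" using r by simp
  have hb: "inj_on h \<Omega>" "h ` \<Omega> = \<Omega>'" "continuous_on \<Omega> h"
    using h(2) unfolding homeomorphism_def by (auto intro: inj_on_inverseI[of \<Omega> g h])
  have o\<Omega>': "open \<Omega>'" using invariance_of_domain[OF hb(3) \<Omega>(1) hb(1)] hb(2) by simp
  obtain f0 where f0: "f0 holomorphic_on annulus r R" "bij_betw f0 (annulus r R) \<Omega>"
    using conformally_equivalent_sym[OF \<Omega>(1) conf] unfolding conformally_equivalent_def by blast
  have f0\<Omega>: "f0 z \<in> \<Omega>" if "z \<in> annulus r R" for z using f0(2) that by (auto simp: bij_betw_def)
  obtain f a \<nu> where f: "f = h \<or> f = (\<lambda>z. cnj (h z))" and a: "a holomorphic_on \<Omega>" and \<nu>: "\<nu> holomorphic_on \<Omega>"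
    and \<nu>1: "\<And>z. z \<in> \<Omega> \<Longrightarrow> cmod (\<nu> z) < 1"
    and df: "\<And>z. z \<in> \<Omega> \<Longrightarrow> (f has_derivative (\<lambda>v. a z * v + cnj (\<nu> z * a z * v))) (at z)"
    by (rule injective_harmonic_beltrami[OF \<Omega> h(1) hb(1)]) (rule that; assumption)
  define \<tau> where "\<tau> = ln (R / r)"
  have \<tau>: "\<tau> > 0" using r by (simp add: \<tau>_def)
  have \<tau>': "\<tau> = ln R - ln r" using r by (simp add: \<tau>_def ln_div)
  define m where "m = (ln r + ln R) / 2"
  have strip: "exp (w + of_real m) \<in> annulus r R" if "\<bar>Re w\<bar> < \<tau> / 2" for w
  proof -
    have "w + of_real m \<in> log_strip r R" using that unfolding log_strip_def m_def \<tau>' by (auto simp: abs_less_iff field_simps)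
    then show ?thesis using exp_in_annulus_iff[OF r(1) R] by blast
  qed
  define p where "p = f0 (exp (of_real m))"
  have p: "p \<in> \<Omega>" using f0\<Omega>[OF strip[of 0]] \<tau> by (simp add: p_def)
  define \<kappa> where "\<kappa> = cnj (\<nu> p)"
  have \<kappa>: "cmod \<kappa> < 1" using \<nu>1[OF p] by (simp add: \<kappa>_def)
  have \<kappa>2: "(cmod \<kappa>)\<^sup>2 < 1" using \<kappa> by (simp add: power_less_one_iff)
  define \<phi> where "\<phi> = (if f = h then (\<lambda>v. v - \<kappa> * cnj v) else (\<lambda>v. cnj v - \<kappa> * v))"
  have aff: "affine_automorphism \<phi>"
  proof (cases "f = h")
    case True
    have "\<phi> = (\<lambda>z. 1 * z + (- \<kappa>) * cnj z + 0)" using True by (simp add: \<phi>_def)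
    moreover have "(cmod 1)\<^sup>2 - (cmod (- \<kappa>))\<^sup>2 \<noteq> 0" using \<kappa>2 by simp
    ultimately show ?thesis unfolding affine_automorphism_def by blast
  next
    case False
    have "\<phi> = (\<lambda>z. (- \<kappa>) * z + 1 * cnj z + 0)" using False by (simp add: \<phi>_def)
    moreover have "(cmod (- \<kappa>))\<^sup>2 - (cmod 1)\<^sup>2 \<noteq> 0" using \<kappa>2 by simp
    ultimately show ?thesis unfolding affine_automorphism_def by blast
  qed
  define g0 where "g0 z = f z - \<kappa> * cnj (f z)" for z
  have \<phi>h: "\<phi> (h z) = g0 z" for z using f by (auto simp: \<phi>_def g0_def)
  have g0_im: "g0 ` \<Omega> = \<phi> ` \<Omega>'" unfolding hb(2)[symmetric] image_image \<phi>h ..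
  have finj: "inj_on f \<Omega>" using f hb(1) by (auto simp: inj_on_def)
  have g0_inj: "inj_on g0 \<Omega>"
  proof (rule inj_onI)
    fix x y assume xy: "x \<in> \<Omega>" "y \<in> \<Omega>" "g0 x = g0 y"
    then have "f x - f y = \<kappa> * cnj (f x - f y)" by (simp add: g0_def algebra_simps)
    then have "cmod (f x - f y) = cmod \<kappa> * cmod (f x - f y)" by (metis complex_mod_cnj norm_mult)
    then have "cmod (f x - f y) = 0" using \<kappa> by (metis less_irrefl mult_cancel_right1)
    then show "x = y" using finj xy by (simp add: inj_on_def)
  qed
  have fcont: "continuous_on \<Omega> f" using f hb(3) by (auto intro: continuous_on_cnj)
  have g0_cont: "continuous_on \<Omega> g0" unfolding g0_def using fcont by (intro continuous_intros)
  \<comment> \<open>Composing with the affine map acts on the dilatation by a disc automorphism: \<open>n\<close> is the new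
    dilatation, and \<open>\<kappa>\<close> was chosen so that \<open>n\<close> vanishes at \<open>p\<close>.\<close>
  define n where "n z = (\<nu> z - cnj \<kappa>) / (1 - \<kappa> * \<nu> z)" for z
  define A where "A z = (1 - \<kappa> * \<nu> z) * a z" for z
  have den: "1 - \<kappa> * \<nu> z \<noteq> 0" if "z \<in> \<Omega>" for z
  proof
    assume "1 - \<kappa> * \<nu> z = 0"
    then have "cmod \<kappa> * cmod (\<nu> z) = 1" by (metis norm_mult norm_one right_minus_eq)
    then show False using \<nu>1[OF that] \<kappa> by (smt (verit) mult_le_one mult_left_le norm_ge_zero)
  qed
  have n1: "cmod (n z) < 1" if "z \<in> \<Omega>" for z
    using Moebius_function_norm_lt_1[of "cnj \<kappa>" "\<nu> z" 0] \<kappa> \<nu>1[OF that]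
    by (simp add: Moebius_function_simple n_def)
  have nh: "n holomorphic_on \<Omega>" unfolding n_def using \<nu> den by (intro holomorphic_intros)
  have Ah: "A holomorphic_on \<Omega>" unfolding A_def using \<nu> a by (intro holomorphic_intros)
  have dg0: "(g0 has_derivative (\<lambda>v. A z * v + cnj (n z * A z * v))) (at z)" if z: "z \<in> \<Omega>" for z
  proof -
    have "(g0 has_derivative (\<lambda>v. (a z * v + cnj (\<nu> z * a z * v)) - \<kappa> * cnj (a z * v + cnj (\<nu> z * a z * v)))) (at z)"
      unfolding g0_def[abs_def]
      by (intro has_derivative_diff has_derivative_mult_right bounded_linear.has_derivative[OF bounded_linear_cnj] df z)
    moreover have nA: "n z * A z = (\<nu> z - cnj \<kappa>) * a z" using den[OF z] by (simp add: n_def A_def)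
    have "(a z * v + cnj (\<nu> z * a z * v)) - \<kappa> * cnj (a z * v + cnj (\<nu> z * a z * v))
       = A z * v + cnj (n z * A z * v)" for v
      unfolding nA by (simp add: A_def algebra_simps)
    ultimately show ?thesis by simp
  qed
  \<comment> \<open>The estimate is applied on the middle part of the annulus of relative width \<open>y\<close>.  This \<open>y\<close> is
    the one for which the bound \<open>exp (- L * (1 - y))\<close> at its edges equals \<open>1 / (1 + L)\<close>.\<close>
  define L where "L = ln (mid_circle_bound \<tau>)"
  have L: "L > 0" using mid_circle_bound_gt_1[OF \<tau>] by (simp add: L_def)
  define y where "y = 1 - ln (1 + L) / L"
  have y: "0 < y" "y < 1"
    using L ln_add_one_self_less_self[OF L] by (auto simp: y_def)
  define k where "k = 1 / (1 + L)"
  have k: "0 \<le> k" "k < 1" using L by (auto simp: k_def)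
  define nn where "nn w = n (f0 (exp (w + of_real m)))" for w
  have nn_hol: "nn holomorphic_on {w. \<bar>Re w\<bar> < \<tau> / 2}"
  proof -
    have 1: "(\<lambda>w. exp (w + of_real m)) holomorphic_on {w. \<bar>Re w\<bar> < \<tau> / 2}" by (intro holomorphic_intros)
    have "f0 \<circ> (\<lambda>w. exp (w + of_real m)) holomorphic_on {w. \<bar>Re w\<bar> < \<tau> / 2}"
      by (rule holomorphic_on_compose_gen[OF 1 f0(1)]) (use strip in blast)
    then have "n \<circ> (f0 \<circ> (\<lambda>w. exp (w + of_real m))) holomorphic_on {w. \<bar>Re w\<bar> < \<tau> / 2}"
      by (rule holomorphic_on_compose_gen[OF _ nh]) (use strip f0\<Omega> in auto)
    then show ?thesis by (simp add: nn_def[abs_def] o_def)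
  qed
  have nn_per: "nn (w + 2 * of_real pi * \<i>) = nn w" for w
    using exp_period[of "w + of_real m"] by (simp add: nn_def add_ac)
  have nn0: "nn 0 = 0" by (simp add: nn_def n_def p_def[symmetric] \<kappa>_def)
  have nn1: "cmod (nn w) < 1" if "\<bar>Re w\<bar> < \<tau> / 2" for w
    unfolding nn_def by (rule n1[OF f0\<Omega>[OF strip[OF that]]])
  define s1 where "s1 = m - y * \<tau> / 2"
  define s2 where "s2 = m + y * \<tau> / 2"
  have y\<tau>: "y * \<tau> < \<tau>" "0 < y * \<tau>" using y \<tau> by auto
  have s: "ln r < s1" "s1 \<le> s2" "s2 < ln R"
    using y\<tau> unfolding s1_def s2_def m_def \<tau>' by (auto simp: field_simps)
  have nk: "cmod (n (f0 (exp w))) \<le> k" if w: "s1 \<le> Re w" "Re w \<le> s2" for w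
  proof -
    have b: "\<bar>Re (w - of_real m)\<bar> \<le> y * \<tau> / 2"
      using w unfolding s1_def s2_def minus_complex.sel Re_complex_of_real by linarith
    then have b': "\<bar>Re (w - of_real m)\<bar> < \<tau> / 2" using y\<tau> by linarith
    have "cmod (nn (w - of_real m)) \<le> exp (- L * (1 - \<bar>Re (w - of_real m)\<bar> / (\<tau> / 2)))"
      unfolding L_def by (rule strip_decay[OF \<tau> nn_hol nn1 nn0 nn_per b'])
    also have "\<dots> \<le> exp (- L * (1 - y))"
    proof -
      have "\<bar>Re (w - of_real m)\<bar> / (\<tau> / 2) \<le> y" using b \<tau> by (simp add: divide_le_eq)
      then have "L * (1 - y) \<le> L * (1 - \<bar>Re (w - of_real m)\<bar> / (\<tau> / 2))" using L by (intro mult_left_mono) auto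
      then show ?thesis by simp
    qed
    also have "- L * (1 - y) = - ln (1 + L)" using L by (simp add: y_def)
    also have "exp (- ln (1 + L)) = k" using L by (simp add: k_def exp_minus inverse_eq_divide)
    finally show ?thesis by (simp add: nn_def)
  qed
  show thesis
  proof (rule that[OF aff])
    fix r' R' assume r': "0 < r'" "r' < R'" and eq: "conformally_equivalent (\<phi> ` \<Omega>') (annulus r' R')"
    obtain q where q: "q holomorphic_on \<phi> ` \<Omega>'" "bij_betw q (\<phi> ` \<Omega>') (annulus r' R')"
      using eq unfolding conformally_equivalent_def by blast
    have oT: "open (\<phi> ` \<Omega>')" using invariance_of_domain[OF g0_cont \<Omega>(1) g0_inj] g0_im by simp
    define F where "F z = q (g0 (f0 z))" for z
    have g0T: "g0 z \<in> \<phi> ` \<Omega>'" if "z \<in> \<Omega>" for z using g0_im that by blast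
    have c_f0: "continuous_on (annulus r R) f0" by (rule holomorphic_on_imp_continuous_on[OF f0(1)])
    have c_gf: "continuous_on (annulus r R) (\<lambda>z. g0 (f0 z))"
      by (rule continuous_on_compose2[OF g0_cont c_f0]) (use f0\<Omega> in blast)
    have cF: "continuous_on (annulus r R) F" unfolding F_def
      by (rule continuous_on_compose2[OF holomorphic_on_imp_continuous_on[OF q(1)] c_gf]) (use f0\<Omega> g0T in blast)
    have "bij_betw (q \<circ> (g0 \<circ> f0)) (annulus r R) (annulus r' R')"
    proof (rule bij_betw_trans[OF bij_betw_trans[OF f0(2)] q(2)])
      show "bij_betw g0 \<Omega> (\<phi> ` \<Omega>')" using g0_inj g0_im by (simp add: bij_betw_def)
    qed
    then have bF: "bij_betw F (annulus r R) (annulus r' R')" by (simp add: F_def[abs_def] o_def)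
    obtain G where G: "homeomorphism (annulus r R) (annulus r' R') F G"
      using homeomorphism_of_injection[OF cF open_annulus bF] .
    have inA: "exp w \<in> annulus r R" if "s1 \<le> Re w" "Re w \<le> s2" for w
      using exp_in_annulus_iff[OF r(1) R, of w] that s by (simp add: log_strip_def)
    define c where "c w = deriv f0 (exp w) * exp w" for w
    define d where "d w = deriv q (g0 (f0 (exp w)))" for w
    let ?Q = "{w. s1 \<le> Re w \<and> Re w \<le> s2}"
    have c_exp: "continuous_on ?Q exp" by (intro continuous_intros)
    have e_sub: "exp ` ?Q \<subseteq> annulus r R" using inA by blast
    have cc: "continuous_on ?Q c" unfolding c_def
      by (intro continuous_intros continuous_on_compose2[OF holomorphic_on_imp_continuous_on[OF holomorphic_deriv[OF f0(1) open_annulus]] c_exp e_sub])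
    have c_f0e: "continuous_on ?Q (\<lambda>w. f0 (exp w))" by (rule continuous_on_compose2[OF c_f0 c_exp e_sub])
    have c_gfe: "continuous_on ?Q (\<lambda>w. g0 (f0 (exp w)))" by (rule continuous_on_compose2[OF c_gf c_exp e_sub])
    have cd: "continuous_on ?Q d" unfolding d_def
      by (rule continuous_on_compose2[OF holomorphic_on_imp_continuous_on[OF holomorphic_deriv[OF q(1) oT]] c_gfe])
         (use inA f0\<Omega> g0T in blast)
    have cn: "continuous_on ?Q (\<lambda>w. n (f0 (exp w)))" "continuous_on ?Q (\<lambda>w. A (f0 (exp w)))"
      by (rule continuous_on_compose2[OF holomorphic_on_imp_continuous_on[OF nh] c_f0e]
               continuous_on_compose2[OF holomorphic_on_imp_continuous_on[OF Ah] c_f0e]; use inA f0\<Omega> in blast)+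
    have "(s2 - s1) * ((1 - k) / (1 + k)) \<le> ln (R' / r')"
    proof (rule annulus_quasiconformal_modulus[OF r r' G s, where a = "\<lambda>w. d w * (A (f0 (exp w)) * c w)"
          and b = "\<lambda>w. d w * cnj (n (f0 (exp w)) * A (f0 (exp w)) * c w)"])
      fix w assume w: "s1 \<le> Re w" "Re w \<le> s2"
      define z where "z = f0 (exp w)"
      have z: "z \<in> \<Omega>" using f0\<Omega>[OF inA[OF w]] by (simp add: z_def)
      have 1: "((\<lambda>w. f0 (exp w)) has_derivative (\<lambda>v. c w * v)) (at w)"
        using DERIV_chain2[OF holomorphic_derivI[OF f0(1) open_annulus inA[OF w]] DERIV_exp]
        by (simp add: has_field_derivative_def c_def)
      have 2: "((\<lambda>w. g0 (f0 (exp w))) has_derivative (\<lambda>v. A z * (c w * v) + cnj (n z * A z * (c w * v)))) (at w)"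
        using diff_chain_at[OF 1 dg0[OF z, unfolded z_def]] unfolding z_def by (simp only: o_def)
      have "(q has_derivative (\<lambda>v. d w * v)) (at (g0 (f0 (exp w))))"
        using holomorphic_derivI[OF q(1) oT g0T[OF z]] by (simp add: has_field_derivative_def d_def z_def)
      from diff_chain_at[OF 2 this]
      have "((\<lambda>w. F (exp w)) has_derivative (\<lambda>v. d w * (A z * (c w * v) + cnj (n z * A z * (c w * v))))) (at w)"
        by (simp add: o_def F_def)
      moreover have "d w * (A z * (c w * v) + cnj (n z * A z * (c w * v)))
         = d w * (A z * c w) * v + d w * cnj (n z * A z * c w) * cnj v" for v
        by (simp add: algebra_simps)
      ultimately show "((\<lambda>w. F (exp w)) has_derivative (\<lambda>v. d w * (A (f0 (exp w)) * c w) * v +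
           d w * cnj (n (f0 (exp w)) * A (f0 (exp w)) * c w) * cnj v)) (at w)"
        unfolding z_def by simp
      have "cmod (d w * cnj (n (f0 (exp w)) * A (f0 (exp w)) * c w)) = cmod (n (f0 (exp w))) * cmod (d w * (A (f0 (exp w)) * c w))"
        by (simp add: norm_mult)
      then show "cmod (d w * cnj (n (f0 (exp w)) * A (f0 (exp w)) * c w)) \<le> k * cmod (d w * (A (f0 (exp w)) * c w))"
        using mult_right_mono[OF nk[OF w] norm_ge_zero] by simp
    next
      show "continuous_on ?Q (\<lambda>w. d w * (A (f0 (exp w)) * c w))"
           "continuous_on ?Q (\<lambda>w. d w * cnj (n (f0 (exp w)) * A (f0 (exp w)) * c w))"
        by (intro continuous_on_mult continuous_on_cnj cc cd cn)+
    qed (use k in auto)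
    moreover have "s2 - s1 = y * \<tau>" by (simp add: s1_def s2_def)
    moreover have "(1 - k) / (1 + k) = L / (2 + L)"
    proof -
      have "1 - k = L / (1 + L)" "1 + k = (2 + L) / (1 + L)" using L by (simp_all add: k_def field_simps)
      then show ?thesis using L by simp
    qed
    moreover have "y * \<tau> * (L / (2 + L)) = modulus_profile \<tau> * \<tau>"
    proof -
      have "y * L = L - ln (1 + L)" using L by (simp add: y_def left_diff_distrib)
      then have "y * (L / (2 + L)) = modulus_profile \<tau>"
        by (simp add: modulus_profile_def lower_profile_def L_def[symmetric])
      moreover have "y * \<tau> * (L / (2 + L)) = (y * (L / (2 + L))) * \<tau>" by (simp only: mult_ac)
      ultimately show ?thesis by (simp only:)
    qed
    ultimately show "modulus_profile (ln (R / r)) * ln (R / r) \<le> ln (R' / r')" by (simp add: \<tau>_def)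
  qed
qed

section \<open>The affine modulus of a harmonic image\<close>

text \<open>The inverse comes from solving \<open>w = a z + b cnj z + c\<close> together with its conjugate; the determinant
  of this system is \<open>\<bar>a\<bar>\<^sup>2 - \<bar>b\<bar>\<^sup>2\<close>.\<close>

lemma affine_automorphism_homeo:
  assumes "affine_automorphism \<phi>"
  obtains \<psi> where "continuous_on UNIV \<phi>" "continuous_on UNIV \<psi>" "\<And>z. \<psi> (\<phi> z) = z" "\<And>z. \<phi> (\<psi> z) = z"
proof -
  obtain a b c where D: "(cmod a)\<^sup>2 - (cmod b)\<^sup>2 \<noteq> 0" and \<phi>: "\<phi> = (\<lambda>z. a * z + b * cnj z + c)"
    using assms unfolding affine_automorphism_def by blast
  define d where "d = a * cnj a - b * cnj b"
  have d: "d \<noteq> 0" "cnj d = d"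
  proof -
    have "d = of_real ((cmod a)\<^sup>2 - (cmod b)\<^sup>2)" unfolding d_def of_real_diff complex_norm_square ..
    then show "d \<noteq> 0" "cnj d = d" using D by (simp_all only: of_real_eq_0_iff complex_cnj_complex_of_real not_False_eq_True)
  qed
  define \<psi> where "\<psi> w = (cnj a * (w - c) - b * cnj (w - c)) / d" for w
  show thesis
  proof
    show "continuous_on UNIV \<phi>" unfolding \<phi> by (intro continuous_intros)
    show "continuous_on UNIV \<psi>" unfolding \<psi>_def using d by (intro continuous_intros) auto
    show "\<psi> (\<phi> z) = z" for z
    proof -
      have "cnj a * (\<phi> z - c) - b * cnj (\<phi> z - c) = d * z" by (simp add: \<phi> d_def algebra_simps)
      then show ?thesis using d by (simp add: \<psi>_def)
    qed
    show "\<phi> (\<psi> z) = z" for z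
    proof -
      have c: "cnj (\<psi> z) = (a * cnj (z - c) - cnj b * (z - c)) / d" using d(2) by (simp add: \<psi>_def)
      have "a * (cnj a * (z - c) - b * cnj (z - c)) + b * (a * cnj (z - c) - cnj b * (z - c)) = d * (z - c)"
        by (simp add: d_def algebra_simps)
      then have "a * \<psi> z + b * cnj (\<psi> z) = (d * (z - c)) / d"
        unfolding c unfolding \<psi>_def by (simp only: times_divide_eq_right add_divide_distrib[symmetric])
      then show ?thesis using d(1) by (simp add: \<phi>)
    qed
  qed
qed

lemma nondegenerate_ring_annulus:
  assumes "ring_with_hole \<Omega> K" "nondegenerate \<Omega>"
  obtains r R where "0 < r" "r < R" "conformally_equivalent \<Omega> (annulus r R)"
    "conformal_modulus \<Omega> = ereal (ln (R / r))"
proof -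
  have o: "open \<Omega>" using assms(1) unfolding ring_with_hole_def by blast
  obtain r R where r: "0 < r" "r < R" "conformally_equivalent \<Omega> (annulus r R)"
    using doubly_connected_uniformization[OF assms(1) nondegenerate_unbounded_complement[OF assms(2) o]
      nondegenerate_no_isolated_point[OF assms(2) o]] by metis
  then show thesis using that conformal_modulus_eq[OF o assms(2)] by blast
qed

text \<open>If the affine image is degenerate its modulus is infinite.  Otherwise it is conformally an
  annulus, and the estimate for annuli applies.\<close>

theorem harmonic_affine_modulus_ratio:
  assumes D: "doubly_connected_domain \<Omega>" "doubly_connected_domain \<Omega>'" and nd: "nondegenerate \<Omega>"
    and h: "harmonic_on h \<Omega>" "homeomorphism \<Omega> \<Omega>' h g"
  shows "affine_modulus \<Omega>' / conformal_modulus \<Omega> \<ge> ereal (modulus_profile (real_of_ereal (conformal_modulus \<Omega>)))"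
proof -
  obtain K where K: "ring_with_hole \<Omega> K" using doubly_connected_imp_ring_with_hole[OF D(1)] .
  obtain K' where K': "ring_with_hole \<Omega>' K'" using doubly_connected_imp_ring_with_hole[OF D(2)] .
  have \<Omega>: "open \<Omega>" "connected \<Omega>" "\<Omega> \<noteq> {}" using K unfolding ring_with_hole_def by blast+
  obtain r R where r: "0 < r" "r < R" and conf: "conformally_equivalent \<Omega> (annulus r R)"
    and mod: "conformal_modulus \<Omega> = ereal (ln (R / r))"
    using nondegenerate_ring_annulus[OF K nd] by metis
  define \<tau> where "\<tau> = ln (R / r)"
  have \<tau>: "\<tau> > 0" using r by (simp add: \<tau>_def)
  obtain \<phi> where \<phi>: "affine_automorphism \<phi>"
    and est: "\<And>r' R'. 0 < r' \<Longrightarrow> r' < R' \<Longrightarrow> conformally_equivalent (\<phi> ` \<Omega>') (annulus r' R') \<Longrightarrow>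
       modulus_profile (ln (R / r)) * ln (R / r) \<le> ln (R' / r')"
    by (rule harmonic_annulus_estimate[OF r \<Omega> conf h]) (rule that; assumption)
  have "ereal (modulus_profile \<tau> * \<tau>) \<le> conformal_modulus (\<phi> ` \<Omega>')"
  proof (cases "nondegenerate (\<phi> ` \<Omega>')")
    case True
    obtain \<psi> where "continuous_on UNIV \<phi>" "continuous_on UNIV \<psi>" "\<And>z. \<psi> (\<phi> z) = z" "\<And>z. \<phi> (\<psi> z) = z"
      by (rule affine_automorphism_homeo[OF \<phi>]) (rule that; assumption)
    then have "ring_with_hole (\<phi> ` \<Omega>') (\<phi> ` K')" by (rule ring_with_hole_homeo[OF _ _ _ _ K'])
    then obtain r' R' where r': "0 < r'" "r' < R'" "conformally_equivalent (\<phi> ` \<Omega>') (annulus r' R')"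
      "conformal_modulus (\<phi> ` \<Omega>') = ereal (ln (R' / r'))"
      using nondegenerate_ring_annulus[OF _ True] by metis
    then show ?thesis using est[OF r'(1-3)] by (simp add: \<tau>_def)
  next
    case False
    then show ?thesis by (simp add: conformal_modulus_def)
  qed
  also have "\<dots> \<le> affine_modulus \<Omega>'"
    unfolding affine_modulus_def by (rule SUP_upper) (use \<phi> in simp)
  finally have "ereal \<tau> * ereal (modulus_profile \<tau>) \<le> affine_modulus \<Omega>'" by (simp add: mult.commute)
  then have "ereal (modulus_profile \<tau>) \<le> affine_modulus \<Omega>' / ereal \<tau>"
    using \<tau> by (subst ereal_le_divide_pos) auto
  then show ?thesis unfolding mod by (simp add: \<tau>_def)
qed

theorem theorem1p2:
  shows "\<exists>(\<Phi> :: real \<Rightarrow> real) (lam :: real \<Rightarrow> real).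
    strict_mono_on {0<..} \<Phi> \<and>
    (\<forall>\<tau>>0. 0 < \<Phi> \<tau> \<and> \<Phi> \<tau> < 1) \<and>
    (\<Phi> \<longlongrightarrow> 1) at_top \<and>
    (\<forall>\<tau>>0. \<Phi> \<tau> = lam (coth (pi\<^sup>2 / (2 * \<tau>)))) \<and>
    (\<forall>t\<ge>1. lam t \<ge> (ln t - ln (1 + ln t)) / (2 + ln t)) \<and>
    (\<forall>(\<Omega> :: complex set) (\<Omega>' :: complex set) (h :: complex \<Rightarrow> complex) g.
       doubly_connected_domain \<Omega> \<longrightarrow> doubly_connected_domain \<Omega>' \<longrightarrow> nondegenerate \<Omega> \<longrightarrow>
       harmonic_on h \<Omega> \<longrightarrow> homeomorphism \<Omega> \<Omega>' h g \<longrightarrow>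
       affine_modulus \<Omega>' / conformal_modulus \<Omega> \<ge> ereal (\<Phi> (real_of_ereal (conformal_modulus \<Omega>))))"
proof (rule exI[of _ modulus_profile], rule exI[of _ "\<lambda>t. lower_profile (ln t)"], intro conjI allI impI)
  show "strict_mono_on {0<..} modulus_profile" by (rule modulus_profile_strict_mono)
  show "(modulus_profile \<longlongrightarrow> 1) at_top" by (rule modulus_profile_tendsto)
next
  fix \<tau> :: real assume "0 < \<tau>"
  then show "0 < modulus_profile \<tau>" "modulus_profile \<tau> < 1" by (rule modulus_profile_bounds)+
  show "modulus_profile \<tau> = lower_profile (ln (coth (pi\<^sup>2 / (2 * \<tau>))))"
    by (simp add: modulus_profile_def mid_circle_bound_def)
next
  fix t :: real
  show "lower_profile (ln t) \<ge> (ln t - ln (1 + ln t)) / (2 + ln t)" by (simp add: lower_profile_def)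
next
  fix \<Omega> \<Omega>' :: "complex set" and h g
  assume "doubly_connected_domain \<Omega>" "doubly_connected_domain \<Omega>'" "nondegenerate \<Omega>"
    "harmonic_on h \<Omega>" "homeomorphism \<Omega> \<Omega>' h g"
  then show "affine_modulus \<Omega>' / conformal_modulus \<Omega> \<ge> ereal (modulus_profile (real_of_ereal (conformal_modulus \<Omega>)))"
    by (rule harmonic_affine_modulus_ratio)
qed

end
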